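(* For $n\geq 1$, let $M=\mathbb{B}^{2n}$ be the unit ball in $\mathbb{R}^{2n}$ equipped with the (Euclidean) metric $dr^2\oplus r^2g_{\mathbb{S}^{2n-1}}$, where $r=|x|$ and $x=(x_1,y_1,x_2,y_2,\ldots,x_n,y_n)\in\mathbb{R}^{2n}$. Let $\eta$ be the magnetic potential on the ball given by $\eta=\sum_{j=1}^n(-y_j\partial_{x_j}+x_j\partial_{y_j})$. Then, for small $t>0$, $$\sigma^{t\eta}_{1,1}(M)<\sigma_{1,1}(M).$$
   Context: Vector fields are identified with real $1$-forms via the metric. For a real $1$-form $\eta$ (magnetic potential) on a compact Riemannian manifold $M$ with boundary, set $d^\eta:=d+i\eta\wedge$, $\delta^\eta:=\delta-i\eta\lrcorner$ ($\delta$ the formal $L^2$-adjoint of $d$), $\Delta^\eta:=d^\eta\delta^\eta+\delta^\eta d^\eta$, acting on smooth complex forms. Let $\iota:\partial M\to M$ be the inclusion and $\nu$ the inward unit normal along $\partial M$. For every $\psi\in\Omega^k(\partial M,\mathbb{C})$ there is a unique $\hat\psi\in\Omega^k(M,\mathbb{C})$ with $\Delta^\eta\hat\psi=0$ on $M$ and $\iota^*\hat\psi=\psi$, $\nu\lrcorner\hat\psi=0$ on $\partial M$. The magnetic Steklov operator on $k$-forms is $T^{[k],\eta}:\Omega^k(\partial M,\mathbb{C})\to\Omega^k(\partial M,\mathbb{C})$, $T^{[k],\eta}\psi:=-\nu\lrcorner d^\eta\hat\psi$. It has a discrete non-negative spectrum $\sigma^\eta_{1,k}(M)\leq\sigma^\eta_{2,k}(M)\leq\cdots$;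 $\sigma_{1,k}^\eta(M)$ denotes the lowest eigenvalue and $\sigma_{1,k}(M):=\sigma^0_{1,k}(M)$. *)

theory Defs
  imports "HOL-Analysis.Analysis"
begin

section \<open>Smooth functions\<close>

primrec Ck_on :: "nat \<Rightarrow> 'a::euclidean_space set \<Rightarrow> ('a \<Rightarrow> 'b::real_normed_vector) \<Rightarrow> bool" where
  "Ck_on 0 U f \<longleftrightarrow> continuous_on U f"
| "Ck_on (Suc k) U f \<longleftrightarrow> (\<forall>x\<in>U. f differentiable (at x)) \<and>
     (\<forall>v. Ck_on k U (\<lambda>x. frechet_derivative f (at x) v))"

text \<open>On a set that need not be open, smooth means: the restriction of a smooth function on an
  open neighbourhood. For a manifold with boundary this is smoothness up to the boundary, for an
  embedded hypersurface it is smoothness on the hypersurface.\<close>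

definition smooth_on :: "'a::euclidean_space set \<Rightarrow> ('a \<Rightarrow> 'b::real_normed_vector) \<Rightarrow> bool" where
  "smooth_on S f \<longleftrightarrow> (\<exists>U g. open U \<and> S \<subseteq> U \<and> (\<forall>k. Ck_on k U g) \<and> (\<forall>x\<in>S. g x = f x))"


section \<open>Complex differential forms on a domain of Euclidean space and on its boundary\<close>

text \<open>A complex form assigns to a point a function of the list of its vector arguments.
  The values outside the relevant points, on vectors that are not tangent, and on lists of
  the wrong length are 0, so that equality of forms is equality of functions.\<close>

type_synonym 'a cform = "'a \<Rightarrow> 'a list \<Rightarrow> complex"

definition alternating_form :: "nat \<Rightarrow> 'a::real_vector set \<Rightarrow> ('a list \<Rightarrow> complex) \<Rightarrow> bool" where
  "alternating_form k V \<phi> \<longleftrightarrow>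
     (\<forall>vs. length vs \<noteq> k \<or> \<not> set vs \<subseteq> V \<longrightarrow> \<phi> vs = 0) \<and>
     (\<forall>us ws u v c. length us + length ws + 1 = k \<and> set us \<union> set ws \<union> {u, v} \<subseteq> V \<longrightarrow>
        \<phi> (us @ (c *\<^sub>R u + v) # ws) = c *\<^sub>R \<phi> (us @ u # ws) + \<phi> (us @ v # ws)) \<and>
     (\<forall>vs. \<not> distinct vs \<longrightarrow> \<phi> vs = 0)"

definition forms :: "nat \<Rightarrow> 'a::euclidean_space set \<Rightarrow> 'a cform set" where
  "forms k M = {\<omega>. (\<forall>x\<in>M. alternating_form k UNIV (\<omega> x)) \<and> (\<forall>x. x \<notin> M \<longrightarrow> \<omega> x = (\<lambda>_. 0)) \<and>
     (\<forall>vs. smooth_on M (\<lambda>x. \<omega> x vs))}"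

text \<open>Throughout, \<open>M\<close> is a compact domain with smooth boundary \<open>frontier M\<close>,
  and \<open>\<nu>\<close> is a vector field that is the inward unit normal along \<open>frontier M\<close>.\<close>

definition tangent_space :: "('a::real_inner \<Rightarrow> 'a) \<Rightarrow> 'a \<Rightarrow> 'a set" where
  "tangent_space \<nu> x = {v. v \<bullet> \<nu> x = 0}"

definition boundary_forms ::
    "nat \<Rightarrow> 'a::euclidean_space set \<Rightarrow> ('a \<Rightarrow> 'a) \<Rightarrow> 'a cform set" where
  "boundary_forms k M \<nu> = {\<psi>.
     (\<forall>x\<in>frontier M. alternating_form k (tangent_space \<nu> x) (\<psi> x)) \<and>
     (\<forall>x. x \<notin> frontier M \<longrightarrow> \<psi> x = (\<lambda>_. 0)) \<and>
     (\<forall>Xs. (\<forall>X\<in>set Xs. smooth_on (frontier M) X \<and> (\<forall>x\<in>frontier M. X x \<in> tangent_space \<nu> x)) \<longrightarrow>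
        smooth_on (frontier M) (\<lambda>x. \<psi> x (map (\<lambda>X. X x) Xs)))}"

definition boundary_pullback ::
    "'a::euclidean_space set \<Rightarrow> ('a \<Rightarrow> 'a) \<Rightarrow> 'a cform \<Rightarrow> 'a cform" where
  "boundary_pullback M \<nu> \<omega> x vs =
     (if x \<in> frontier M \<and> set vs \<subseteq> tangent_space \<nu> x then \<omega> x vs else 0)"

definition remove_nth :: "nat \<Rightarrow> 'a list \<Rightarrow> 'a list" where
  "remove_nth i vs = take i vs @ drop (Suc i) vs"

definition ext_deriv :: "'a::euclidean_space set \<Rightarrow> 'a cform \<Rightarrow> 'a cform" where
  "ext_deriv M \<omega> x vs = (if x \<in> M then
     \<Sum>i<length vs. (-1) ^ i *
       frechet_derivative (\<lambda>y. \<omega> y (remove_nth i vs)) (at x within M) (vs ! i) else 0)"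

text \<open>The formal \<open>L\<^sup>2\<close>-adjoint of the exterior derivative for the Euclidean metric,
  \<open>\<delta> = - \<Sum>\<^sub>b b \<lrcorner> \<nabla>\<^sub>b\<close> with \<open>b\<close> ranging over an orthonormal basis;
  \<open>codiff_formal_adjoint\<close> below establishes the adjointness.\<close>

definition codiff :: "'a::euclidean_space set \<Rightarrow> 'a cform \<Rightarrow> 'a cform" where
  "codiff M \<omega> x vs = (if x \<in> M then
     - (\<Sum>b\<in>Basis. frechet_derivative (\<lambda>y. \<omega> y (b # vs)) (at x within M) b) else 0)"

text \<open>Real 1-forms are identified with vector fields via the Euclidean metric.\<close>

definition wedge1 :: "('a::real_inner \<Rightarrow> 'a) \<Rightarrow> 'a cform \<Rightarrow> 'a cform" where
  "wedge1 \<eta> \<omega> x vs =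
     (\<Sum>i<length vs. (-1) ^ i * of_real (\<eta> x \<bullet> vs ! i) * \<omega> x (remove_nth i vs))"

definition interior_product :: "('a \<Rightarrow> 'a) \<Rightarrow> 'a cform \<Rightarrow> 'a cform" where
  "interior_product X \<omega> x vs = \<omega> x (X x # vs)"


section \<open>The magnetic Hodge Laplacian and the magnetic Steklov operator\<close>

definition magnetic_d ::
    "'a::euclidean_space set \<Rightarrow> ('a \<Rightarrow> 'a) \<Rightarrow> 'a cform \<Rightarrow> 'a cform" where
  "magnetic_d M \<eta> \<omega> x vs = ext_deriv M \<omega> x vs + \<i> * wedge1 \<eta> \<omega> x vs"

definition magnetic_codiff ::
    "'a::euclidean_space set \<Rightarrow> ('a \<Rightarrow> 'a) \<Rightarrow> 'a cform \<Rightarrow> 'a cform" where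
  "magnetic_codiff M \<eta> \<omega> x vs = codiff M \<omega> x vs - \<i> * interior_product \<eta> \<omega> x vs"

definition magnetic_laplacian ::
    "'a::euclidean_space set \<Rightarrow> ('a \<Rightarrow> 'a) \<Rightarrow> 'a cform \<Rightarrow> 'a cform" where
  "magnetic_laplacian M \<eta> \<omega> x vs =
     magnetic_d M \<eta> (magnetic_codiff M \<eta> \<omega>) x vs + magnetic_codiff M \<eta> (magnetic_d M \<eta> \<omega>) x vs"

definition steklov_extension ::
    "nat \<Rightarrow> 'a::euclidean_space set \<Rightarrow> ('a \<Rightarrow> 'a) \<Rightarrow> ('a \<Rightarrow> 'a) \<Rightarrow> 'a cform \<Rightarrow> 'a cform \<Rightarrow> bool" where
  "steklov_extension k M \<nu> \<eta> \<psi> \<omega> \<longleftrightarrow> \<omega> \<in> forms k M \<and>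
     (\<forall>x\<in>M. \<forall>vs. magnetic_laplacian M \<eta> \<omega> x vs = 0) \<and>
     boundary_pullback M \<nu> \<omega> = \<psi> \<and>
     (\<forall>x\<in>frontier M. \<forall>vs. interior_product \<nu> \<omega> x vs = 0)"

text \<open>The operator is given by its graph: \<open>(\<psi>, \<phi>)\<close> belongs to it iff
  \<open>\<phi> = - \<nu> \<lrcorner> d\<^sup>\<eta> \<omega>\<close> on the boundary, where \<open>\<omega>\<close> is the extension of \<open>\<psi>\<close>, which
  exists and is unique for every \<open>\<psi>\<close> in \<open>boundary_forms k M \<nu>\<close>.\<close>

definition magnetic_steklov ::
    "nat \<Rightarrow> 'a::euclidean_space set \<Rightarrow> ('a \<Rightarrow> 'a) \<Rightarrow> ('a \<Rightarrow> 'a) \<Rightarrow> ('a cform \<times> 'a cform) set" where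
  "magnetic_steklov k M \<nu> \<eta> = {(\<psi>, \<phi>). \<psi> \<in> boundary_forms k M \<nu> \<and>
     (\<exists>\<omega>. steklov_extension k M \<nu> \<eta> \<psi> \<omega> \<and>
        \<phi> = (\<lambda>x vs. - boundary_pullback M \<nu> (interior_product \<nu> (magnetic_d M \<eta> \<omega>)) x vs))}"

definition steklov_eigenvalue ::
    "nat \<Rightarrow> 'a::euclidean_space set \<Rightarrow> ('a \<Rightarrow> 'a) \<Rightarrow> ('a \<Rightarrow> 'a) \<Rightarrow> real \<Rightarrow> bool" where
  "steklov_eigenvalue k M \<nu> \<eta> \<sigma> \<longleftrightarrow>
     (\<exists>\<psi>. \<psi> \<noteq> (\<lambda>_ _. 0) \<and> (\<psi>, \<lambda>x vs. of_real \<sigma> * \<psi> x vs) \<in> magnetic_steklov k M \<nu> \<eta>)"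

text \<open>The spectrum is discrete and non-negative, so the infimum is the lowest eigenvalue.\<close>

definition lowest_steklov_eigenvalue ::
    "nat \<Rightarrow> 'a::euclidean_space set \<Rightarrow> ('a \<Rightarrow> 'a) \<Rightarrow> ('a \<Rightarrow> 'a) \<Rightarrow> real" where
  "lowest_steklov_eigenvalue k M \<nu> \<eta> = Inf {\<sigma>. steklov_eigenvalue k M \<nu> \<eta> \<sigma>}"


section \<open>Adjointness of the exterior derivative and the codifferential\<close>

lemma alternating_form_swap:
  assumes w: "alternating_form k UNIV w"
  shows "w (us @ a # b # ws) = - w (us @ b # a # ws)"
proof (cases "length us + length ws + 2 = k")
  case True
  have lin: "w (xs @ (c *\<^sub>R u + v) # ys) = c *\<^sub>R w (xs @ u # ys) + w (xs @ v # ys)"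
    if "length xs + length ys + 1 = k" for xs ys u v c
    using w that unfolding alternating_form_def by simp
  have add1: "w (us @ (u + v) # c # ws) = w (us @ u # c # ws) + w (us @ v # c # ws)" for u v c
    using lin[of us "c # ws" 1 u v] True by simp
  have add2: "w (us @ c # (u + v) # ws) = w (us @ c # u # ws) + w (us @ c # v # ws)" for u v c
    using lin[of "us @ [c]" ws 1 u v] True by simp
  have z: "w (us @ c # c # ws) = 0" for c
    using w unfolding alternating_form_def by auto
  have "0 = w (us @ (a + b) # (a + b) # ws)" by (simp add: z)
  also have "\<dots> = w (us @ a # b # ws) + w (us @ b # a # ws)"
    by (simp only: add1 add2) (simp add: z)
  finally have "w (us @ a # b # ws) + w (us @ b # a # ws) = 0" by (rule sym)
  then show ?thesis by (simp add: eq_neg_iff_add_eq_0)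
next
  case False
  then have "length (us @ a # b # ws) \<noteq> k" "length (us @ b # a # ws) \<noteq> k" by auto
  then show ?thesis using w unfolding alternating_form_def by simp
qed

lemma alternating_form_move:
  assumes w: "alternating_form k UNIV w"
  shows "w (xs @ us @ a # ws) = (-1) ^ length us * w (xs @ a # us @ ws)"
proof (induction us arbitrary: xs)
  case (Cons u us)
  have "w (xs @ (u # us) @ a # ws) = (-1) ^ length us * w (xs @ u # a # us @ ws)"
    using Cons[of "xs @ [u]"] by simp
  also have "w (xs @ u # a # us @ ws) = - w (xs @ a # u # us @ ws)"
    by (rule alternating_form_swap[OF w])
  finally show ?case by simp
qed simp

lemma alternating_form_front:
  assumes "alternating_form k UNIV w" and "i < length vs"
  shows "w vs = (-1) ^ i * w (vs ! i # remove_nth i vs)"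
  using alternating_form_move[OF assms(1), of "[]" "take i vs" "vs ! i" "drop (Suc i) vs"] assms(2)
  by (simp add: remove_nth_def id_take_nth_drop[symmetric] min_def)

definition basis_tuples :: "nat \<Rightarrow> 'a::euclidean_space list set" where
  "basis_tuples k = {vs. set vs \<subseteq> Basis \<and> length vs = k}"

lemma finite_basis_tuples: "finite (basis_tuples k)"
  unfolding basis_tuples_def by (rule finite_lists_length_eq) simp

lemma sum_basis_tuples_remove_nth:
  fixes G :: "'a::euclidean_space list \<Rightarrow> 'a \<Rightarrow> complex"
  assumes i: "i < Suc k"
  shows "(\<Sum>vs\<in>basis_tuples (Suc k). G (remove_nth i vs) (vs ! i)) =
    (\<Sum>us\<in>basis_tuples k. \<Sum>b\<in>Basis. G us b)"
proof -
  have "(\<Sum>vs\<in>basis_tuples (Suc k). G (remove_nth i vs) (vs ! i)) =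
      (\<Sum>(us, b)\<in>basis_tuples k \<times> Basis. G us b)"
  proof (rule sum.reindex_bij_witness[where
        i = "\<lambda>(us, b). take i us @ b # drop i us" and j = "\<lambda>vs. (remove_nth i vs, vs ! i)"])
    fix vs :: "'a list" assume vs: "vs \<in> basis_tuples (Suc k)"
    then have l: "length vs = Suc k" and s: "set vs \<subseteq> Basis" by (auto simp: basis_tuples_def)
    show "(case (remove_nth i vs, vs ! i) of (us, b) \<Rightarrow> take i us @ b # drop i us) = vs"
      using i l by (simp add: remove_nth_def min_def id_take_nth_drop[symmetric])
    show "(remove_nth i vs, vs ! i) \<in> basis_tuples k \<times> Basis"
      using i l s nth_mem[of i vs] set_take_subset[of i vs] set_drop_subset[of "Suc i" vs]
      by (auto simp: basis_tuples_def remove_nth_def)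
  next
    fix p :: "'a list \<times> 'a" assume p: "p \<in> basis_tuples k \<times> Basis"
    obtain us b where [simp]: "p = (us, b)" by (cases p)
    have l: "length us = k" and s: "set us \<subseteq> Basis" "b \<in> Basis" using p by (auto simp: basis_tuples_def)
    show "(remove_nth i (case p of (us, b) \<Rightarrow> take i us @ b # drop i us),
        (case p of (us, b) \<Rightarrow> take i us @ b # drop i us) ! i) = p"
      using i l by (simp add: remove_nth_def min_def nth_append)
    show "(case p of (us, b) \<Rightarrow> take i us @ b # drop i us) \<in> basis_tuples (Suc k)"
      using i l s set_take_subset[of i us] set_drop_subset[of i us]
      by (auto simp: basis_tuples_def)
  qed auto
  then show ?thesis by (simp add: sum.cartesian_product)
qed

definition form_inner ::
    "nat \<Rightarrow> ('a::euclidean_space list \<Rightarrow> complex) \<Rightarrow> ('a list \<Rightarrow> complex) \<Rightarrow> complex" where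
  "form_inner k \<alpha> \<beta> = (\<Sum>vs\<in>basis_tuples k. \<alpha> vs * cnj (\<beta> vs)) / fact k"

lemma form_inner_ext_deriv:
  assumes "x \<in> M" and w: "alternating_form (Suc k) UNIV w"
  shows "form_inner (Suc k) (ext_deriv M \<phi> x) w =
    (\<Sum>us\<in>basis_tuples k. \<Sum>b\<in>Basis.
       frechet_derivative (\<lambda>y. \<phi> y us) (at x within M) b * cnj (w (b # us))) / fact k"
proof -
  let ?A = "\<lambda>us b. frechet_derivative (\<lambda>y. \<phi> y us) (at x within M) b"
  let ?S = "\<Sum>us\<in>basis_tuples k. \<Sum>b\<in>Basis. ?A us b * cnj (w (b # us))"
  have "(\<Sum>vs\<in>basis_tuples (Suc k). ext_deriv M \<phi> x vs * cnj (w vs)) =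
      (\<Sum>vs\<in>basis_tuples (Suc k). \<Sum>i<Suc k.
         ?A (remove_nth i vs) (vs ! i) * cnj (w (vs ! i # remove_nth i vs)))"
  proof (rule sum.cong[OF refl])
    fix vs :: "'a list" assume "vs \<in> basis_tuples (Suc k)"
    then have l: "length vs = Suc k" by (simp add: basis_tuples_def)
    have "(-1) ^ i * ?A (remove_nth i vs) (vs ! i) * cnj (w vs) =
        ?A (remove_nth i vs) (vs ! i) * cnj (w (vs ! i # remove_nth i vs))" if "i < Suc k" for i
    proof -
      have "w vs = (-1) ^ i * w (vs ! i # remove_nth i vs)"
        using alternating_form_front[OF w, of i vs] that l by simp
      then have "cnj (w vs) = (-1) ^ i * cnj (w (vs ! i # remove_nth i vs))" by simp
      moreover have "(-1) ^ i * (-1) ^ i = (1::complex)" by (simp flip: power_mult_distrib)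
      ultimately show ?thesis by (simp add: mult.assoc mult.left_commute[of "(-1) ^ i"])
    qed
    then show "ext_deriv M \<phi> x vs * cnj (w vs) = (\<Sum>i<Suc k.
         ?A (remove_nth i vs) (vs ! i) * cnj (w (vs ! i # remove_nth i vs)))"
      unfolding ext_deriv_def sum_distrib_right l using \<open>x \<in> M\<close>
      by (simp only: if_True sum_distrib_right) (rule sum.cong, auto)
  qed
  also have "\<dots> = (\<Sum>i<Suc k. \<Sum>vs\<in>basis_tuples (Suc k).
         ?A (remove_nth i vs) (vs ! i) * cnj (w (vs ! i # remove_nth i vs)))"
    by (rule sum.swap)
  also have "\<dots> = (\<Sum>i<Suc k. ?S)"
    by (rule sum.cong[OF refl])
      (use sum_basis_tuples_remove_nth[where G = "\<lambda>us b. ?A us b * cnj (w (b # us))"] in simp)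
  also have "\<dots> = of_nat (Suc k) * ?S" by simp
  finally have "form_inner (Suc k) (ext_deriv M \<phi> x) w = of_nat (Suc k) * ?S / fact (Suc k)"
    by (simp add: form_inner_def)
  also have "fact (Suc k) = of_nat (Suc k) * (fact k :: complex)" by (rule fact_Suc)
  finally show ?thesis by (simp del: of_nat_Suc)
qed

lemma integral_derivative_compact_support:
  fixes h :: "'a::euclidean_space \<Rightarrow> complex"
  assumes der: "\<And>x. (h has_derivative h' x) (at x)"
    and cont: "continuous_on UNIV (\<lambda>x. h' x b)"
    and K: "compact K" "\<And>x. x \<notin> K \<Longrightarrow> h x = 0"
  shows "integral\<^sup>L lborel (\<lambda>x. h' x b) = 0"
proof -
  have contD: "continuous_on A (\<lambda>x. h' x b)" for A
    using cont continuous_on_subset by blast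
  have conth: "continuous_on A h" for A
    by (meson der has_derivative_continuous continuous_at_imp_continuous_on)
  have zero: "h' x b = 0" if "x \<notin> K" for x
  proof -
    have "(h has_derivative (\<lambda>_. 0)) (at x)"
      by (rule has_derivative_transform_within_open[of "\<lambda>_. 0" _ x UNIV "- K"])
        (use that K compact_imp_closed in auto)
    then have "h' x = (\<lambda>_. 0)" using der has_derivative_unique by blast
    then show ?thesis by simp
  qed
  obtain C where C: "C > 0" "\<And>x. norm (h' x b) \<le> C"
  proof -
    have "bounded ((\<lambda>x. h' x b) ` K)"
      by (intro compact_imp_bounded compact_continuous_image contD K)
    then obtain C where "C > 0" "\<forall>y\<in>(\<lambda>x. h' x b) ` K. norm y \<le> C"
      by (auto simp: bounded_pos)
    then show ?thesis using zero by (intro that[of C]) force+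
  qed
  define K' where "K' = (\<lambda>(x, s). x - s *\<^sub>R b) ` (K \<times> {0..1::real})"
  have "compact K'" unfolding K'_def
    by (intro compact_continuous_image compact_Times K compact_Icc)
      (auto intro!: continuous_intros simp: split_beta)
  define u where "u n x = of_nat (Suc n) * (h (x + inverse (real (Suc n)) *\<^sub>R b) - h x)" for n x
  have inth: "integrable lborel h"
  proof -
    have "integrable lborel (\<lambda>x. indicator K x *\<^sub>R h x)"
      by (rule borel_integrable_compact[OF K(1) conth])
    moreover have "(\<lambda>x. indicator K x *\<^sub>R h x) = h" using K(2) by (auto simp: indicator_def)
    ultimately show ?thesis by simp
  qed
  have shift: "integrable lborel (\<lambda>x. h (x + c))" "integral\<^sup>L lborel (\<lambda>x. h (x + c)) = integral\<^sup>L lborel h" for c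
  proof -
    have e: "distr lborel borel ((+) c) = (lborel :: 'a measure)" by (rule lborel_distr_plus)
    have m: "h \<in> borel_measurable borel" by (intro borel_measurable_continuous_onI conth)
    have "integrable (distr lborel borel ((+) c)) h" using inth e by simp
    then show "integrable lborel (\<lambda>x. h (x + c))"
      using integrable_distr_eq[of "(+) c" lborel borel h] m by (simp add: add.commute)
    have "integral\<^sup>L lborel h = integral\<^sup>L (distr lborel borel ((+) c)) h" using e by simp
    also have "\<dots> = integral\<^sup>L lborel (\<lambda>x. h (c + x))" using m by (intro integral_distr) auto
    finally show "integral\<^sup>L lborel (\<lambda>x. h (x + c)) = integral\<^sup>L lborel h" by (simp add: add.commute)
  qed
  have intu: "integral\<^sup>L lborel (u n) = 0" for n
    unfolding u_def using shift inth by simp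
  have "(\<lambda>n. integral\<^sup>L lborel (u n)) \<longlonglongrightarrow> integral\<^sup>L lborel (\<lambda>x. h' x b)"
  proof (rule integral_dominated_convergence[where w = "\<lambda>x. C * indicator K' x"])
    show "(\<lambda>x. h' x b) \<in> borel_measurable lborel"
      using borel_measurable_continuous_onI[OF cont] by simp
    have "continuous_on UNIV (\<lambda>x. h (x + c))" for c
      by (rule continuous_on_compose2[OF conth[of UNIV]]) (auto intro!: continuous_intros)
    then show "u n \<in> borel_measurable lborel" for n
      unfolding u_def measurable_lborel2
      by (intro borel_measurable_continuous_onI continuous_intros conth) 
    show "integrable lborel (\<lambda>x. C * indicator K' x)"
      using borel_integrable_compact[OF \<open>compact K'\<close>, of "\<lambda>_. C"]
      by (simp add: mult.commute)
    show "AE x in lborel. (\<lambda>n. u n x) \<longlonglongrightarrow> h' x b"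
    proof (rule AE_I2)
      fix x
      have "((\<lambda>s. x + s *\<^sub>R b) has_derivative (\<lambda>t. t *\<^sub>R b)) (at 0)"
        by (auto intro!: derivative_eq_intros)
      from has_derivative_compose[OF this der]
      have "((\<lambda>s. h (x + s *\<^sub>R b)) has_derivative (\<lambda>t. t *\<^sub>R h' x b)) (at 0)"
        using linear_cmul[OF has_derivative_linear[OF der]] by simp
      then have "((\<lambda>s. norm (h (x + s *\<^sub>R b) - h x - s *\<^sub>R h' x b) / norm s) \<longlongrightarrow> 0) (at 0)"
        by (simp add: has_derivative_at)
      moreover have "\<forall>\<^sub>F s in at 0. norm (h (x + s *\<^sub>R b) - h x - s *\<^sub>R h' x b) / norm s =
          norm ((h (x + s *\<^sub>R b) - h x) /\<^sub>R s - h' x b)"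
      proof -
        have "norm (h (x + s *\<^sub>R b) - h x - s *\<^sub>R h' x b) / norm s =
          norm ((h (x + s *\<^sub>R b) - h x) /\<^sub>R s - h' x b)" if "s \<noteq> 0" for s
        proof -
          have "(h (x + s *\<^sub>R b) - h x) /\<^sub>R s - h' x b =
              (h (x + s *\<^sub>R b) - h x - s *\<^sub>R h' x b) /\<^sub>R s"
            using that by (simp add: scaleR_diff_right)
          then show ?thesis by (simp add: divide_inverse_commute)
        qed
        then show ?thesis by (auto simp: eventually_at_filter)
      qed
      ultimately have "((\<lambda>s. norm ((h (x + s *\<^sub>R b) - h x) /\<^sub>R s - h' x b)) \<longlongrightarrow> 0) (at 0)"
        by (rule Lim_transform_eventually)
      then have lim: "((\<lambda>s. (h (x + s *\<^sub>R b) - h x) /\<^sub>R s) \<longlongrightarrow> h' x b) (at 0)"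
        by (simp only: tendsto_norm_zero_iff Lim_null[symmetric])
      have "filterlim (\<lambda>n. inverse (real (Suc n))) (at 0) sequentially"
        unfolding filterlim_at using LIMSEQ_inverse_real_of_nat by auto
      from filterlim_compose[OF lim this]
      show "(\<lambda>n. u n x) \<longlonglongrightarrow> h' x b"
        by (simp add: u_def scaleR_conv_of_real del: of_nat_Suc)
    qed
    show "AE x in lborel. norm (u n x) \<le> C * indicator K' x" for n
    proof (rule AE_I2)
      fix x
      let ?s = "inverse (real (Suc n))"
      have s: "0 \<le> ?s" "?s \<le> 1" by (auto simp: inverse_le_1_iff)
      show "norm (u n x) \<le> C * indicator K' x"
      proof (cases "x \<in> K'")
        case True
        have "norm (h (x + ?s *\<^sub>R b) - h (x + 0 *\<^sub>R b)) \<le> C * norm (?s - 0)"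
        proof (rule differentiable_bound[of "UNIV" "\<lambda>s. h (x + s *\<^sub>R b)" "\<lambda>s t. h' (x + s *\<^sub>R b) (t *\<^sub>R b)"])
          fix r :: real
          have "((\<lambda>s. x + s *\<^sub>R b) has_derivative (\<lambda>t. t *\<^sub>R b)) (at r)"
            by (auto intro!: derivative_eq_intros)
          from has_derivative_compose[OF this der]
          show "((\<lambda>s. h (x + s *\<^sub>R b)) has_derivative (\<lambda>t. h' (x + r *\<^sub>R b) (t *\<^sub>R b))) (at r within UNIV)"
            by simp
          have lin: "linear (h' (x + r *\<^sub>R b))" using der has_derivative_linear by blast
          show "onorm (\<lambda>t. h' (x + r *\<^sub>R b) (t *\<^sub>R b)) \<le> C"
            using C(2)[of "x + r *\<^sub>R b"] C(1)
            by (intro onorm_bound) (auto simp: linear_cmul[OF lin] mult.commute[of C] intro!: mult_left_mono)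
        qed auto
        then have "norm (h (x + ?s *\<^sub>R b) - h x) \<le> C * ?s" using s by simp
        then have "real (Suc n) * norm (h (x + ?s *\<^sub>R b) - h x) \<le> real (Suc n) * (C * ?s)"
          by (rule mult_left_mono) simp
        also have "\<dots> = C" by simp
        finally show ?thesis using True by (simp add: u_def norm_mult del: of_nat_Suc)
      next
        case False
        have "x + r *\<^sub>R b \<notin> K" if "0 \<le> r" "r \<le> 1" for r
        proof
          assume "x + r *\<^sub>R b \<in> K"
          then have "(x + r *\<^sub>R b) - r *\<^sub>R b \<in> K'" unfolding K'_def using that by force
          then show False using False by simp
        qed
        from this[of ?s] this[of 0] s have "u n x = 0" by (simp add: u_def K(2))
        then show ?thesis using False by simp
      qed
    qed
  qed
  then show ?thesis using intu by (simp add: LIMSEQ_const_iff)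
qed

lemma smooth_on_interior:
  fixes f :: "'a::euclidean_space \<Rightarrow> complex"
  assumes "smooth_on M f"
  shows "x \<in> interior M \<Longrightarrow> (f has_derivative frechet_derivative f (at x within M)) (at x)"
    and "continuous_on (interior M) f"
    and "continuous_on (interior M) (\<lambda>x. frechet_derivative f (at x within M) v)"
proof -
  obtain U g where U: "open U" "M \<subseteq> U" and g: "\<And>k. Ck_on k U g" and eq: "\<And>x. x \<in> M \<Longrightarrow> g x = f x"
    using assms unfolding smooth_on_def by blast
  have IM: "interior M \<subseteq> M" by (rule interior_subset)
  then have sub: "interior M \<subseteq> U" using U(2) by (rule order_trans)
  have fd: "(f has_derivative frechet_derivative g (at x)) (at x)" if "x \<in> interior M" for x
  proof -
    have "(g has_derivative frechet_derivative g (at x)) (at x)"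
    proof -
      have "\<forall>x\<in>U. g differentiable (at x)" using g[of "Suc 0"] unfolding Ck_on.simps by (rule conjunct1)
      then have "g differentiable (at x)" using sub that by blast
      then show ?thesis by (simp only: frechet_derivative_works)
    qed
    then show ?thesis
      by (rule has_derivative_transform_within_open[of _ _ _ _ "interior M"])
        (use that eq IM in auto)
  qed
  have fe: "frechet_derivative f (at x within M) = frechet_derivative g (at x)" if "x \<in> interior M" for x
    unfolding at_within_interior[OF that] using frechet_derivative_at[OF fd[OF that]] by (rule sym)
  show "x \<in> interior M \<Longrightarrow> (f has_derivative frechet_derivative f (at x within M)) (at x)"
    using fd fe by simp
  have "continuous_on (interior M) g"
    using g[of 0, unfolded Ck_on.simps] sub by (rule continuous_on_subset)
  then show "continuous_on (interior M) f"
    by (rule continuous_on_eq) (use eq IM in blast)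
  have "continuous_on (interior M) (\<lambda>x. frechet_derivative g (at x) v)"
  proof -
    have "continuous_on U (\<lambda>x. frechet_derivative g (at x) v)"
      using g[of "Suc 0", unfolded Ck_on.simps, THEN conjunct2] by (rule spec)
    then show ?thesis using sub by (rule continuous_on_subset)
  qed
  then show "continuous_on (interior M) (\<lambda>x. frechet_derivative f (at x within M) v)"
    by (rule continuous_on_eq) (simp add: fe)
qed

lemma set_integrable_compact_support:
  fixes f :: "'a::euclidean_space \<Rightarrow> complex"
  assumes "continuous_on U f" "compact K" "K \<subseteq> U" "\<And>x. x \<in> U - K \<Longrightarrow> f x = 0"
  shows "set_integrable lborel U f"
proof -
  have "integrable lborel (\<lambda>x. indicator K x *\<^sub>R f x)"
    by (rule borel_integrable_compact) (use assms continuous_on_subset in auto)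
  moreover have "(\<lambda>x. indicator K x *\<^sub>R f x) = (\<lambda>x. indicator U x *\<^sub>R f x)"
    using assms(3,4) by (auto simp: indicator_def fun_eq_iff)
  ultimately show ?thesis by (simp add: set_integrable_def)
qed

text \<open>The forms \<open>\<phi>\<close> are those with compact support in the interior of \<open>M\<close>.\<close>

theorem codiff_formal_adjoint:
  fixes M :: "'a::euclidean_space set"
  assumes \<phi>: "\<phi> \<in> forms k M" and \<omega>: "\<omega> \<in> forms (Suc k) M"
    and K: "compact K" "K \<subseteq> interior M" "\<And>x. x \<notin> K \<Longrightarrow> \<phi> x = (\<lambda>_. 0)"
  shows "set_integrable lborel (interior M) (\<lambda>x. form_inner (Suc k) (ext_deriv M \<phi> x) (\<omega> x))"
    and "set_integrable lborel (interior M) (\<lambda>x. form_inner k (\<phi> x) (codiff M \<omega> x))"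
    and "(LINT x:interior M|lborel. form_inner (Suc k) (ext_deriv M \<phi> x) (\<omega> x)) =
      (LINT x:interior M|lborel. form_inner k (\<phi> x) (codiff M \<omega> x))"
proof -
  let ?D = "\<lambda>f x. frechet_derivative f (at x within M)"
  let ?I = "interior M"
  let ?P = "\<lambda>us b x. ?D (\<lambda>y. \<phi> y us) x b * cnj (\<omega> x (b # us))"
  let ?Q = "\<lambda>us b x. \<phi> x us * cnj (?D (\<lambda>y. \<omega> y (b # us)) x b)"
  have I: "?I \<subseteq> M" by (rule interior_subset)
  have s\<phi>: "smooth_on M (\<lambda>x. \<phi> x us)" and s\<omega>: "smooth_on M (\<lambda>x. \<omega> x us)" for us
    using \<phi> \<omega> by (auto simp: forms_def)
  note \<phi>D = smooth_on_interior[OF s\<phi>] and \<omega>D = smooth_on_interior[OF s\<omega>]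
  have \<phi>0: "?D (\<lambda>y. \<phi> y us) x b = 0" if "x \<in> ?I - K" for us x b
  proof -
    have "((\<lambda>y. \<phi> y us) has_derivative (\<lambda>_. 0)) (at x)"
      by (rule has_derivative_transform_within_open[of "\<lambda>_. 0" _ x UNIV "- K"])
        (use that K compact_imp_closed in auto)
    then have "?D (\<lambda>y. \<phi> y us) x = (\<lambda>_. 0)"
      using \<phi>D(1)[of x us] that has_derivative_unique by blast
    then show ?thesis by simp
  qed
  have iP: "set_integrable lborel ?I (?P us b)" for us b
    by (rule set_integrable_compact_support[OF _ K(1,2)])
      (auto intro!: continuous_intros \<phi>D(3) \<omega>D(2) simp: \<phi>0)
  have iQ: "set_integrable lborel ?I (?Q us b)" for us b
    by (rule set_integrable_compact_support[OF _ K(1,2)])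
      (auto intro!: continuous_intros \<phi>D(2) \<omega>D(3) simp: K(3))
  have PQ: "(LINT x:?I|lborel. ?P us b x) = - (LINT x:?I|lborel. ?Q us b x)" for us b
  proof -
    define h where "h x = \<phi> x us * cnj (\<omega> x (b # us))" for x
    define h' where "h' x v = (if x \<in> ?I then \<phi> x us * cnj (?D (\<lambda>y. \<omega> y (b # us)) x v) +
      ?D (\<lambda>y. \<phi> y us) x v * cnj (\<omega> x (b # us)) else 0)" for x v
    have "integral\<^sup>L lborel (\<lambda>x. h' x b) = 0"
    proof (rule integral_derivative_compact_support[OF _ _ K(1)])
      show "h x = 0" if "x \<notin> K" for x using K(3)[OF that] by (simp add: h_def)
      show "(h has_derivative h' x) (at x)" for x
      proof (cases "x \<in> ?I")
        case True
        have "(h has_derivative (\<lambda>v. \<phi> x us * cnj (?D (\<lambda>y. \<omega> y (b # us)) x v) +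
            ?D (\<lambda>y. \<phi> y us) x v * cnj (\<omega> x (b # us)))) (at x)"
          unfolding h_def
          by (intro has_derivative_mult has_derivative_cnj \<phi>D(1) \<omega>D(1) True)
        moreover have "(\<lambda>v. \<phi> x us * cnj (?D (\<lambda>y. \<omega> y (b # us)) x v) +
            ?D (\<lambda>y. \<phi> y us) x v * cnj (\<omega> x (b # us))) = h' x"
          using True by (simp add: h'_def fun_eq_iff)
        ultimately show ?thesis by simp
      next
        case False
        then have "x \<notin> K" using K(2) by blast
        have "(h has_derivative (\<lambda>_. 0)) (at x)"
          by (rule has_derivative_transform_within_open[of "\<lambda>_. 0" _ x UNIV "- K"])
            (use \<open>x \<notin> K\<close> K compact_imp_closed in \<open>auto simp: h_def\<close>)
        moreover have "h' x = (\<lambda>_. 0)" using False by (simp add: h'_def fun_eq_iff)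
        ultimately show ?thesis by simp
      qed
      have "continuous_on (?I \<union> - K) (\<lambda>x. h' x b)"
      proof (rule continuous_on_open_Un)
        have "continuous_on ?I (\<lambda>x. \<phi> x us * cnj (?D (\<lambda>y. \<omega> y (b # us)) x b) +
            ?D (\<lambda>y. \<phi> y us) x b * cnj (\<omega> x (b # us)))"
          by (intro continuous_intros \<phi>D(2,3) \<omega>D(2,3))
        then show "continuous_on ?I (\<lambda>x. h' x b)"
          by (rule continuous_on_eq) (simp add: h'_def)
        have "h' x b = 0" if "x \<in> - K" for x
          using that \<phi>0[of x us b] K(3)[of x] by (auto simp: h'_def)
        then show "continuous_on (- K) (\<lambda>x. h' x b)"
          by (intro continuous_on_eq[OF continuous_on_const[of _ 0]]) simp
      qed (use K compact_imp_closed in auto)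
      moreover have "?I \<union> - K = UNIV" using K(2) by blast
      ultimately show "continuous_on UNIV (\<lambda>x. h' x b)" by simp
    qed
    moreover have "integral\<^sup>L lborel (\<lambda>x. h' x b) = (LINT x:?I|lborel. ?Q us b x + ?P us b x)"
      unfolding set_lebesgue_integral_def
      by (rule Bochner_Integration.integral_cong) (auto simp: h'_def indicator_def)
    moreover have "\<dots> = (LINT x:?I|lborel. ?Q us b x) + (LINT x:?I|lborel. ?P us b x)"
      by (rule set_integral_add(2)[OF iQ iP])
    ultimately show ?thesis by (simp add: eq_neg_iff_add_eq_0 add.commute)
  qed
  have L: "form_inner (Suc k) (ext_deriv M \<phi> x) (\<omega> x) =
      (\<Sum>us\<in>basis_tuples k. \<Sum>b\<in>Basis. ?P us b x) / fact k" if "x \<in> ?I" for x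
    using form_inner_ext_deriv[of x M k "\<omega> x" \<phi>] that I \<omega> by (auto simp: forms_def)
  have R: "form_inner k (\<phi> x) (codiff M \<omega> x) =
      (\<Sum>us\<in>basis_tuples k. \<Sum>b\<in>Basis. - ?Q us b x) / fact k" if "x \<in> ?I" for x
    using that I by (auto simp: form_inner_def codiff_def sum_distrib_left sum_negf)
  have int_sum: "(LINT x:?I|lborel. (\<Sum>us\<in>basis_tuples k. \<Sum>b\<in>Basis. F us b x) / fact k) =
      (\<Sum>us\<in>basis_tuples k. \<Sum>b\<in>Basis. (LINT x:?I|lborel. F us b x)) / fact k"
    if "\<And>us b. set_integrable lborel ?I (F us b)" for F :: "'a list \<Rightarrow> 'a \<Rightarrow> 'a \<Rightarrow> complex"
  proof -
    have i: "integrable lborel (\<lambda>x. indicator ?I x *\<^sub>R F us b x)" for us b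
      using that by (simp add: set_integrable_def)
    have "(LINT x:?I|lborel. (\<Sum>us\<in>basis_tuples k. \<Sum>b\<in>Basis. F us b x) / fact k) =
        (LINT x:?I|lborel. (\<Sum>us\<in>basis_tuples k. \<Sum>b\<in>Basis. F us b x)) / fact k"
      by (rule set_integral_divide_zero)
    also have "(LINT x:?I|lborel. (\<Sum>us\<in>basis_tuples k. \<Sum>b\<in>Basis. F us b x)) =
        (\<Sum>us\<in>basis_tuples k. \<Sum>b\<in>Basis. (LINT x:?I|lborel. F us b x))"
      unfolding set_lebesgue_integral_def
      by (simp only: scaleR_sum_right Bochner_Integration.integral_sum i
          Bochner_Integration.integrable_sum)
    finally show ?thesis .
  qed
  have iL: "set_integrable lborel ?I (\<lambda>x. (\<Sum>us\<in>basis_tuples k. \<Sum>b\<in>Basis. ?P us b x) / fact k)"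
    using iP unfolding set_integrable_def
    by (intro set_integrable_divide[unfolded set_integrable_def])
      (simp only: scaleR_sum_right, intro Bochner_Integration.integrable_sum)
  have iR: "set_integrable lborel ?I (\<lambda>x. (\<Sum>us\<in>basis_tuples k. \<Sum>b\<in>Basis. - ?Q us b x) / fact k)"
    using iQ unfolding set_integrable_def
    by (intro set_integrable_divide[unfolded set_integrable_def])
      (simp only: scaleR_sum_right scaleR_minus_right,
       intro Bochner_Integration.integrable_sum Bochner_Integration.integrable_minus)
  show "set_integrable lborel ?I (\<lambda>x. form_inner (Suc k) (ext_deriv M \<phi> x) (\<omega> x))"
    using iL L by (subst set_integrable_cong[OF refl refl L]) auto
  show "set_integrable lborel ?I (\<lambda>x. form_inner k (\<phi> x) (codiff M \<omega> x))"
    using iR R by (subst set_integrable_cong[OF refl refl R]) auto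
  have "(LINT x:?I|lborel. form_inner (Suc k) (ext_deriv M \<phi> x) (\<omega> x)) =
      (LINT x:?I|lborel. (\<Sum>us\<in>basis_tuples k. \<Sum>b\<in>Basis. ?P us b x) / fact k)"
    by (rule set_lebesgue_integral_cong) (use L in auto)
  also have "\<dots> = (\<Sum>us\<in>basis_tuples k. \<Sum>b\<in>Basis. (LINT x:?I|lborel. ?P us b x)) / fact k"
    by (rule int_sum) (rule iP)
  also have "\<dots> = (\<Sum>us\<in>basis_tuples k. \<Sum>b\<in>Basis. (LINT x:?I|lborel. - ?Q us b x)) / fact k"
    by (simp only: PQ set_integral_uminus[OF iQ])
  also have "\<dots> = (LINT x:?I|lborel. (\<Sum>us\<in>basis_tuples k. \<Sum>b\<in>Basis. - ?Q us b x) / fact k)"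
    by (rule int_sum[symmetric]) (use iQ in \<open>simp add: set_integrable_def\<close>)
  also have "\<dots> = (LINT x:?I|lborel. form_inner k (\<phi> x) (codiff M \<omega> x))"
    by (rule set_lebesgue_integral_cong) (use R in auto)
  finally show "(LINT x:?I|lborel. form_inner (Suc k) (ext_deriv M \<phi> x) (\<omega> x)) =
      (LINT x:?I|lborel. form_inner k (\<phi> x) (codiff M \<omega> x))" .
qed

end

theory Submission
  imports Defs
begin

text \<open>
  At \<open>t = 0\<close> a Steklov eigenform has harmonic components \<open>w\<^sub>b\<close> with \<open>h = \<Sum>\<^sub>b x\<^sub>b w\<^sub>b = 0\<close>
  on the sphere, where moreover \<open>E w\<^sub>b = (\<sigma> - 1) w\<^sub>b + x\<^sub>b E h\<close> for the Euler operator
  \<open>E = \<Sum>\<^sub>b x\<^sub>b \<partial>\<^sub>b\<close>. Uniqueness for the Dirichlet problem, which needs only the maximum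
  principle, turns these boundary identities into the ordinary differential equation
  \<open>2 E\<^sup>2 G + (m - 2 \<sigma>) E G - \<sigma> (m - 2) G = 0\<close> along rays for a harmonic \<open>G\<close> with
  \<open>4 h = (\<bar>x\<bar>\<^sup>2 - 1) G\<close>, where \<open>m = 2 n\<close>. If \<open>\<sigma> < 1 + 2/m\<close>, both indicial roots are below 1,
  which forces \<open>G\<close> and then the form to vanish. So \<open>\<sigma>\<^sub>1\<^sub>,\<^sub>1 \<ge> 1 + 1/n\<close>.

  For small \<open>t\<close> the spectrum is bounded below, again by the maximum principle, and there is an explicit
  eigenform \<open>F(\<bar>x\<bar>\<^sup>2) \<ell> + \<ell>(x) H(\<bar>x\<bar>\<^sup>2) r dr\<close> with \<open>\<ell>\<close> a conjugate complex coordinate. Its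
  eigenvalue is \<open>1 + 1/n + t ((2 - 1/n) P'(t)/P(t) + 1/n Q'(t)/Q(t))\<close>, where \<open>P\<close> and \<open>Q\<close> are
  entire functions with value 1 and negative derivative at 0; at \<open>t = 0\<close> it attains the lower bound.
\<close>

section \<open>Closure properties of \<open>C\<^sup>k\<close> functions\<close>

text \<open>Two values of \<open>Inf\<close> are compared, which shapes the argument: for
  \<open>t = 0\<close> the bound 1 + 1/n on all eigenvalues must come with an existing eigenvalue,
  and for small \<open>t\<close> one eigenvalue below 1 + 1/n must come with a lower bound of the
  whole set, because \<open>Inf\<close> of an empty or unbounded set carries no information. The
  strict inequality is an effect of first order in t. The part of the magnetic Laplacian that is
  linear in t is -2i times the Lie derivative of one-forms along \<open>t *\<^sub>R \<eta>\<close>,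
  and a conjugate complex coordinate has weight -i under the rotation. On the explicit form the
  magnetic terms therefore reduce to the potential t^2 |x|^2 - 2t, negative on the ball for small t
  > 0, and this makes P and Q decrease from their value 1; weight +i would give +2t. The threshold 1
  + 2/m is the value of \<sigma> at which the larger indicial root reaches 1, so that
  \<open>G\<close> may be linear. The explicit form at \<open>t = 0\<close> realizes this: there h
  is a constant multiple of (1 - |x|^2) times the coordinate.\<close>

lemma frechet_derivative_cong_open:
  fixes f g :: "'a::real_normed_vector \<Rightarrow> 'b::real_normed_vector"
  assumes "open U" "x \<in> U" "\<And>y. y \<in> U \<Longrightarrow> f y = g y"
  shows "frechet_derivative f (at x) = frechet_derivative g (at x)"
proof -
  have "(f has_derivative d) (at x) \<longleftrightarrow> (g has_derivative d) (at x)" for d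
    using has_derivative_transform_within_open[of f d x UNIV U g]
      has_derivative_transform_within_open[of g d x UNIV U f] assms by auto
  then show ?thesis by (simp add: frechet_derivative_def)
qed

lemma differentiable_cong_open:
  fixes f g :: "'a::real_normed_vector \<Rightarrow> 'b::real_normed_vector"
  assumes "open U" "x \<in> U" "\<And>y. y \<in> U \<Longrightarrow> f y = g y"
  shows "f differentiable (at x) \<longleftrightarrow> g differentiable (at x)"
  unfolding differentiable_def
  using has_derivative_transform_within_open[of f _ x UNIV U g]
      has_derivative_transform_within_open[of g _ x UNIV U f] assms by fastforce

lemma Ck_on_cong:
  assumes "open U" "\<And>x. x \<in> U \<Longrightarrow> f x = g x"
  shows "Ck_on k U f \<longleftrightarrow> Ck_on k U g"
  using assms(2)
proof (induction k arbitrary: f g)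
  case 0
  then show ?case by (simp cong: continuous_on_cong)
next
  case (Suc k)
  have "Ck_on k U (\<lambda>x. frechet_derivative f (at x) v) \<longleftrightarrow>
      Ck_on k U (\<lambda>x. frechet_derivative g (at x) v)" for v
    by (rule Suc.IH) (use frechet_derivative_cong_open[OF assms(1)] Suc.prems in metis)
  moreover have "f differentiable (at x) \<longleftrightarrow> g differentiable (at x)" if "x \<in> U" for x
    using differentiable_cong_open[OF assms(1) that] Suc.prems by blast
  ultimately show ?case by simp
qed

lemma Ck_on_Suc_imp:
  assumes "Ck_on (Suc k) U f"
  shows "Ck_on k U f"
  using assms
proof (induction k arbitrary: f)
  case 0
  then show ?case
    by (auto intro!: continuous_at_imp_continuous_on differentiable_imp_continuous_within)
next
  case (Suc k)
  then show ?case by (metis Ck_on.simps(2))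
qed

lemma Ck_on_subset:
  assumes "Ck_on k U f" "V \<subseteq> U"
  shows "Ck_on k V f"
  using assms(1) by (induction k arbitrary: f) (use assms(2) in \<open>auto intro: continuous_on_subset\<close>)

lemma Ck_on_const: "Ck_on k U (\<lambda>_. c)"
  by (induction k arbitrary: c) auto

lemma Ck_on_add:
  assumes "open U" "Ck_on k U f" "Ck_on k U g"
  shows "Ck_on k U (\<lambda>x. f x + g x)"
  using assms(2,3)
proof (induction k arbitrary: f g)
  case 0
  then show ?case by (simp add: continuous_on_add)
next
  case (Suc k)
  have d: "((\<lambda>x. f x + g x) has_derivative
      (\<lambda>v. frechet_derivative f (at x) v + frechet_derivative g (at x) v)) (at x)" if "x \<in> U" for x
    by (rule has_derivative_add)
      (use Suc.prems that in \<open>auto simp: frechet_derivative_works[symmetric]\<close>)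
  have "Ck_on k U (\<lambda>x. frechet_derivative (\<lambda>x. f x + g x) (at x) v)" for v
  proof (subst Ck_on_cong[OF assms(1)])
    show "frechet_derivative (\<lambda>x. f x + g x) (at x) v =
        frechet_derivative f (at x) v + frechet_derivative g (at x) v" if "x \<in> U" for x
      using frechet_derivative_at[OF d[OF that]] by metis
    show "Ck_on k U (\<lambda>x. frechet_derivative f (at x) v + frechet_derivative g (at x) v)"
      by (rule Suc.IH) (use Suc.prems in auto)
  qed
  then show ?case using d by (auto simp: differentiable_def)
qed

lemma Ck_on_bilinear:
  assumes "bounded_bilinear BB" "open U" "Ck_on k U f" "Ck_on k U g"
  shows "Ck_on k U (\<lambda>x. BB (f x) (g x))"
  using assms(3,4)
proof (induction k arbitrary: f g)
  case 0
  then show ?case using bounded_bilinear.continuous_on[OF assms(1)] by simp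
next
  case (Suc k)
  have d: "((\<lambda>x. BB (f x) (g x)) has_derivative
      (\<lambda>v. BB (f x) (frechet_derivative g (at x) v) + BB (frechet_derivative f (at x) v) (g x))) (at x)"
    if "x \<in> U" for x
    by (rule bounded_bilinear.FDERIV[OF assms(1)])
      (use Suc.prems that in \<open>auto simp: frechet_derivative_works[symmetric]\<close>)
  have "Ck_on k U (\<lambda>x. frechet_derivative (\<lambda>x. BB (f x) (g x)) (at x) v)" for v
  proof (subst Ck_on_cong[OF assms(2)])
    show "frechet_derivative (\<lambda>x. BB (f x) (g x)) (at x) v =
        BB (f x) (frechet_derivative g (at x) v) + BB (frechet_derivative f (at x) v) (g x)"
      if "x \<in> U" for x
      using frechet_derivative_at[OF d[OF that]] by metis
    show "Ck_on k U (\<lambda>x. BB (f x) (frechet_derivative g (at x) v) +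
        BB (frechet_derivative f (at x) v) (g x))"
      using Suc.prems Ck_on_Suc_imp[OF Suc.prems(1)] Ck_on_Suc_imp[OF Suc.prems(2)]
      by (intro Ck_on_add[OF assms(2)] Suc.IH) simp_all
  qed
  then show ?case using d by (auto simp: differentiable_def)
qed

lemma Ck_on_bounded_linear_compose:
  assumes "bounded_linear T" "open U" "Ck_on k U f"
  shows "Ck_on k U (\<lambda>x. T (f x))"
  using assms(3)
proof (induction k arbitrary: f)
  case 0
  then show ?case using bounded_linear.continuous_on[OF assms(1)] by simp
next
  case (Suc k)
  have d: "((\<lambda>x. T (f x)) has_derivative (\<lambda>v. T (frechet_derivative f (at x) v))) (at x)"
    if "x \<in> U" for x
    by (rule bounded_linear.has_derivative[OF assms(1)])
      (use Suc.prems that in \<open>auto simp: frechet_derivative_works[symmetric]\<close>)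
  have "Ck_on k U (\<lambda>x. frechet_derivative (\<lambda>x. T (f x)) (at x) v)" for v
  proof (subst Ck_on_cong[OF assms(2)])
    show "frechet_derivative (\<lambda>x. T (f x)) (at x) v = T (frechet_derivative f (at x) v)"
      if "x \<in> U" for x
      using frechet_derivative_at[OF d[OF that]] by metis
    show "Ck_on k U (\<lambda>x. T (frechet_derivative f (at x) v))"
      by (rule Suc.IH) (use Suc.prems in auto)
  qed
  then show ?case using d by (auto simp: differentiable_def)
qed

lemma Ck_on_bounded_linear:
  assumes "bounded_linear T"
  shows "Ck_on k U T"
proof (cases k)
  case 0
  then show ?thesis using linear_continuous_on[OF assms] by simp
next
  case (Suc j)
  have "(T has_derivative T) (at x)" for x
    by (rule bounded_linear_imp_has_derivative[OF assms])
  then have "frechet_derivative T (at x) = T" "T differentiable (at x)" for x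
    using frechet_derivative_at by (metis, auto simp: differentiable_def)
  then show ?thesis using Suc by (simp add: Ck_on_const)
qed

text \<open>Differentiating \<open>d j\<close> composed with \<open>q\<close> produces
  \<open>d (Suc j)\<close>, so the induction closes only for a whole tower of successive
  derivatives. The radial profiles of the explicit eigenform are supplied as such towers.\<close>

lemma Ck_on_real_compose:
  fixes d :: "nat \<Rightarrow> real \<Rightarrow> real" and q :: "'a::euclidean_space \<Rightarrow> real"
  assumes "\<And>j s. (d j has_real_derivative d (Suc j) s) (at s)"
    and "open U" "\<And>k. Ck_on k U q"
  shows "Ck_on k U (\<lambda>x. d j (q x))"
proof (induction k arbitrary: j)
  case 0
  have "continuous_on UNIV (d j)"
    using assms(1) by (meson DERIV_isCont continuous_at_imp_continuous_on)
  then show ?case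
    using assms(3)[of 0] by (auto intro: continuous_on_compose2)
next
  case (Suc k)
  have d: "((\<lambda>x. d j (q x)) has_derivative (\<lambda>v. d (Suc j) (q x) * frechet_derivative q (at x) v)) (at x)"
    if "x \<in> U" for x
  proof -
    have "(q has_derivative frechet_derivative q (at x)) (at x)"
      using assms(3)[of "Suc 0"] that by (auto simp: frechet_derivative_works[symmetric])
    moreover have "(d j has_derivative (*) (d (Suc j) (q x))) (at (q x))"
      using assms(1) by (simp add: has_field_derivative_def)
    ultimately show ?thesis by (rule has_derivative_compose)
  qed
  have "Ck_on k U (\<lambda>x. frechet_derivative (\<lambda>x. d j (q x)) (at x) v)" for v
  proof (subst Ck_on_cong[OF assms(2)])
    show "frechet_derivative (\<lambda>x. d j (q x)) (at x) v = d (Suc j) (q x) * frechet_derivative q (at x) v"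
      if "x \<in> U" for x
      using frechet_derivative_at[OF d[OF that]] by metis
    show "Ck_on k U (\<lambda>x. d (Suc j) (q x) * frechet_derivative q (at x) v)"
      by (rule Ck_on_bilinear[OF bounded_bilinear_mult assms(2) Suc.IH])
        (use assms(3)[of "Suc k"] in auto)
  qed
  then show ?case using d by (auto simp: differentiable_def)
qed

section \<open>Smooth functions on an open set and their derivatives\<close>

locale open_set =
  fixes U :: "'a::euclidean_space set"
  assumes open_U: "open U"
begin

text \<open>Extending smooth functions and their derivatives by 0 outside \<open>U\<close> makes the product and
  commutation rules equations between functions, so that they can be iterated by rewriting.\<close>

definition smooth :: "('a \<Rightarrow> 'b::real_normed_vector) set" where
  "smooth = {f. (\<forall>k. Ck_on k U f) \<and> (\<forall>x. x \<notin> U \<longrightarrow> f x = 0)}"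

definition D :: "'a \<Rightarrow> ('a \<Rightarrow> 'b::real_normed_vector) \<Rightarrow> 'a \<Rightarrow> 'b" where
  "D v f x = (if x \<in> U then frechet_derivative f (at x) v else 0)"

lemma smooth_outside: "f \<in> smooth \<Longrightarrow> x \<notin> U \<Longrightarrow> f x = 0"
  by (simp add: smooth_def)

lemma D_outside: "x \<notin> U \<Longrightarrow> D v f x = 0"
  by (simp add: D_def)

lemma smooth_has_derivative:
  assumes "f \<in> smooth" "x \<in> U"
  shows "(f has_derivative (\<lambda>v. D v f x)) (at x)"
proof -
  have "Ck_on (Suc 0) U f" using assms by (simp add: smooth_def)
  then have "f differentiable (at x)" using assms(2) by simp
  then show ?thesis using assms(2) by (simp add: D_def frechet_derivative_works)
qed

lemma D_eqI:
  assumes "(f has_derivative f') (at x)" "x \<in> U"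
  shows "D v f x = f' v"
  using frechet_derivative_at[OF assms(1)] assms(2) by (simp add: D_def)

lemma smooth_continuous_on: "f \<in> smooth \<Longrightarrow> continuous_on U f"
  by (metis (mono_tags, lifting) Ck_on.simps(1) mem_Collect_eq smooth_def)

lemma smooth_D:
  assumes "f \<in> smooth"
  shows "D v f \<in> smooth"
proof -
  have "Ck_on k U (D v f)" for k
  proof (subst Ck_on_cong[OF open_U])
    show "D v f x = frechet_derivative f (at x) v" if "x \<in> U" for x using that by (simp add: D_def)
    have "Ck_on (Suc k) U f" using assms unfolding smooth_def by blast
    then show "Ck_on k U (\<lambda>x. frechet_derivative f (at x) v)" by simp
  qed
  then show ?thesis by (simp add: smooth_def D_def)
qed

lemma smooth_zero: "(\<lambda>_. 0) \<in> smooth"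
  by (simp add: smooth_def Ck_on_const)

lemma smooth_add: "f \<in> smooth \<Longrightarrow> g \<in> smooth \<Longrightarrow> (\<lambda>x. f x + g x) \<in> smooth"
  by (simp add: smooth_def Ck_on_add[OF open_U])

lemma smooth_bounded_linear:
  "bounded_linear T \<Longrightarrow> f \<in> smooth \<Longrightarrow> (\<lambda>x. T (f x)) \<in> smooth"
  by (simp add: smooth_def Ck_on_bounded_linear_compose[OF _ open_U] linear_simps)

lemma smooth_cmult: "f \<in> smooth \<Longrightarrow> (\<lambda>x. c * f x :: 'b::real_normed_algebra) \<in> smooth"
  by (rule smooth_bounded_linear[OF bounded_linear_mult_right])

lemma smooth_minus: "f \<in> smooth \<Longrightarrow> (\<lambda>x. - f x) \<in> smooth"
  by (rule smooth_bounded_linear[OF bounded_linear_minus[OF bounded_linear_ident]])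

lemma smooth_diff: "f \<in> smooth \<Longrightarrow> g \<in> smooth \<Longrightarrow> (\<lambda>x. f x - g x) \<in> smooth"
  using smooth_add[OF _ smooth_minus, of f g] by simp

lemma smooth_sum: "(\<And>i. i \<in> I \<Longrightarrow> f i \<in> smooth) \<Longrightarrow> (\<lambda>x. \<Sum>i\<in>I. f i x) \<in> smooth"
  by (induction I rule: infinite_finite_induct) (auto intro: smooth_zero smooth_add)

lemma smooth_mult:
  "f \<in> smooth \<Longrightarrow> g \<in> smooth \<Longrightarrow> (\<lambda>x. f x * g x :: 'b::real_normed_algebra) \<in> smooth"
  by (simp add: smooth_def Ck_on_bilinear[OF bounded_bilinear_mult open_U])

text \<open>A coordinate function does not vanish off \<open>U\<close> and so need not lie in
  \<open>smooth\<close>; only its product with a smooth function is available as a member. The same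
  holds for |x|^2 in \<open>smooth_radius\<close>.\<close>

lemma smooth_scaleR_inner: "f \<in> smooth \<Longrightarrow> (\<lambda>x. (x \<bullet> a) *\<^sub>R f x) \<in> smooth"
  by (simp add: smooth_def Ck_on_bilinear[OF bounded_bilinear_scaleR open_U]
      Ck_on_bounded_linear[OF bounded_linear_inner_left])

lemma smooth_coord: "f \<in> smooth \<Longrightarrow> (\<lambda>x. (x \<bullet> a) * f x :: real) \<in> smooth"
  using smooth_scaleR_inner[of f a] by simp

lemma smooth_radius:
  assumes "f \<in> smooth"
  shows "(\<lambda>x. (x \<bullet> x) * f x :: real) \<in> smooth"
proof -
  have "(\<lambda>x. \<Sum>b\<in>Basis. (x \<bullet> b) * ((x \<bullet> b) * f x)) \<in> smooth"
    by (intro smooth_sum smooth_coord assms)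
  moreover have "(\<lambda>x. \<Sum>b\<in>Basis. (x \<bullet> b) * ((x \<bullet> b) * f x)) = (\<lambda>x. (x \<bullet> x) * f x)"
    by (simp add: fun_eq_iff euclidean_inner[of x x for x] sum_distrib_right mult.assoc)
  ultimately show ?thesis by simp
qed

lemma D_linear:
  assumes "f \<in> smooth"
  shows "linear (\<lambda>v. D v f x)"
proof (cases "x \<in> U")
  case True
  then show ?thesis using smooth_has_derivative[OF assms] has_derivative_linear by blast
next
  case False
  then show ?thesis by (simp add: D_outside module_hom_zero[unfolded linear_iff_module_hom] linear_zero)
qed

lemma D_expand:
  assumes "f \<in> smooth"
  shows "D v f x = (\<Sum>b\<in>Basis. (v \<bullet> b) *\<^sub>R D b f x)"
proof -
  have "D v f x = D (\<Sum>b\<in>Basis. (v \<bullet> b) *\<^sub>R b) f x" by (simp add: euclidean_representation)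
  also have "\<dots> = (\<Sum>b\<in>Basis. (v \<bullet> b) *\<^sub>R D b f x)"
    by (simp only: linear_sum[OF D_linear[OF assms]] linear_cmul[OF D_linear[OF assms]])
  finally show ?thesis .
qed

lemma D_add:
  assumes "f \<in> smooth" "g \<in> smooth"
  shows "D v (\<lambda>x. f x + g x) = (\<lambda>x. D v f x + D v g x)"
proof
  show "D v (\<lambda>x. f x + g x) x = D v f x + D v g x" for x
    by (cases "x \<in> U") (simp_all add: D_outside
        D_eqI[OF has_derivative_add[OF smooth_has_derivative smooth_has_derivative]] assms)
qed

lemma D_bounded_linear:
  assumes "bounded_linear T" "f \<in> smooth"
  shows "D v (\<lambda>x. T (f x)) = (\<lambda>x. T (D v f x))"
proof
  show "D v (\<lambda>x. T (f x)) x = T (D v f x)" for x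
    by (cases "x \<in> U") (simp_all add: D_outside linear_simps(3)[OF assms(1)]
        D_eqI[OF bounded_linear.has_derivative[OF assms(1) smooth_has_derivative]] assms)
qed

lemma D_cmult: "f \<in> smooth \<Longrightarrow> D v (\<lambda>x. c * f x :: 'b::real_normed_algebra) = (\<lambda>x. c * D v f x)"
  by (rule D_bounded_linear[OF bounded_linear_mult_right])

lemma D_minus: "f \<in> smooth \<Longrightarrow> D v (\<lambda>x. - f x) = (\<lambda>x. - D v f x)"
  by (rule D_bounded_linear[OF bounded_linear_minus[OF bounded_linear_ident]])

lemma D_diff:
  "f \<in> smooth \<Longrightarrow> g \<in> smooth \<Longrightarrow> D v (\<lambda>x. f x - g x) = (\<lambda>x. D v f x - D v g x)"
  using D_add[OF _ smooth_minus, of f g v] by (simp add: D_minus)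

lemma D_zero: "D v (\<lambda>_. 0) = (\<lambda>_. 0)"
  by (auto simp: D_def)

lemma D_sum:
  assumes "\<And>i. i \<in> I \<Longrightarrow> f i \<in> smooth"
  shows "D v (\<lambda>x. \<Sum>i\<in>I. f i x) = (\<lambda>x. \<Sum>i\<in>I. D v (f i) x)"
  using assms
  by (induction I rule: infinite_finite_induct) (auto simp: D_zero D_add smooth_sum)

lemma D_mult:
  assumes "f \<in> smooth" "g \<in> smooth"
  shows "D v (\<lambda>x. f x * g x :: 'b::real_normed_algebra) = (\<lambda>x. f x * D v g x + D v f x * g x)"
proof
  show "D v (\<lambda>x. f x * g x) x = f x * D v g x + D v f x * g x" for x
    by (cases "x \<in> U") (simp_all add: D_outside
        D_eqI[OF bounded_bilinear.FDERIV[OF bounded_bilinear_mult smooth_has_derivative smooth_has_derivative]] assms)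
qed

lemma D_scaleR_inner:
  assumes "f \<in> smooth"
  shows "D v (\<lambda>x. (x \<bullet> a) *\<^sub>R f x) = (\<lambda>x. (x \<bullet> a) *\<^sub>R D v f x + (v \<bullet> a) *\<^sub>R f x)"
proof
  show "D v (\<lambda>x. (x \<bullet> a) *\<^sub>R f x) x = (x \<bullet> a) *\<^sub>R D v f x + (v \<bullet> a) *\<^sub>R f x" for x
    by (cases "x \<in> U") (simp_all add: D_outside smooth_outside assms
        D_eqI[OF bounded_bilinear.FDERIV[OF bounded_bilinear_scaleR
          bounded_linear_imp_has_derivative[OF bounded_linear_inner_left] smooth_has_derivative]])
qed

lemma D_coord:
  "f \<in> smooth \<Longrightarrow> D v (\<lambda>x. (x \<bullet> a) * f x :: real) = (\<lambda>x. (x \<bullet> a) * D v f x + (v \<bullet> a) * f x)"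
  using D_scaleR_inner[of f v a] by simp

lemma D_radius:
  assumes "f \<in> smooth"
  shows "D v (\<lambda>x. (x \<bullet> x) * f x :: real) = (\<lambda>x. (x \<bullet> x) * D v f x + 2 * ((x \<bullet> v) * f x))"
proof
  have d: "((\<lambda>x. (x \<bullet> x) * f x) has_derivative
      (\<lambda>v. (x \<bullet> x) * D v f x + 2 * (x \<bullet> v) * f x)) (at x)" if "x \<in> U" for x
    by (rule has_derivative_eq_rhs, rule has_derivative_mult[OF
          has_derivative_inner[OF has_derivative_ident has_derivative_ident]
          smooth_has_derivative[OF assms that]]) (simp add: inner_commute)
  show "D v (\<lambda>x. (x \<bullet> x) * f x) x = (x \<bullet> x) * D v f x + 2 * ((x \<bullet> v) * f x)" for x
    by (cases "x \<in> U") (simp_all add: D_outside smooth_outside assms D_eqI[OF d])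
qed

lemma D_zero_on:
  assumes "open V" "x \<in> V" "\<And>y. y \<in> V \<Longrightarrow> f y = 0"
  shows "D v f x = 0"
proof (cases "x \<in> U")
  case True
  have "(f has_derivative (\<lambda>_. 0)) (at x)"
    by (rule has_derivative_transform_within_open[of "\<lambda>_. 0" _ x UNIV V]) (use assms in auto)
  then show ?thesis using True by (rule D_eqI)
qed (rule D_outside)


section \<open>Symmetry of second derivatives\<close>

lemma D_line:
  fixes f :: "'a \<Rightarrow> real"
  assumes "f \<in> smooth" "y + r *\<^sub>R v \<in> U"
  shows "((\<lambda>r. f (y + r *\<^sub>R v)) has_real_derivative D v f (y + r *\<^sub>R v)) (at r)"
proof -
  have "((\<lambda>r. y + r *\<^sub>R v) has_derivative (\<lambda>t. t *\<^sub>R v)) (at r)"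
    by (auto intro!: derivative_eq_intros)
  from has_derivative_compose[OF this smooth_has_derivative[OF assms]]
  show ?thesis
    by (simp add: has_field_derivative_def linear_cmul[OF D_linear[OF assms(1)]] mult.commute
        fun_eq_iff mult_commute_abs)
qed

text \<open>The second difference is symmetric in \<open>u\<close> and \<open>v\<close> while the
  derivative on the right is not, so using both orders compares the two mixed derivatives at nearby
  points. The mean value theorem is used along \<open>u\<close> for the increment in direction
  \<open>v\<close>, then along \<open>v\<close>.\<close>

lemma second_difference:
  fixes f :: "'a \<Rightarrow> real"
  assumes f: "f \<in> smooth" and "s > 0"
    and U: "\<And>p q. 0 \<le> p \<Longrightarrow> p \<le> s \<Longrightarrow> 0 \<le> q \<Longrightarrow> q \<le> s \<Longrightarrow> x + p *\<^sub>R u + q *\<^sub>R v \<in> U"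
  obtains p q where "0 < p" "p < s" "0 < q" "q < s"
    "f (x + s *\<^sub>R u + s *\<^sub>R v) - f (x + s *\<^sub>R u) - f (x + s *\<^sub>R v) + f x =
      s * (s * D v (D u f) (x + p *\<^sub>R u + q *\<^sub>R v))"
proof -
  have d1: "((\<lambda>r. f (x + r *\<^sub>R u + s *\<^sub>R v) - f (x + r *\<^sub>R u)) has_real_derivative
      D u f (x + r *\<^sub>R u + s *\<^sub>R v) - D u f (x + r *\<^sub>R u)) (at r)" if "0 \<le> r" "r \<le> s" for r
  proof (rule DERIV_diff)
    show "((\<lambda>r. f (x + r *\<^sub>R u + s *\<^sub>R v)) has_real_derivative D u f (x + r *\<^sub>R u + s *\<^sub>R v)) (at r)"
      using D_line[OF f, of "x + s *\<^sub>R v" r u] U[of r s] that \<open>s > 0\<close> by (simp add: algebra_simps)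
    show "((\<lambda>r. f (x + r *\<^sub>R u)) has_real_derivative D u f (x + r *\<^sub>R u)) (at r)"
      using D_line[OF f, of x r u] U[of r 0] that \<open>s > 0\<close> by simp
  qed
  obtain p where p: "0 < p" "p < s" and
    e1: "(f (x + s *\<^sub>R u + s *\<^sub>R v) - f (x + s *\<^sub>R u)) - (f (x + 0 *\<^sub>R u + s *\<^sub>R v) - f (x + 0 *\<^sub>R u)) =
      (s - 0) * (D u f (x + p *\<^sub>R u + s *\<^sub>R v) - D u f (x + p *\<^sub>R u))"
    using MVT2[OF \<open>s > 0\<close> d1] by auto
  have d2: "((\<lambda>r. D u f (x + p *\<^sub>R u + r *\<^sub>R v)) has_real_derivative
      D v (D u f) (x + p *\<^sub>R u + r *\<^sub>R v)) (at r)" if "0 \<le> r" "r \<le> s" for r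
    using D_line[OF smooth_D[OF f], of "x + p *\<^sub>R u" r v] U[of p r] that p by simp
  obtain q where "0 < q" "q < s" and
    "D u f (x + p *\<^sub>R u + s *\<^sub>R v) - D u f (x + p *\<^sub>R u + 0 *\<^sub>R v) =
      (s - 0) * D v (D u f) (x + p *\<^sub>R u + q *\<^sub>R v)"
    using MVT2[OF \<open>s > 0\<close> d2] by auto
  then show ?thesis using that[OF p] e1 by simp
qed

lemma D_commute_real:
  fixes f :: "'a \<Rightarrow> real"
  assumes f: "f \<in> smooth"
  shows "D u (D v f) = D v (D u f)"
proof
  fix x
  show "D u (D v f) x = D v (D u f) x"
  proof (cases "x \<in> U")
    case True
    define a where "a = D u (D v f) x"
    define b where "b = D v (D u f) x"
    have "a = b"
    proof (rule ccontr)
      assume "a \<noteq> b"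
      then have e: "\<bar>a - b\<bar> / 2 > 0" by simp
      have "isCont (D u (D v f)) x" "isCont (D v (D u f)) x"
        using smooth_continuous_on[OF smooth_D[OF smooth_D[OF f]]] open_U True
        by (simp_all add: continuous_on_eq_continuous_at)
      then have "(D u (D v f) \<longlongrightarrow> a) (nhds x)" "(D v (D u f) \<longlongrightarrow> b) (nhds x)"
        by (simp_all add: a_def b_def isCont_def tendsto_at_iff_tendsto_nhds)
      then have "\<forall>\<^sub>F y in nhds x. y \<in> U \<and> dist (D u (D v f) y) a < \<bar>a - b\<bar> / 2 \<and> dist (D v (D u f) y) b < \<bar>a - b\<bar> / 2"
        using open_U True e
        by (intro eventually_conj eventually_nhds_in_open tendstoD)
      then obtain d where d: "d > 0" and
        near: "\<And>y. dist y x < d \<Longrightarrow> y \<in> U \<and> \<bar>D u (D v f) y - a\<bar> < \<bar>a - b\<bar> / 2 \<and> \<bar>D v (D u f) y - b\<bar> < \<bar>a - b\<bar> / 2"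
        by (auto simp: eventually_nhds_metric dist_real_def)
      \<comment> \<open>Keeps the whole parallelogram spanned by \<open>s *\<^sub>R u\<close> and
        \<open>s *\<^sub>R v\<close> within distance \<open>d\<close> of \<open>x\<close>; the
        summand 1 covers \<open>u = v = 0\<close>.\<close>
      define s where "s = d / (norm u + norm v + 1)"
      have pos: "norm u + norm v + 1 > 0" by (smt (verit) norm_ge_zero)
      then have s: "s > 0" using d by (simp add: s_def)
      have close: "dist (x + p *\<^sub>R u + q *\<^sub>R v) x < d" if "0 \<le> p" "p \<le> s" "0 \<le> q" "q \<le> s" for p q
      proof -
        have "dist (x + p *\<^sub>R u + q *\<^sub>R v) x \<le> norm (p *\<^sub>R u) + norm (q *\<^sub>R v)"
          using norm_triangle_ineq[of "p *\<^sub>R u" "q *\<^sub>R v"] by (simp add: dist_norm add.assoc)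
        also have "\<dots> \<le> s * norm u + s * norm v"
          using that by (intro add_mono) (auto intro: mult_right_mono)
        also have "\<dots> < s * (norm u + norm v + 1)" using s by (simp add: algebra_simps)
        also have "\<dots> = d" using pos by (simp add: s_def)
        finally show ?thesis .
      qed
      obtain p q where pq: "0 < p" "p < s" "0 < q" "q < s"
        and 1: "f (x + s *\<^sub>R u + s *\<^sub>R v) - f (x + s *\<^sub>R u) - f (x + s *\<^sub>R v) + f x =
          s * (s * D v (D u f) (x + p *\<^sub>R u + q *\<^sub>R v))"
        using second_difference[OF f s, of x u v] near close by metis
      obtain p' q' where pq': "0 < p'" "p' < s" "0 < q'" "q' < s"
        and 2: "f (x + s *\<^sub>R v + s *\<^sub>R u) - f (x + s *\<^sub>R v) - f (x + s *\<^sub>R u) + f x =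
          s * (s * D u (D v f) (x + p' *\<^sub>R v + q' *\<^sub>R u))"
      proof (rule second_difference[OF f s, of x v u])
        show "x + p *\<^sub>R v + q *\<^sub>R u \<in> U" if "0 \<le> p" "p \<le> s" "0 \<le> q" "q \<le> s" for p q
          using near[OF close[of q p]] that by (simp add: algebra_simps)
      qed blast
      have "s * (s * D v (D u f) (x + p *\<^sub>R u + q *\<^sub>R v)) = s * (s * D u (D v f) (x + p' *\<^sub>R v + q' *\<^sub>R u))"
        unfolding 1[symmetric] 2[symmetric] by (simp add: algebra_simps)
      then have "D v (D u f) (x + p *\<^sub>R u + q *\<^sub>R v) = D u (D v f) (x + q' *\<^sub>R u + p' *\<^sub>R v)"
        using s by (simp add: algebra_simps)
      moreover have "\<bar>D v (D u f) (x + p *\<^sub>R u + q *\<^sub>R v) - b\<bar> < \<bar>a - b\<bar> / 2"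
        using near[OF close[of p q]] pq by simp
      moreover have "\<bar>D u (D v f) (x + q' *\<^sub>R u + p' *\<^sub>R v) - a\<bar> < \<bar>a - b\<bar> / 2"
        using near[OF close[of q' p']] pq' by simp
      ultimately show False by (simp add: abs_if split: if_splits)
    qed
    then show ?thesis by (simp add: a_def b_def)
  qed (simp add: D_outside)
qed

lemma D_commute:
  fixes f :: "'a \<Rightarrow> 'b::euclidean_space"
  assumes f: "f \<in> smooth"
  shows "D u (D v f) = D v (D u f)"
proof
  fix x
  have c: "D u (D v f) x \<bullet> i = D u (D v (\<lambda>x. f x \<bullet> i)) x" for u v i
    by (simp add: D_bounded_linear[OF bounded_linear_inner_left] f smooth_D)
  show "D u (D v f) x = D v (D u f) x"
    by (rule euclidean_eqI)
      (simp add: c D_commute_real[OF smooth_bounded_linear[OF bounded_linear_inner_left f]])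
qed

section \<open>The Euler operator and the Laplacian\<close>

definition E :: "('a \<Rightarrow> real) \<Rightarrow> 'a \<Rightarrow> real" where
  "E f x = (\<Sum>b\<in>Basis. (x \<bullet> b) * D b f x)"

definition L :: "('a \<Rightarrow> 'b::real_normed_vector) \<Rightarrow> 'a \<Rightarrow> 'b" where
  "L f x = (\<Sum>b\<in>Basis. D b (D b f) x)"

lemma E_eq_D: "f \<in> smooth \<Longrightarrow> E f x = D x f x"
  by (simp add: E_def D_expand[of f x])

lemma smooth_E: "f \<in> smooth \<Longrightarrow> E f \<in> smooth"
  unfolding E_def by (intro smooth_sum smooth_coord smooth_D)

lemma smooth_L: "f \<in> smooth \<Longrightarrow> L f \<in> smooth"
  unfolding L_def by (intro smooth_sum smooth_D)

lemmas smooth_intros = smooth_add smooth_diff smooth_minus smooth_cmult smooth_coord smooth_radius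
  smooth_sum smooth_mult smooth_D smooth_E smooth_L

lemma E_add: "f \<in> smooth \<Longrightarrow> g \<in> smooth \<Longrightarrow> E (\<lambda>x. f x + g x) = (\<lambda>x. E f x + E g x)"
  by (simp add: E_def fun_eq_iff D_add distrib_left sum.distrib)

lemma E_diff: "f \<in> smooth \<Longrightarrow> g \<in> smooth \<Longrightarrow> E (\<lambda>x. f x - g x) = (\<lambda>x. E f x - E g x)"
  by (simp add: E_def fun_eq_iff D_diff right_diff_distrib sum_subtractf)

lemma E_cmult: "f \<in> smooth \<Longrightarrow> E (\<lambda>x. c * f x) = (\<lambda>x. c * E f x)"
  by (simp add: E_def fun_eq_iff D_cmult sum_distrib_left mult.left_commute)

lemma E_coord: "f \<in> smooth \<Longrightarrow> E (\<lambda>x. (x \<bullet> a) * f x) = (\<lambda>x. (x \<bullet> a) * E f x + (x \<bullet> a) * f x)"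
  by (simp add: fun_eq_iff E_eq_D smooth_coord D_coord)

lemma E_radius: "f \<in> smooth \<Longrightarrow> E (\<lambda>x. (x \<bullet> x) * f x) = (\<lambda>x. (x \<bullet> x) * E f x + 2 * ((x \<bullet> x) * f x))"
  by (simp add: fun_eq_iff E_eq_D smooth_radius D_radius)

lemma E_sum: "(\<And>i. i \<in> I \<Longrightarrow> f i \<in> smooth) \<Longrightarrow> E (\<lambda>x. \<Sum>i\<in>I. f i x) = (\<lambda>x. \<Sum>i\<in>I. E (f i) x)"
  by (simp add: fun_eq_iff E_eq_D smooth_sum D_sum)

lemma D_E:
  assumes "f \<in> smooth"
  shows "D v (E f) = (\<lambda>x. E (D v f) x + D v f x)"
proof
  fix x
  have "D v (E f) x = (\<Sum>b\<in>Basis. (x \<bullet> b) * D v (D b f) x + (v \<bullet> b) * D b f x)"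
    unfolding E_def by (simp add: D_sum smooth_intros assms D_coord)
  also have "\<dots> = E (D v f) x + D v f x"
    unfolding sum.distrib E_def D_expand[OF assms, of v x] D_commute_real[OF assms, of v] by simp
  finally show "D v (E f) x = E (D v f) x + D v f x" .
qed

lemma L_add: "f \<in> smooth \<Longrightarrow> g \<in> smooth \<Longrightarrow> L (\<lambda>x. f x + g x) = (\<lambda>x. L f x + L g x)"
  by (simp add: L_def fun_eq_iff D_add smooth_D sum.distrib)

lemma L_diff: "f \<in> smooth \<Longrightarrow> g \<in> smooth \<Longrightarrow> L (\<lambda>x. f x - g x) = (\<lambda>x. L f x - L g x)"
  by (simp add: L_def fun_eq_iff D_diff smooth_D sum_subtractf)

lemma L_cmult: "f \<in> smooth \<Longrightarrow> L (\<lambda>x. c * f x :: real) = (\<lambda>x. c * L f x)"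
  by (simp add: L_def fun_eq_iff D_cmult smooth_D sum_distrib_left)

lemma L_sum: "(\<And>i. i \<in> I \<Longrightarrow> f i \<in> smooth) \<Longrightarrow> L (\<lambda>x. \<Sum>i\<in>I. f i x) = (\<lambda>x. \<Sum>i\<in>I. L (f i) x)"
  by (rule ext) (simp add: L_def D_sum smooth_D, rule sum.swap)

lemma D_L: "f \<in> smooth \<Longrightarrow> D v (L f) = L (D v (f::'a \<Rightarrow> real))"
  by (simp add: L_def[abs_def] D_sum smooth_D D_commute_real[of _ v])

text \<open>The commutator of L and E is 2 L, hence E preserves harmonicity. This is what lets
  Dirichlet uniqueness be applied to identities that contain Euler derivatives.\<close>

lemma L_E:
  assumes "f \<in> smooth"
  shows "L (E f) = (\<lambda>x. E (L f) x + 2 * L f x)"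
proof
  fix x
  have "L (E f) x = (\<Sum>b\<in>Basis. 2 * D b (D b f) x + E (D b (D b f)) x)"
    by (simp add: L_def D_E D_add smooth_intros assms)
  also have "\<dots> = E (L f) x + 2 * L f x"
    by (simp add: L_def[abs_def] sum.distrib sum_distrib_left E_sum smooth_intros assms)
  finally show "L (E f) x = E (L f) x + 2 * L f x" .
qed

lemma L_coord:
  assumes "f \<in> smooth"
  shows "L (\<lambda>x. (x \<bullet> a) * f x) = (\<lambda>x. (x \<bullet> a) * L f x + 2 * D a f x)"
proof
  fix x
  have "L (\<lambda>x. (x \<bullet> a) * f x) x = (\<Sum>b\<in>Basis. (x \<bullet> a) * D b (D b f) x + 2 * ((b \<bullet> a) * D b f x))"
    unfolding L_def by (rule sum.cong) (simp_all add: D_coord D_add smooth_intros D_cmult assms)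
  then show "L (\<lambda>x. (x \<bullet> a) * f x) x = (x \<bullet> a) * L f x + 2 * D a f x"
    unfolding D_expand[OF assms, of a x] by (simp add: sum.distrib sum_distrib_left L_def inner_commute)
qed

lemma L_radius:
  assumes "f \<in> smooth"
  shows "L (\<lambda>x. (x \<bullet> x) * f x) =
    (\<lambda>x. (x \<bullet> x) * L f x + 4 * E f x + 2 * real DIM('a) * f x)"
proof
  fix x
  have "L (\<lambda>x. (x \<bullet> x) * f x) x =
      (\<Sum>b\<in>Basis. (x \<bullet> x) * D b (D b f) x + 4 * ((x \<bullet> b) * D b f x) + 2 * f x)"
    unfolding L_def by (rule sum.cong) (simp_all add: D_radius D_coord D_add smooth_intros D_cmult assms)
  then show "L (\<lambda>x. (x \<bullet> x) * f x) x = (x \<bullet> x) * L f x + 4 * E f x + 2 * real DIM('a) * f x"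
    by (simp add: sum.distrib sum_distrib_left[symmetric] L_def E_def)
qed

text \<open>A unit tangent vector is the velocity of a great circle, along which \<open>f\<close> is
  constantly 0; so only the radial part of \<open>v\<close> contributes, and on the unit sphere the
  radial derivative is \<open>E f\<close>.\<close>

lemma D_tangential:
  fixes f :: "'a \<Rightarrow> real"
  assumes f: "f \<in> smooth" and U: "sphere 0 1 \<subseteq> U" and z: "\<And>y. norm y = 1 \<Longrightarrow> f y = 0"
    and x: "norm x = 1"
  shows "D v f x = (x \<bullet> v) * E f x"
proof -
  have xU: "x \<in> U" using U x by auto
  have tan: "D w f x = 0" if w: "norm w = 1" "x \<bullet> w = 0" for w
  proof -
    have ww: "w \<bullet> w = 1" and xx: "x \<bullet> x = 1" using w(1) x by (simp_all add: dot_square_norm)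
    define \<gamma> where "\<gamma> \<theta> = cos \<theta> *\<^sub>R x + sin \<theta> *\<^sub>R w" for \<theta>
    have "((\<lambda>\<theta>. cos \<theta> *\<^sub>R x + sin \<theta> *\<^sub>R w) has_derivative (\<lambda>t. t *\<^sub>R w)) (at 0)"
      by (rule has_derivative_eq_rhs, (rule derivative_intros)+) simp
    then have d1: "(\<gamma> has_derivative (\<lambda>t. t *\<^sub>R w)) (at 0)" by (simp add: \<gamma>_def[abs_def])
    have d2: "(f has_derivative (\<lambda>v. D v f x)) (at (\<gamma> 0))"
      using smooth_has_derivative[OF f xU] by (simp add: \<gamma>_def)
    note d = has_derivative_compose[OF d1 d2]
    have "norm (\<gamma> \<theta>) = 1" for \<theta>
    proof -
      have "(norm (\<gamma> \<theta>))\<^sup>2 = 1"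
        using sin_cos_squared_add2[of \<theta>] ww xx w(2) unfolding power2_norm_eq_inner \<gamma>_def
        by (simp add: inner_add_left inner_add_right inner_commute[of w x] power2_eq_square)
      then have "norm (\<gamma> \<theta>) = 1 \<or> norm (\<gamma> \<theta>) = - 1" by (simp only: power2_eq_1_iff)
      then show ?thesis using norm_ge_zero[of "\<gamma> \<theta>"] by linarith
    qed
    then have "(\<lambda>\<theta>. f (\<gamma> \<theta>)) = (\<lambda>_. 0)" using z by (simp add: fun_eq_iff)
    then have "((\<lambda>_. 0) has_derivative (\<lambda>t. D (t *\<^sub>R w) f x)) (at (0::real))" using d by simp
    from fun_cong[OF has_derivative_unique[OF this has_derivative_const], of 1] have "D (1 *\<^sub>R w) f x = 0" .
    then show ?thesis by simp
  qed
  have tan: "D w f x = 0" if w: "x \<bullet> w = 0" for w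
  proof (cases "w = 0")
    case False
    then have "D (w /\<^sub>R norm w) f x = 0" using w by (intro tan) auto
    then show ?thesis using False linear_cmul[OF D_linear[OF f]] by simp
  qed (simp add: linear_0[OF D_linear[OF f]])
  have "x \<bullet> (v - (x \<bullet> v) *\<^sub>R x) = 0"
    using x by (simp add: inner_diff_right dot_square_norm)
  from tan[OF this] have "D v f x = (x \<bullet> v) * D x f x"
    by (simp add: linear_diff[OF D_linear[OF f]] linear_cmul[OF D_linear[OF f]])
  then show ?thesis by (simp add: E_eq_D[OF f])
qed

section \<open>Harmonic functions on the unit ball\<close>


lemma D_cong_on:
  assumes "open V" "x \<in> V" "\<And>y. y \<in> V \<Longrightarrow> f y = g y"
  shows "D v f x = D v g x"
  using frechet_derivative_cong_open[OF assms] by (simp add: D_def)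

lemma E_cong_on:
  assumes "open V" "x \<in> V" "\<And>y. y \<in> V \<Longrightarrow> f y = g y"
  shows "E f x = E g x"
  unfolding E_def using D_cong_on[OF assms] by simp

lemma E_zero_on:
  assumes "open V" "x \<in> V" "\<And>y. y \<in> V \<Longrightarrow> f y = 0"
  shows "E f x = 0"
  unfolding E_def using D_zero_on[OF assms] by simp

text \<open>The member of \<open>smooth\<close> that stands in for the constant 1, which does not
  vanish off \<open>U\<close>; it enters the comparison functions of the maximum principle.\<close>

definition one :: "'a \<Rightarrow> real" where
  "one x = (if x \<in> U then 1 else 0)"

lemma smooth_one: "one \<in> smooth"
proof -
  have "Ck_on k U one" for k
    using Ck_on_cong[OF open_U, of one "\<lambda>_. 1" k] by (simp add: one_def Ck_on_const)
  then show ?thesis by (simp add: smooth_def one_def)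
qed

lemma D_one: "D v one = (\<lambda>_. 0)"
proof
  show "D v one x = 0" for x
  proof (cases "x \<in> U")
    case True
    have "(one has_derivative (\<lambda>_. 0)) (at x)"
      by (rule has_derivative_transform_within_open[of "\<lambda>_. 1" _ x UNIV U])
        (use True open_U in \<open>auto simp: one_def\<close>)
    then show ?thesis using True by (rule D_eqI)
  qed (rule D_outside)
qed

lemma E_one: "E one = (\<lambda>_. 0)"
  by (simp add: E_def[abs_def] D_one)

lemma L_one: "L one = (\<lambda>_. 0)"
  by (simp add: L_def[abs_def] D_one D_zero)

section \<open>The maximum principle and uniqueness for the Dirichlet problem\<close>

lemma L_local_max:
  fixes f :: "'a \<Rightarrow> real"
  assumes f: "f \<in> smooth" and e: "e > 0" "ball x e \<subseteq> U" and max: "\<And>y. y \<in> ball x e \<Longrightarrow> f y \<le> f x"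
  shows "L f x \<le> 0"
proof -
  have xU: "x \<in> U" using e by auto
  have "D v f x = 0" for v
    using differential_zero_maxmin[OF _ _ smooth_has_derivative[OF f xU], of "ball x e"] e max
    by (auto dest: fun_cong)
  have "D b (D b f) x \<le> 0" if b: "b \<in> Basis" for b
  proof (rule ccontr)
    assume c: "\<not> D b (D b f) x \<le> 0"
    have "((\<lambda>r. D b f (x + r *\<^sub>R b)) has_real_derivative D b (D b f) x) (at 0)"
      using D_line[OF smooth_D[OF f], of x 0 b b] xU by simp
    from DERIV_pos_inc_right[OF this] c obtain d where d: "d > 0"
      and inc: "\<And>r. 0 < r \<Longrightarrow> r < d \<Longrightarrow> D b f (x + r *\<^sub>R b) > 0"
      using \<open>D b f x = 0\<close> by auto
    define s where "s = min d e / 2"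
    have s: "0 < s" "s < d" "s < e" using d e by (auto simp: s_def)
    have ball: "x + r *\<^sub>R b \<in> ball x e" if "0 \<le> r" "r \<le> s" for r
      using that s b by (simp add: dist_norm)
    have "((\<lambda>r. f (x + r *\<^sub>R b)) has_real_derivative D b f (x + r *\<^sub>R b)) (at r)"
      if "0 \<le> r" "r \<le> s" for r
      using D_line[OF f, of x r b] ball[OF that] e by blast
    from MVT2[OF s(1) this] obtain r where r: "0 < r" "r < s"
      and eq: "f (x + s *\<^sub>R b) - f (x + 0 *\<^sub>R b) = (s - 0) * D b f (x + r *\<^sub>R b)" by blast
    have "(s - 0) * D b f (x + r *\<^sub>R b) > 0" using inc[of r] r s by simp
    then show False using eq max[OF ball[of s]] s by simp
  qed
  then show ?thesis unfolding L_def by (rule sum_nonpos)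
qed

lemma zero_on_cball:
  assumes f: "f \<in> smooth" and U: "cball 0 1 \<subseteq> U" and z: "\<And>y. norm y < 1 \<Longrightarrow> f y = 0"
    and x: "norm x \<le> 1"
  shows "f x = 0"
proof -
  have "continuous_on (closure (ball 0 1)) f"
    using smooth_continuous_on[OF f] U by (auto intro: continuous_on_subset)
  from continuous_constant_on_closure[OF this, of 0 x] show ?thesis using z x by auto
qed

text \<open>Adding a small multiple of |x|^2 makes the Laplacian strictly positive, which excludes
  an interior maximum; the multiple is small enough that the maximum cannot lie on the sphere
  either.\<close>

lemma harmonic_le_zero:
  assumes f: "f \<in> smooth" and U: "cball 0 1 \<subseteq> U"
    and harm: "\<And>y. norm y < 1 \<Longrightarrow> L f y = 0" and z: "\<And>y. norm y = 1 \<Longrightarrow> f y = 0"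
    and x: "norm x \<le> 1"
  shows "f x \<le> (0::real)"
proof (rule ccontr)
  assume "\<not> f x \<le> 0"
  \<comment> \<open>On the sphere the perturbed function equals \<open>\<epsilon>\<close>, which is
    less than \<open>f x\<close> and hence less than its value at \<open>x\<close>.\<close>
  define \<epsilon> where "\<epsilon> = f x / 2"
  have \<epsilon>: "\<epsilon> > 0" "f x > \<epsilon>" using \<open>\<not> f x \<le> 0\<close> by (auto simp: \<epsilon>_def)
  define k where "k = (\<lambda>y. f y + \<epsilon> * ((y \<bullet> y) * one y))"
  have k: "k \<in> smooth" unfolding k_def by (intro smooth_intros f smooth_one)
  have kU: "k y = f y + \<epsilon> * (y \<bullet> y)" if "norm y \<le> 1" for y
    using that U by (auto simp: k_def one_def)
  have "continuous_on (cball 0 1) k"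
    using smooth_continuous_on[OF k] U by (rule continuous_on_subset)
  from continuous_attains_sup[OF compact_cball _ this] obtain y
    where y: "norm y \<le> 1" and max: "\<And>w. norm w \<le> 1 \<Longrightarrow> k w \<le> k y" by auto
  have "norm y \<noteq> 1"
  proof
    assume "norm y = 1"
    then have "k y = \<epsilon>" by (simp add: kU z dot_square_norm)
    moreover have "k x \<ge> f x" using x \<epsilon> by (simp add: kU)
    ultimately show False using max[OF x] \<epsilon> by linarith
  qed
  then have y1: "norm y < 1" using y by simp
  have "L k y = 2 * \<epsilon> * real DIM('a)"
  proof -
    have "y \<in> U" using y U by auto
    then show ?thesis unfolding k_def
      by (simp add: L_add L_cmult L_radius smooth_intros f smooth_one harm[OF y1] L_one E_one one_def[of y])
  qed
  moreover have "L k y \<le> 0"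
  proof (rule L_local_max[OF k])
    have sub: "ball y (1 - norm y) \<subseteq> ball 0 1"
      using ball_subset_ball_iff[of y "1 - norm y" 0 1] by simp
    then show "ball y (1 - norm y) \<subseteq> U" using U ball_subset_cball by blast
    show "k w \<le> k y" if "w \<in> ball y (1 - norm y)" for w
      using max[of w] sub that by (auto simp: subset_iff)
  qed (use y1 in simp)
  ultimately show False using \<epsilon> by (simp add: mult_le_0_iff)
qed

lemma harmonic_zero:
  assumes "f \<in> smooth" "cball 0 1 \<subseteq> U"
    and "\<And>y. norm y < 1 \<Longrightarrow> L f y = 0" "\<And>y. norm y = 1 \<Longrightarrow> f y = 0" "norm x \<le> 1"
  shows "f x = (0::real)"
proof -
  have "L (\<lambda>x. - f x) y = - L f y" for y
    by (simp add: L_def D_minus smooth_D assms(1) sum_negf)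
  then have "- f x \<le> 0"
    by (intro harmonic_le_zero smooth_minus assms) (simp_all add: assms)
  moreover have "f x \<le> 0" by (rule harmonic_le_zero[OF assms])
  ultimately show ?thesis by simp
qed

text \<open>Along rays \<open>f\<close> is homogeneous: f(s x) = s^e f(x). Differentiability at 0
  together with \<open>f 0 = 0\<close> gives f(s x) = O(s), and since e < 1 this leaves only f(x) =
  0. The exponent may be negative.\<close>

lemma euler_zero:
  fixes f :: "'a \<Rightarrow> real"
  assumes f: "f \<in> smooth" and U: "ball 0 1 \<subseteq> U" and E: "\<And>x. norm x < 1 \<Longrightarrow> E f x = e * f x"
    and e: "e < 1" and 0: "f 0 = 0" and x: "norm x < 1"
  shows "f x = 0"
proof -
  have in_ball: "norm (s *\<^sub>R x) < 1" if "0 \<le> s" "s \<le> 1" for s :: real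
  proof -
    have "s * norm x \<le> 1 * norm x" using that by (intro mult_right_mono) auto
    then show ?thesis using that x by simp
  qed
  have line: "((\<lambda>s. f (s *\<^sub>R x)) has_real_derivative D x f (s *\<^sub>R x)) (at s)" if "0 \<le> s" "s \<le> 1" for s
  proof -
    have "0 + s *\<^sub>R x \<in> U" using in_ball[OF that] U by (auto simp: subset_iff simp del: norm_scaleR)
    from D_line[OF f this] show ?thesis by simp
  qed
  define \<phi> where "\<phi> s = s powr (- e) * f (s *\<^sub>R x)" for s
  have der: "(\<phi> has_real_derivative 0) (at s)" if s: "0 < s" "s \<le> 1" for s
  proof -
    have eq: "s * D x f (s *\<^sub>R x) = e * f (s *\<^sub>R x)"
      using E[OF in_ball[of s]] s by (simp add: E_eq_D[OF f] linear_cmul[OF D_linear[OF f]])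
    have "(\<phi> has_real_derivative
        (- e * s powr (- e - 1)) * f (s *\<^sub>R x) + D x f (s *\<^sub>R x) * s powr (- e)) (at s)"
      unfolding \<phi>_def
      by (rule DERIV_mult[OF has_real_derivative_powr line]) (use s in auto)
    also have "(- e * s powr (- e - 1)) * f (s *\<^sub>R x) + D x f (s *\<^sub>R x) * s powr (- e) =
        s powr (- e - 1) * (s * D x f (s *\<^sub>R x) - e * f (s *\<^sub>R x))"
      using s powr_add[of s 1 "- e - 1"] by (simp add: algebra_simps)
    also have "\<dots> = 0" using eq by simp
    finally show ?thesis .
  qed
  have const: "\<phi> s = f x" if s: "0 < s" "s < 1" for s
  proof -
    have "\<phi> 1 = \<phi> s"
    proof (rule DERIV_isconst_end[OF s(2)])
      show "continuous_on {s..1} \<phi>"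
        using DERIV_isCont[OF der] s by (intro continuous_at_imp_continuous_on) auto
    qed (use der s in auto)
    then show ?thesis by (simp add: \<phi>_def)
  qed
  have lim1: "((\<lambda>s. f (s *\<^sub>R x) / s) \<longlongrightarrow> D x f 0) (at_right 0)"
    using line[of 0] 0 unfolding has_field_derivative_iff
    by (auto intro: filterlim_at_within_not_equal tendsto_within_subset[of _ _ 0 UNIV])
  have lim2: "((\<lambda>s::real. s powr (1 - e)) \<longlongrightarrow> 0) (at_right 0)"
    by (rule tendsto_zero_powrI[OF tendsto_ident_at tendsto_const])
      (use e in \<open>auto simp: eventually_at_filter\<close>)
  have "((\<lambda>s. s powr (1 - e) * (f (s *\<^sub>R x) / s)) \<longlongrightarrow> 0 * D x f 0) (at_right 0)"
    by (rule tendsto_mult[OF lim2 lim1])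
  moreover have "\<forall>\<^sub>F s in at_right 0. s powr (1 - e) * (f (s *\<^sub>R x) / s) = f x"
  proof -
    have "\<forall>\<^sub>F s::real in at_right 0. 0 < s \<and> s < 1"
      unfolding eventually_at_right_field by (intro exI[of _ 1]) auto
    then show ?thesis
    proof (rule eventually_mono)
      fix s :: real assume s: "0 < s \<and> s < 1"
      then have "s powr (1 - e) = s * s powr (- e)" using powr_add[of s 1 "- e"] by simp
      then show "s powr (1 - e) * (f (s *\<^sub>R x) / s) = f x"
        using const[of s] s by (simp add: \<phi>_def field_simps)
    qed
  qed
  ultimately have "((\<lambda>s::real. f x) \<longlongrightarrow> 0) (at_right 0)"
    by (simp add: tendsto_cong)
  then show ?thesis by (simp add: tendsto_const_iff)
qed

text \<open>In polar form |x|^2 L is E^2 + (m - 2) E plus a spherical part that sees only the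
  boundary values. To get this without polar coordinates, the tangential gradient \<open>v\<close>,
  which itself vanishes on the sphere, is fed into \<open>D_tangential\<close> again, and its
  divergence is computed in two ways.\<close>

lemma L_on_sphere:
  fixes f :: "'a \<Rightarrow> real"
  assumes f: "f \<in> smooth" and U: "sphere 0 1 \<subseteq> U" and z: "\<And>y. norm y = 1 \<Longrightarrow> f y = 0"
    and x: "norm x = 1"
  shows "L f x = E (E f) x + (real DIM('a) - 2) * E f x"
proof -
  define v where "v b = (\<lambda>x. D b f x - (x \<bullet> b) * E f x)" for b
  have vs: "v b \<in> smooth" for b unfolding v_def by (intro smooth_intros f)
  have "v b y = 0" if "norm y = 1" for b y
    using D_tangential[OF f U z that] by (simp add: v_def)
  from D_tangential[OF vs U this x] have v: "D b (v b) x = (x \<bullet> b) * E (v b) x" for b .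
  have r: "(\<Sum>b\<in>Basis. (x \<bullet> b) * (x \<bullet> b)) = 1"
    using x by (simp add: euclidean_inner[symmetric] dot_square_norm)
  have "(\<Sum>b\<in>Basis. D b (v b) x) = L f x - (E (E f) x + real DIM('a) * E f x)"
    unfolding v_def
    by (simp add: D_diff D_coord smooth_intros f sum_subtractf sum.distrib L_def E_def[of "E f"])
  moreover have Ev: "E (v b) x = (D b (E f) x - D b f x) - (x \<bullet> b) * (E (E f) x + E f x)" for b
    unfolding v_def by (simp add: E_diff E_coord D_E smooth_intros f distrib_left)
  have "(x \<bullet> b) * E (v b) x = ((x \<bullet> b) * D b (E f) x - (x \<bullet> b) * D b f x)
      - ((x \<bullet> b) * (x \<bullet> b)) * (E (E f) x + E f x)" for b
    unfolding Ev by (simp add: algebra_simps)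
  then have "(\<Sum>b\<in>Basis. (x \<bullet> b) * E (v b) x) = (E (E f) x - E f x) - (E (E f) x + E f x)"
    by (simp add: sum_subtractf sum_distrib_right[symmetric] r E_def[symmetric])
  ultimately show ?thesis using v by (simp add: algebra_simps)
qed

section \<open>The lowest eigenvalue without magnetic potential\<close>


text \<open>Here \<open>h\<close> is the radial pairing of the field and \<open>g\<close> its
  divergence. The strategy is to find combinations of \<open>g\<close>, \<open>G\<close> and their
  Euler derivatives that are harmonic inside and vanish on the sphere, until a single equation for
  \<open>G\<close> is left.\<close>

lemma harmonic_field_eigenvalue_ge:
  fixes w :: "'a \<Rightarrow> 'a \<Rightarrow> real"
  assumes dim: "DIM('a) \<ge> 2" and U: "cball 0 1 \<subseteq> U"
    and w: "\<And>b. w b \<in> smooth"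
    and harm: "\<And>b x. b \<in> Basis \<Longrightarrow> norm x \<le> 1 \<Longrightarrow> L (w b) x = 0"
    and h_def: "h = (\<lambda>x. \<Sum>b\<in>Basis. (x \<bullet> b) * w b x)"
    and normal: "\<And>x. norm x = 1 \<Longrightarrow> h x = 0"
    and tangential: "\<And>b x. b \<in> Basis \<Longrightarrow> norm x = 1 \<Longrightarrow> E (w b) x = (\<sigma> - 1) * w b x + (x \<bullet> b) * E h x"
    and nonzero: "norm x0 = 1" "b0 \<in> Basis" "w b0 x0 \<noteq> 0"
  shows "\<sigma> \<ge> 1 + 2 / real DIM('a)"
proof (rule ccontr)
  define m where "m = real DIM('a)"
  have m: "m \<ge> 2" using dim by (simp add: m_def)
  assume "\<not> \<sigma> \<ge> 1 + 2 / real DIM('a)"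
  then have \<sigma>: "\<sigma> < 1 + 2 / m" by (simp add: m_def)
  then have \<sigma>m: "\<sigma> * m < m + 2" using m by (simp add: field_simps)
  have "2 / m \<le> 1" using m by simp
  then have \<sigma>2: "\<sigma> < 2" using \<sigma> by linarith
  have SU: "sphere 0 1 \<subseteq> U" and BU: "ball 0 1 \<subseteq> U" using U by auto
  have ball: "open (ball 0 1 :: 'a set)" "norm y < 1 \<longleftrightarrow> y \<in> ball 0 1" for y :: 'a by auto
  have sph: "y \<bullet> y = 1" if "norm y = 1" for y :: 'a using that by (simp add: dot_square_norm)
  define g where "g = (\<lambda>x. \<Sum>b\<in>Basis. D b (w b) x)"
  \<comment> \<open>\<open>G\<close> is the harmonic function with \<open>4 h = (\<bar>x\<bar>\<^sup>2 - 1) G\<close>, written without a division: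
    solve \<open>m G + 2 E G = 4 g\<close> (from \<open>L h = 2 g\<close>) and the Euler derivative of this factorization for \<open>G\<close>.\<close>
  define G where "G = (\<lambda>x. 2 * E h x + (m - 4) * h x + (g x - (x \<bullet> x) * g x))"
  have h: "h \<in> smooth" unfolding h_def by (intro smooth_intros w)
  have g: "g \<in> smooth" unfolding g_def by (intro smooth_intros w)
  have G: "G \<in> smooth" unfolding G_def by (intro smooth_intros h g)
  note sm = smooth_intros h g G w
  have Lh: "L h x = 2 * g x" if "norm x \<le> 1" for x
    unfolding h_def g_def by (simp add: L_sum L_coord sm harm that sum_distrib_left)
  have ELh: "E (L h) x = 2 * E g x" if "norm x < 1" for x
    using E_cong_on[OF ball(1), of x "L h" "\<lambda>x. 2 * g x"] that by (simp add: Lh E_cmult g)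
  have Lg: "L g x = 0" if "norm x < 1" for x
  proof -
    have "D b (L (w b)) x = 0" if "b \<in> Basis" for b
      by (rule D_zero_on[OF ball(1)]) (use \<open>norm x < 1\<close> that harm in auto)
    then show ?thesis unfolding g_def by (simp add: L_sum sm D_L[symmetric])
  qed
  have LG: "L G x = 0" if "norm x < 1" for x
    unfolding G_def
    by (simp add: L_add L_diff L_cmult L_radius L_E sm Lg[OF that] Lh ELh[OF that] less_imp_le[OF that]
        m_def[symmetric]) (simp add: algebra_simps)
  have ELG: "E (L G) x = 0" and ELg: "E (L g) x = 0" if "norm x < 1" for x
    by (rule E_zero_on[OF ball(1)]; use that LG Lg in auto)+
  have G_sph: "G x = 2 * E h x" if "norm x = 1" for x
    using normal[OF that] sph[OF that] by (simp add: G_def)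
  have EG_sph: "E G x = 2 * E (E h) x + (m - 4) * E h x - 2 * g x" if "norm x = 1" for x
    unfolding G_def using sph[OF that] by (simp add: E_add E_diff E_cmult E_radius sm)
  have EEh: "2 * g x = E (E h) x + (m - 2) * E h x" if "norm x = 1" for x
    using L_on_sphere[OF h SU normal that] Lh[of x] that by (simp add: m_def)
  \<comment> \<open>This has to precede \<open>h_G\<close>: it is exactly what makes the difference
    of the two sides of \<open>h_G\<close> harmonic.\<close>
  have g_G: "4 * g x = m * G x + 2 * E G x" if "norm x \<le> 1" for x
  proof -
    have "m * G x + 2 * E G x - 4 * g x = 0"
    proof (rule harmonic_zero[OF _ U _ _ that])
      show "(\<lambda>x. m * G x + 2 * E G x - 4 * g x) \<in> smooth" by (intro sm)
      show "L (\<lambda>x. m * G x + 2 * E G x - 4 * g x) y = 0" if "norm y < 1" for y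
        by (simp add: L_add L_diff L_cmult L_E sm LG[OF that] Lg[OF that] ELG[OF that])
      show "m * G y + 2 * E G y - 4 * g y = 0" if "norm y = 1" for y
        unfolding G_sph[OF that] EG_sph[OF that] using EEh[OF that] by (simp add: algebra_simps)
    qed
    then show ?thesis by simp
  qed
  have h_G: "4 * h x = (x \<bullet> x) * G x - G x" if "norm x \<le> 1" for x
  proof -
    have "4 * h x - ((x \<bullet> x) * G x - G x) = 0"
    proof (rule harmonic_zero[OF _ U _ _ that])
      show "(\<lambda>x. 4 * h x - ((x \<bullet> x) * G x - G x)) \<in> smooth" by (intro sm)
      show "L (\<lambda>x. 4 * h x - ((x \<bullet> x) * G x - G x)) y = 0" if "norm y < 1" for y
        using g_G[of y] that
        by (simp add: L_diff L_cmult L_radius sm LG[OF that] Lh m_def[symmetric])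
      show "4 * h y - ((y \<bullet> y) * G y - G y) = 0" if "norm y = 1" for y
        using normal[OF that] sph[OF that] by simp
    qed
    then show ?thesis by simp
  qed
  have G0: "G 0 = 0" using h_G[of 0] by (simp add: h_def)
  \<comment> \<open>Twice the defect of \<open>tangential\<close>, with \<open>E h\<close> replaced
    by \<open>G / 2\<close> as on the sphere. The factor \<open>x \<bullet> b\<close> spoils
    harmonicity, so uniqueness cannot be applied to \<open>u\<close> itself. Instead its divergence
    is used: since \<open>u\<close> vanishes on the sphere, there the divergence equals the pairing
    of x with the radial derivative of \<open>u\<close>.\<close>
  define u where "u b = (\<lambda>x. 2 * (E (w b) x - (\<sigma> - 1) * w b x) - (x \<bullet> b) * G x)" for b
  have u: "u b \<in> smooth" for b unfolding u_def by (intro sm)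
  have u_sph: "u b x = 0" if "norm x = 1" "b \<in> Basis" for b x
    using tangential[OF that(2,1)] G_sph[OF that(1)] by (simp add: u_def)
  have div_u: "(\<Sum>b\<in>Basis. D b (u b) x) = 2 * (E g x + (2 - \<sigma>) * g x) - (E G x + m * G x)" for x
  proof -
    have "D b (u b) x = 2 * (E (D b (w b)) x + (2 - \<sigma>) * D b (w b) x) - ((x \<bullet> b) * D b G x + G x)"
      if "b \<in> Basis" for b
      unfolding u_def using that by (simp add: D_diff D_cmult D_coord D_E sm) (simp add: algebra_simps)
    then have "(\<Sum>b\<in>Basis. D b (u b) x) = (\<Sum>b\<in>Basis. 2 * (E (D b (w b)) x + (2 - \<sigma>) * D b (w b) x)
        - ((x \<bullet> b) * D b G x + G x))" by simp
    also have "\<dots> = 2 * ((\<Sum>b\<in>Basis. E (D b (w b)) x) + (2 - \<sigma>) * g x) - (E G x + m * G x)"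
      by (simp add: sum.distrib sum_subtractf sum_distrib_left[symmetric] g_def E_def m_def
          sum_divide_distrib[symmetric])
    also have "(\<Sum>b\<in>Basis. E (D b (w b)) x) = E g x"
      unfolding g_def by (simp add: E_sum sm)
    finally show ?thesis .
  qed
  have xu: "(\<lambda>x. \<Sum>b\<in>Basis. (x \<bullet> b) * u b x) = (\<lambda>x. 2 * (E h x - \<sigma> * h x) - (x \<bullet> x) * G x)"
  proof
    fix x
    have "(\<Sum>b\<in>Basis. (x \<bullet> b) * u b x) = (\<Sum>b\<in>Basis. 2 * (((x \<bullet> b) * E (w b) x + (x \<bullet> b) * w b x)
        - \<sigma> * ((x \<bullet> b) * w b x)) - (x \<bullet> b) * (x \<bullet> b) * G x)"
      by (rule sum.cong) (auto simp: u_def algebra_simps)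
    also have "\<dots> = 2 * ((\<Sum>b\<in>Basis. (x \<bullet> b) * E (w b) x + (x \<bullet> b) * w b x) - \<sigma> * h x)
        - (x \<bullet> x) * G x"
      by (simp only: sum_subtractf sum_distrib_left[symmetric] sum_distrib_right[symmetric] h_def
          euclidean_inner[of x x])
    also have "(\<Sum>b\<in>Basis. (x \<bullet> b) * E (w b) x + (x \<bullet> b) * w b x) = E h x"
      unfolding h_def by (simp add: E_sum E_coord sm)
    finally show "(\<Sum>b\<in>Basis. (x \<bullet> b) * u b x) = 2 * (E h x - \<sigma> * h x) - (x \<bullet> x) * G x" .
  qed
  \<comment> \<open>The two expressions for the divergence of \<open>u\<close>, after eliminating
    \<open>E h\<close> and \<open>E (E h)\<close> in favour of \<open>G\<close> and
    \<open>g\<close>. What remains is harmonic, so the boundary identity extends to the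
    ball.\<close>
  have K: "2 * (E g x + (2 - \<sigma>) * g x - E G x) - (m - \<sigma>) * G x = 0" if "norm x \<le> 1" for x
  proof (rule harmonic_zero[OF _ U _ _ that])
    show "(\<lambda>x. 2 * (E g x + (2 - \<sigma>) * g x - E G x) - (m - \<sigma>) * G x) \<in> smooth" by (intro sm)
    show "L (\<lambda>x. 2 * (E g x + (2 - \<sigma>) * g x - E G x) - (m - \<sigma>) * G x) y = 0" if "norm y < 1" for y
      by (simp add: L_add L_diff L_cmult L_E sm LG[OF that] Lg[OF that] ELG[OF that] ELg[OF that])
    fix y :: 'a assume y: "norm y = 1"
    have "(\<Sum>b\<in>Basis. D b (u b) y) = (\<Sum>b\<in>Basis. (y \<bullet> b) * E (u b) y)"
      by (rule sum.cong) (use D_tangential[OF u SU u_sph y] in \<open>auto simp: inner_commute\<close>)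
    also have "\<dots> = E (\<lambda>x. \<Sum>b\<in>Basis. (x \<bullet> b) * u b x) y - (\<Sum>b\<in>Basis. (y \<bullet> b) * u b y)"
      by (simp add: E_sum E_coord smooth_intros u sum.distrib)
    also have "(\<Sum>b\<in>Basis. (y \<bullet> b) * u b y) = 0" using u_sph[OF y] by simp
    also have "E (\<lambda>x. \<Sum>b\<in>Basis. (x \<bullet> b) * u b x) y =
        2 * (E (E h) y - \<sigma> * E h y) - (E G y + 2 * G y)"
      unfolding xu using sph[OF y] by (simp add: E_diff E_cmult E_radius sm)
    finally have "2 * (E g y + (2 - \<sigma>) * g y) - (E G y + m * G y) =
        2 * (E (E h) y - \<sigma> * E h y) - (E G y + 2 * G y)" unfolding div_u by simp
    moreover have "E h y = G y / 2" using G_sph[OF y] by simp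
    moreover have "E (E h) y = 2 * g y - (m - 2) * (G y / 2)"
      using EEh[OF y] \<open>E h y = G y / 2\<close> by simp
    ultimately show "2 * (E g y + (2 - \<sigma>) * g y - E G y) - (m - \<sigma>) * G y = 0"
      using g_G[of y] y by (simp add: field_simps)
  qed
  have quad: "2 * E (E G) x + (m - 2 * \<sigma>) * E G x - \<sigma> * (m - 2) * G x = 0" if "norm x < 1" for x
  proof -
    have "E (\<lambda>x. 4 * g x) x = E (\<lambda>x. m * G x + 2 * E G x) x"
      by (rule E_cong_on[OF ball(1)]) (use that g_G in auto)
    then have "4 * E g x = m * E G x + 2 * E (E G) x" by (simp add: E_add E_cmult sm)
    moreover have "2 * (2 * (E g x + (2 - \<sigma>) * g x - E G x) - (m - \<sigma>) * G x) =
        4 * E g x + (2 - \<sigma>) * (4 * g x) - 4 * E G x - 2 * (m - \<sigma>) * G x"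
      by (simp add: algebra_simps)
    ultimately have "m * E G x + 2 * E (E G) x + (2 - \<sigma>) * (m * G x + 2 * E G x) - 4 * E G x
        - 2 * (m - \<sigma>) * G x = 0"
      using K[of x] that g_G[of x] by simp
    then show ?thesis by (simp add: algebra_simps)
  qed
  define \<Delta> where "\<Delta> = (m + 2 * \<sigma>)\<^sup>2 - 16 * \<sigma>"
  define e1 where "e1 = (2 * \<sigma> - m + sqrt \<Delta>) / 4"
  define e2 where "e2 = (2 * \<sigma> - m - sqrt \<Delta>) / 4"
  have \<Delta>_eq: "\<Delta> = (m - 2 * \<sigma>)\<^sup>2 + 8 * \<sigma> * (m - 2)"
    by (simp add: \<Delta>_def power2_eq_square algebra_simps)
  \<comment> \<open>The sign of \<sigma> is still open here: for \<sigma> \<ge> 0 the form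
    \<open>\<Delta>_eq\<close> is a sum of non-negative terms, for negative \<sigma> the defining
    form is.\<close>
  have "\<Delta> \<ge> 0"
  proof (cases "\<sigma> \<ge> 0")
    case True
    then show ?thesis using m by (simp add: \<Delta>_eq)
  next
    case False
    then have "(m + 2 * \<sigma>)\<^sup>2 - 16 * \<sigma> \<ge> 0" by (simp add: add_nonneg_nonneg diff_le_eq order_trans[of _ 0])
    then show ?thesis by (simp add: \<Delta>_def)
  qed
  then have sq: "sqrt \<Delta> * sqrt \<Delta> = \<Delta>" "sqrt \<Delta> \<ge> 0" by simp_all
  have roots: "e1 + e2 = (2 * \<sigma> - m) / 2" "e1 * e2 = - \<sigma> * (m - 2) / 2"
    using sq(1) by (simp_all add: e1_def e2_def \<Delta>_eq power2_eq_square field_simps)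
  \<comment> \<open>The claim \<open>e1 < 1\<close> means
    \<open>sqrt \<Delta> < 4 + m - 2 * \<sigma>\<close>; the difference of squares is positive
    exactly when \<sigma> < 1 + 2/m.\<close>
  have "(4 + m - 2 * \<sigma>)\<^sup>2 - \<Delta> = 8 * (m + 2 - \<sigma> * m)"
    by (simp add: \<Delta>_def power2_eq_square algebra_simps)
  then have "(sqrt \<Delta>)\<^sup>2 < (4 + m - 2 * \<sigma>)\<^sup>2" using \<sigma>m sq by (simp add: power2_eq_square)
  then have "sqrt \<Delta> < 4 + m - 2 * \<sigma>" by (rule power2_less_imp_less) (use m \<sigma>2 in linarith)
  then have e: "e1 < 1" "e2 < 1" unfolding e1_def e2_def using sq(2) \<sigma>2 m by (auto simp only: divide_less_eq_1_pos)
  \<comment> \<open>The equation factors as (E - e1)(E - e2) G = 0, so \<open>euler_zero\<close> is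
    applied once for each root.\<close>
  have "E G x - e2 * G x = 0" if "norm x < 1" for x
  proof (rule euler_zero[OF _ BU _ e(1) _ that])
    show "(\<lambda>x. E G x - e2 * G x) \<in> smooth" by (intro sm)
    show "E (\<lambda>x. E G x - e2 * G x) y = e1 * (E G y - e2 * G y)" if "norm y < 1" for y
    proof -
      have "E (E G) y = (e1 + e2) * E G y - e1 * e2 * G y"
        unfolding roots using quad[OF that] by (simp add: field_simps)
      then show ?thesis by (simp add: E_diff E_cmult sm algebra_simps)
    qed
    show "E G 0 - e2 * G 0 = 0" by (simp add: G0 E_def)
  qed
  then have "G x = 0" if "norm x < 1" for x
    by (intro euler_zero[OF G BU _ e(2) G0 that]) simp
  then have G_zero: "G x = 0" if "norm x \<le> 1" for x
    using zero_on_cball[OF G U] that by blast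
  have h0: "h x = 0" if "norm x \<le> 1" for x using h_G[OF that] G_zero[OF that] by simp
  \<comment> \<open>Differentiating the sum of the products x_b w_b at the origin recovers w_b(0);
    this supplies the value at 0 that \<open>euler_zero\<close> requires.\<close>
  have w0: "w b 0 = 0" if b: "b \<in> Basis" for b
  proof -
    have "D b h 0 = 0" by (rule D_zero_on[OF ball(1)]) (use h0 in auto)
    moreover have "D b h 0 = (\<Sum>c\<in>Basis. (b \<bullet> c) * w c 0)"
      unfolding h_def by (simp add: D_sum D_coord sm)
    moreover have "\<dots> = (\<Sum>c\<in>Basis. if b = c then w c 0 else 0)"
      by (rule sum.cong) (use b in \<open>auto simp: inner_Basis\<close>)
    ultimately show ?thesis using b by simp
  qed
  have hom: "E (w b) x = (\<sigma> - 1) * w b x" if b: "b \<in> Basis" and "norm x \<le> 1" for b x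
  proof -
    have "E (w b) x - (\<sigma> - 1) * w b x = 0"
    proof (rule harmonic_zero[OF _ U _ _ that(2)])
      show "(\<lambda>x. E (w b) x - (\<sigma> - 1) * w b x) \<in> smooth" by (intro sm)
      show "L (\<lambda>x. E (w b) x - (\<sigma> - 1) * w b x) y = 0" if y: "norm y < 1" for y
      proof -
        have "E (L (w b)) y = 0" by (rule E_zero_on[OF ball(1)]) (use y harm b in auto)
        then show ?thesis using y b by (simp add: L_diff L_cmult L_E sm harm)
      qed
      show "E (w b) y - (\<sigma> - 1) * w b y = 0" if "norm y = 1" for y
        using tangential[OF b that] G_sph[OF that] G_zero[of y] that by simp
    qed
    then show ?thesis by simp
  qed
  have "w b0 x = 0" if "norm x < 1" for x
    by (rule euler_zero[OF w BU _ _ w0[OF nonzero(2)] that]) (use hom nonzero \<sigma>2 in auto)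
  then have "w b0 x0 = 0" using zero_on_cball[OF w U] nonzero(1) by simp
  then show False using nonzero(3) by simp
qed

section \<open>A lower bound for small magnetic potentials\<close>


lemma D_square: "f \<in> smooth \<Longrightarrow> D v (\<lambda>x. f x * f x :: real) = (\<lambda>x. 2 * (f x * D v f x))"
  by (simp add: D_mult)

lemma L_square:
  assumes "f \<in> smooth"
  shows "L (\<lambda>x. f x * f x :: real) x = 2 * (f x * L f x + (\<Sum>b\<in>Basis. (D b f x)\<^sup>2))"
proof -
  have "D b (D b (\<lambda>x. f x * f x)) x = 2 * (f x * D b (D b f) x + (D b f x)\<^sup>2)" for b
    by (simp add: D_square D_cmult D_mult smooth_intros assms power2_eq_square)
  then show ?thesis by (simp add: L_def sum_distrib_left sum.distrib distrib_left)
qed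

lemma E_square: "f \<in> smooth \<Longrightarrow> E (\<lambda>x. f x * f x) x = 2 * (f x * E f x)"
  by (simp add: E_eq_D smooth_mult D_square)

lemma E_boundary_max:
  fixes k :: "'a \<Rightarrow> real"
  assumes k: "k \<in> smooth" and U: "cball 0 1 \<subseteq> U" and y: "norm y = 1"
    and max: "\<And>x. norm x \<le> 1 \<Longrightarrow> k x \<le> k y"
  shows "E k y \<ge> 0"
proof (rule ccontr)
  assume "\<not> E k y \<ge> 0"
  moreover have "((\<lambda>s. k (s *\<^sub>R y)) has_real_derivative E k y) (at 1)"
  proof -
    have "0 + 1 *\<^sub>R y \<in> U" using U y by auto
    from D_line[OF k this] show ?thesis by (simp add: E_eq_D[OF k])
  qed
  ultimately obtain d where d: "d > 0" "\<And>h. 0 < h \<Longrightarrow> h < d \<Longrightarrow> k (1 *\<^sub>R y) < k ((1 - h) *\<^sub>R y)"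
    using DERIV_neg_dec_left[of "\<lambda>s. k (s *\<^sub>R y)" "E k y" 1] by force
  define h where "h = min d 1 / 2"
  have "0 < h" "h < d" "h < 1" using d(1) by (auto simp: h_def)
  then show False using d(2)[of h] max[of "(1 - h) *\<^sub>R y"] y by simp
qed

text \<open>The squared length \<open>u\<close> of the field satisfies \<open>L u \<ge> - 4 a u\<close>; it is compared with the
  strict supersolution \<open>2 - \<bar>x\<bar>\<^sup>2\<close> at a maximum of the quotient.\<close>

lemma magnetic_field_eigenvalue_nonneg:
  fixes p q :: "'a \<Rightarrow> 'a \<Rightarrow> real"
  assumes U: "cball 0 1 \<subseteq> U" and A: "linear A" "\<And>x. norm (A x) \<le> a * norm x" and a: "4 * a < real DIM('a)"
    and p: "\<And>b. p b \<in> smooth" and q: "\<And>b. q b \<in> smooth"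
    and Lp: "\<And>c x. c \<in> Basis \<Longrightarrow> norm x \<le> 1 \<Longrightarrow>
      L (p c) x = 2 * D (A x) (q c) x + (A x \<bullet> A x) * p c x - 2 * (\<Sum>b\<in>Basis. (A b \<bullet> c) * q b x)"
    and Lq: "\<And>c x. c \<in> Basis \<Longrightarrow> norm x \<le> 1 \<Longrightarrow>
      L (q c) x = - 2 * D (A x) (p c) x + (A x \<bullet> A x) * q c x + 2 * (\<Sum>b\<in>Basis. (A b \<bullet> c) * p b x)"
    and u_def: "u = (\<lambda>x. \<Sum>b\<in>Basis. p b x * p b x + q b x * q b x)"
    and radial: "\<And>x. norm x = 1 \<Longrightarrow> (\<Sum>b\<in>Basis. p b x * E (p b) x + q b x * E (q b) x) = (\<sigma> - 1) * u x"
    and nonzero: "norm x0 = 1" "u x0 \<noteq> 0"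
  shows "\<sigma> \<ge> 0"
proof -
  have u: "u \<in> smooth" unfolding u_def by (intro smooth_intros p q)
  have u0: "u x \<ge> 0" for x unfolding u_def by (intro sum_nonneg) simp
  have a0: "a \<ge> 0"
  proof -
    have "0 \<le> a * norm x0" using A(2)[of x0] norm_ge_zero order_trans by blast
    then show ?thesis using nonzero(1) by simp
  qed
  have Lu: "L u x \<ge> - 4 * a * u x" if x: "norm x \<le> 1" for x
  proof -
    define P where "P = (\<Sum>b\<in>Basis. p b x *\<^sub>R b)"
    define Q where "Q = (\<Sum>b\<in>Basis. q b x *\<^sub>R b)"
    have PQ: "P \<bullet> b = p b x" "Q \<bullet> b = q b x" if "b \<in> Basis" for b
      using that by (simp_all add: P_def Q_def)
    have AP: "A P = (\<Sum>b\<in>Basis. p b x *\<^sub>R A b)" "A Q = (\<Sum>b\<in>Basis. q b x *\<^sub>R A b)"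
      by (simp_all add: P_def Q_def linear_sum[OF A(1)] linear_cmul[OF A(1)])
    \<comment> \<open>Completing the square: the quadratic term in the potential and the squared
      gradient absorb the first-order magnetic term, leaving only the constant field
      strength.\<close>
    have young: "2 * (s * D (A x) f x) \<ge> - ((A x \<bullet> A x) * s\<^sup>2) - (\<Sum>b\<in>Basis. (D b f x)\<^sup>2)"
      if f: "f \<in> smooth" for f :: "'a \<Rightarrow> real" and s :: real
    proof -
      have "0 \<le> (\<Sum>b\<in>Basis. ((A x \<bullet> b) * s + D b f x)\<^sup>2)" by (intro sum_nonneg) simp
      also have "\<dots> = (\<Sum>b\<in>Basis. ((A x \<bullet> b) * (A x \<bullet> b)) * s\<^sup>2) + 2 * (s * (\<Sum>b\<in>Basis. (A x \<bullet> b) * D b f x))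
          + (\<Sum>b\<in>Basis. (D b f x)\<^sup>2)"
        by (simp add: sum.distrib[symmetric] sum_distrib_left power2_eq_square algebra_simps)
      also have "(\<Sum>b\<in>Basis. (A x \<bullet> b) * D b f x) = D (A x) f x"
        by (simp add: D_expand[OF f, of "A x"])
      also have "(\<Sum>b\<in>Basis. ((A x \<bullet> b) * (A x \<bullet> b)) * s\<^sup>2) = (A x \<bullet> A x) * s\<^sup>2"
        by (simp add: sum_distrib_right[symmetric] euclidean_inner[of "A x" "A x"])
      finally show ?thesis by simp
    qed
    have AQP: "\<bar>A y \<bullet> z\<bar> \<le> a * ((y \<bullet> y + z \<bullet> z) / 2)" for y z
    proof -
      have "\<bar>A y \<bullet> z\<bar> \<le> norm (A y) * norm z" by (rule Cauchy_Schwarz_ineq2)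
      also have "\<dots> \<le> a * norm y * norm z" using A(2) by (rule mult_right_mono) simp
      also have "\<dots> = a * (norm y * norm z)" by simp
      also have "\<dots> \<le> a * ((y \<bullet> y + z \<bullet> z) / 2)"
        using sum_squares_bound[of "norm y" "norm z"] a0
        by (intro mult_left_mono) (simp_all add: power2_norm_eq_inner[symmetric])
      finally show ?thesis .
    qed
    have uPQ: "P \<bullet> P + Q \<bullet> Q = u x"
      by (simp add: u_def sum.distrib euclidean_inner[of P P] euclidean_inner[of Q Q] PQ)
    have "- (2 * a * u x) \<le> - 2 * (A Q \<bullet> P) + 2 * (A P \<bullet> Q)"
      using AQP[of Q P] AQP[of P Q] unfolding uPQ[symmetric] by (simp add: field_simps abs_if split: if_splits)
    also have "A Q \<bullet> P = (\<Sum>c\<in>Basis. p c x * (\<Sum>b\<in>Basis. (A b \<bullet> c) * q b x))"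
      by (subst euclidean_inner) (simp add: PQ AP inner_sum_left mult.commute)
    also have "A P \<bullet> Q = (\<Sum>c\<in>Basis. q c x * (\<Sum>b\<in>Basis. (A b \<bullet> c) * p b x))"
      by (subst euclidean_inner) (simp add: PQ AP inner_sum_left mult.commute)
    also have "- 2 * (\<Sum>c\<in>Basis. p c x * (\<Sum>b\<in>Basis. (A b \<bullet> c) * q b x)) +
        2 * (\<Sum>c\<in>Basis. q c x * (\<Sum>b\<in>Basis. (A b \<bullet> c) * p b x)) =
        (\<Sum>c\<in>Basis. - 2 * (p c x * (\<Sum>b\<in>Basis. (A b \<bullet> c) * q b x)) +
          2 * (q c x * (\<Sum>b\<in>Basis. (A b \<bullet> c) * p b x)))"
      by (simp only: sum.distrib sum_distrib_left)
    also have "\<dots> \<le> (\<Sum>c\<in>Basis. (p c x * L (p c) x + (\<Sum>b\<in>Basis. (D b (p c) x)\<^sup>2)) +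
        (q c x * L (q c) x + (\<Sum>b\<in>Basis. (D b (q c) x)\<^sup>2)))"
    proof (rule sum_mono)
      fix c :: 'a assume c: "c \<in> Basis"
      have "p c x * L (p c) x + q c x * L (q c) x =
          2 * (p c x * D (A x) (q c) x) + (A x \<bullet> A x) * (p c x)\<^sup>2 - 2 * (p c x * (\<Sum>b\<in>Basis. (A b \<bullet> c) * q b x))
          + (2 * ((- q c x) * D (A x) (p c) x) + (A x \<bullet> A x) * (- q c x)\<^sup>2 + 2 * (q c x * (\<Sum>b\<in>Basis. (A b \<bullet> c) * p b x)))"
        unfolding Lp[OF c x] Lq[OF c x] by (simp add: algebra_simps power2_eq_square)
      then show "- 2 * (p c x * (\<Sum>b\<in>Basis. (A b \<bullet> c) * q b x)) +
          2 * (q c x * (\<Sum>b\<in>Basis. (A b \<bullet> c) * p b x)) \<le>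
          (p c x * L (p c) x + (\<Sum>b\<in>Basis. (D b (p c) x)\<^sup>2)) +
          (q c x * L (q c) x + (\<Sum>b\<in>Basis. (D b (q c) x)\<^sup>2))"
        using young[OF q, of "p c x" c] young[OF p, of "- q c x" c] by linarith
    qed
    also have "2 * \<dots> = L u x"
      unfolding u_def
      by (simp add: L_sum L_add L_square smooth_intros p q sum_distrib_left distrib_left)
    finally show ?thesis by simp
  qed
  \<comment> \<open>With the constant 2 one has v = 1 and E v = -2 on the sphere, which exactly
    offsets the -1 in \<open>\<sigma> - 1\<close>. In the ball v \<le> 2 and L v = -2 m, so L v + 4
    a v < 0 as soon as 4 a < m.\<close>
  define v where "v x = 2 - x \<bullet> x" for x :: 'a
  have v: "v x \<ge> 1" "v x \<le> 2" if "norm x \<le> 1" for x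
    using that by (simp_all add: v_def dot_square_norm power_le_one)
  have "continuous_on (cball 0 1) (\<lambda>x. u x / v x)"
    using smooth_continuous_on[OF u] U v
    by (intro continuous_on_divide) (force simp: v_def[abs_def] intro!: continuous_intros intro: continuous_on_subset)+
  from continuous_attains_sup[OF compact_cball _ this] obtain y
    where y: "norm y \<le> 1" and max: "\<And>x. norm x \<le> 1 \<Longrightarrow> u x / v x \<le> u y / v y" by auto
  define \<mu> where "\<mu> = u y / v y"
  have "\<mu> > 0"
  proof -
    have "u x0 > 0" using u0[of x0] nonzero by simp
    then have "u x0 / v x0 > 0" using v(1)[of x0] nonzero(1) by simp
    then show ?thesis using max[of x0] nonzero(1) unfolding \<mu>_def by linarith
  qed
  have uy: "u y = \<mu> * v y" using v(1)[OF y] by (simp add: \<mu>_def)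
  have ux: "u x \<le> \<mu> * v x" if "norm x \<le> 1" for x
    using max[OF that] v(1)[OF that] unfolding \<mu>_def by (simp add: pos_divide_le_eq)
  \<comment> \<open>On the closed ball this is \<open>u - \<mu> * v\<close>, whose maximum 0 is
    attained at \<open>y\<close>. An interior \<open>y\<close> contradicts the sign of the
    Laplacian; a boundary \<open>y\<close> gives a sign for the radial derivative, which is the
    claim.\<close>
  define k where "k = (\<lambda>x. u x - \<mu> * (2 * one x - (x \<bullet> x) * one x))"
  have k: "k \<in> smooth" unfolding k_def by (intro smooth_intros u smooth_one)
  have yU: "y \<in> U" using y U by auto
  have kmax: "k x \<le> k y" if "norm x \<le> 1" for x
  proof -
    have "k x = u x - \<mu> * v x" "k y = u y - \<mu> * v y"
      using that yU U by (auto simp: k_def one_def v_def)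
    then show ?thesis using ux[OF that] uy by simp
  qed
  have "norm y = 1"
  proof (rule ccontr)
    assume "norm y \<noteq> 1"
    then have y1: "norm y < 1" using y by simp
    have "L k y \<le> 0"
    proof (rule L_local_max[OF k])
      have sub: "ball y (1 - norm y) \<subseteq> ball 0 1"
        using ball_subset_ball_iff[of y "1 - norm y" 0 1] by simp
      then show "ball y (1 - norm y) \<subseteq> U" using U ball_subset_cball by blast
      show "k w \<le> k y" if "w \<in> ball y (1 - norm y)" for w
        using kmax[of w] sub that by (auto simp: subset_iff)
    qed (use y1 in simp)
    moreover have "L k y = L u y + 2 * \<mu> * real DIM('a)"
      unfolding k_def using yU
      by (simp add: L_diff L_cmult L_radius smooth_intros u smooth_one L_one E_one one_def[of y])
    moreover have "L u y \<ge> - 4 * a * (\<mu> * 2)"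
    proof -
      have "4 * a * (\<mu> * v y) \<le> 4 * a * (\<mu> * 2)"
        using v(2)[OF y] a0 \<open>\<mu> > 0\<close> by (intro mult_left_mono) auto
      moreover have "L u y \<ge> - (4 * a * (\<mu> * v y))" using Lu[OF y] unfolding uy by simp
      ultimately show ?thesis by linarith
    qed
    ultimately have "2 * \<mu> * (real DIM('a) - 4 * a) \<le> 0" by (simp add: algebra_simps)
    then show False using a \<open>\<mu> > 0\<close> by (simp add: mult_le_0_iff)
  qed
  then have yy: "y \<bullet> y = 1" by (simp add: dot_square_norm)
  then have "v y = 1" by (simp add: v_def)
  have "0 \<le> E k y" by (rule E_boundary_max[OF k U \<open>norm y = 1\<close> kmax])
  also have "E k y = E u y + 2 * \<mu>"
    unfolding k_def using yU yy
    by (simp add: E_diff E_cmult E_radius smooth_intros u smooth_one E_one one_def[of y])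
  also have "E u y = 2 * (\<Sum>b\<in>Basis. p b y * E (p b) y + q b y * E (q b) y)"
    unfolding u_def
    by (simp add: E_sum E_add E_square smooth_intros p q sum_distrib_left distrib_left)
  also have "\<dots> = 2 * ((\<sigma> - 1) * u y)" unfolding radial[OF \<open>norm y = 1\<close>] ..
  also have "u y = \<mu>" using uy \<open>v y = 1\<close> by simp
  finally have "0 \<le> 2 * \<mu> * \<sigma>" by (simp add: algebra_simps)
  then show ?thesis using \<open>\<mu> > 0\<close> by (simp add: zero_le_mult_iff)
qed

end

section \<open>The magnetic Laplacian in components\<close>

text \<open>The form operators differentiate within the closed ball, also at boundary points. There
  one-sided derivatives along segments fix the differential on all vectors y - x with y in S, and
  differences of such vectors, taken inside a small ball contained in S, reach every
  direction.\<close>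

lemma has_derivative_within_convex_unique:
  fixes f :: "'a::euclidean_space \<Rightarrow> 'b::real_normed_vector"
  assumes S: "convex S" "interior S \<noteq> {}" "x \<in> S"
    and f: "(f has_derivative f') (at x within S)" "(f has_derivative f'') (at x within S)"
  shows "f' = f''"
proof
  fix v :: 'a
  define d where "d v = f' v - f'' v" for v
  have d: "((\<lambda>_. 0) has_derivative d) (at x within S)"
    using has_derivative_diff[OF f] by (simp add: d_def[abs_def])
  then have lin: "linear d" by (rule has_derivative_linear)
  have toward: "d (y - x) = 0" if "y \<in> S" for y
  proof -
    have seg: "((\<lambda>s. x + s *\<^sub>R (y - x)) has_derivative (\<lambda>t. t *\<^sub>R (y - x))) (at 0 within {0..1::real})"
      by (auto intro!: derivative_eq_intros)
    have "(\<lambda>s. x + s *\<^sub>R (y - x)) ` {0..1} \<subseteq> S"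
    proof clarify
      fix s :: real assume "s \<in> {0..1}"
      then have "(1 - s) *\<^sub>R x + s *\<^sub>R y \<in> S" using S that by (intro convexD) auto
      then show "x + s *\<^sub>R (y - x) \<in> S" by (simp add: algebra_simps)
    qed
    then have "((\<lambda>_. 0) has_derivative d) (at (x + 0 *\<^sub>R (y - x)) within (\<lambda>s. x + s *\<^sub>R (y - x)) ` {0..1})"
      using has_derivative_subset[OF d] by simp
    from has_derivative_in_compose[OF seg this]
    have "((\<lambda>_. 0) has_vector_derivative d (y - x)) (at 0 within cbox 0 (1::real))"
      by (simp add: has_vector_derivative_def linear_cmul[OF lin])
    from vector_derivative_unique_within_closed_interval[OF _ _ this has_vector_derivative_const]
    show ?thesis by simp
  qed
  obtain z e where "e > 0" and e: "cball z e \<subseteq> S"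
    using S(2) by (metis ex_in_conv mem_interior_cball)
  define s where "s = e / (norm v + 1)"
  have s: "s > 0" using \<open>e > 0\<close> by (simp add: s_def add_nonneg_pos)
  have "s * norm v \<le> e"
    using \<open>e > 0\<close> by (simp add: s_def pos_divide_le_eq add_nonneg_pos)
  then have "z + s *\<^sub>R v \<in> S" "z \<in> S" using e s \<open>e > 0\<close> by (auto simp: subset_iff dist_norm)
  then have "d ((z + s *\<^sub>R v) - x) - d (z - x) = 0" using toward by simp
  then have "s *\<^sub>R d v = 0" by (simp add: linear_diff[OF lin, symmetric] linear_cmul[OF lin, symmetric])
  then show "f' v = f'' v" using s by (simp add: d_def)
qed

lemma frechet_derivative_within_cball:
  fixes f :: "'a::euclidean_space \<Rightarrow> 'b::real_normed_vector"
  assumes "(f has_derivative f') (at x within cball 0 1)" "norm x \<le> 1"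
  shows "frechet_derivative f (at x within cball 0 1) = f'"
proof (rule has_derivative_within_convex_unique[OF _ _ _ _ assms(1)])
  show "(f has_derivative frechet_derivative f (at x within cball 0 1)) (at x within cball 0 1)"
    using assms(1) by (metis differentiable_def frechet_derivative_works)
qed (use assms(2) in auto)

lemma alternating_form_linear:
  assumes "alternating_form 1 UNIV \<phi>"
  shows "linear (\<lambda>v. \<phi> [v])"
proof -
  have lin: "\<phi> [c *\<^sub>R u + v] = c *\<^sub>R \<phi> [u] + \<phi> [v]" for c u v
    using assms unfolding alternating_form_def by (metis append_Nil list.size(3) plus_nat.add_0 subset_UNIV)
  have "\<phi> [0] = 0" using lin[of 1 0 0] by simp
  then show ?thesis using lin[of 1] lin[of _ _ 0] by (intro linearI) simp_all
qed

context open_set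
begin

lemma frechet_derivative_within_eq_D:
  assumes "f \<in> smooth" "cball 0 1 \<subseteq> U" "\<And>y. norm y \<le> 1 \<Longrightarrow> g y = f y" "norm x \<le> 1"
  shows "frechet_derivative g (at x within cball 0 1) v = D v f x"
proof -
  have "x \<in> U" using assms(2,4) by auto
  then have "(f has_derivative (\<lambda>v. D v f x)) (at x within cball 0 1)"
    using smooth_has_derivative[OF assms(1)] has_derivative_at_withinI by blast
  then have "(g has_derivative (\<lambda>v. D v f x)) (at x within cball 0 1)"
    by (rule has_derivative_transform[rotated 2]) (use assms(3,4) in auto)
  from frechet_derivative_within_cball[OF this assms(4)] show ?thesis by simp
qed

text \<open>The value on \<open>v\<close> of the one-form with components \<open>w b\<close>. For
  fixed \<open>v\<close> it is a finite combination of smooth functions, so \<open>D\<close> and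
  \<open>L\<close> can be applied to it.\<close>

definition W :: "('a \<Rightarrow> 'a \<Rightarrow> complex) \<Rightarrow> 'a \<Rightarrow> 'a \<Rightarrow> complex" where
  "W w v x = (\<Sum>b\<in>Basis. (v \<bullet> b) *\<^sub>R w b x)"

lemma W_Basis: "b \<in> Basis \<Longrightarrow> W w b = w b"
proof
  fix x assume "b \<in> Basis"
  then have "W w b x = (\<Sum>c\<in>Basis. if c = b then w c x else 0)"
    unfolding W_def by (intro sum.cong) (auto simp: inner_Basis)
  then show "W w b x = w b x" using \<open>b \<in> Basis\<close> by simp
qed

lemma smooth_scaleR: "f \<in> smooth \<Longrightarrow> (\<lambda>x. c *\<^sub>R f x) \<in> smooth"
  by (rule smooth_bounded_linear[OF bounded_linear_scaleR_right])

lemma smooth_W: "(\<And>b. w b \<in> smooth) \<Longrightarrow> W w v \<in> smooth"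
  unfolding W_def[abs_def] by (intro smooth_sum smooth_scaleR)

lemma D_W: "(\<And>b. w b \<in> smooth) \<Longrightarrow> D u (W w v) x = (\<Sum>b\<in>Basis. (v \<bullet> b) *\<^sub>R D u (w b) x)"
  unfolding W_def[abs_def]
  by (simp add: D_sum smooth_scaleR D_bounded_linear[OF bounded_linear_scaleR_right])

end

locale form_components = open_set U for U :: "'a::euclidean_space set" +
  fixes w :: "'a \<Rightarrow> 'a \<Rightarrow> complex" and \<omega> :: "'a cform" and A :: "'a \<Rightarrow> 'a"
  assumes U: "cball 0 1 \<subseteq> U" and w: "\<And>b. w b \<in> smooth"
    and \<omega>: "\<And>x v. norm x \<le> 1 \<Longrightarrow> \<omega> x [v] = W w v x"
    and \<omega>_length: "\<And>x vs. norm x \<le> 1 \<Longrightarrow> length vs \<noteq> 1 \<Longrightarrow> \<omega> x vs = 0"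
    and A: "linear A" and skew: "\<And>x y. A x \<bullet> y = - (x \<bullet> A y)"
begin

lemma frechet_zero_within:
  fixes g :: "'a \<Rightarrow> complex"
  assumes "\<And>y. norm y \<le> 1 \<Longrightarrow> g y = 0" "norm x \<le> 1"
  shows "frechet_derivative g (at x within cball 0 1) v = 0"
  using frechet_derivative_within_eq_D[OF smooth_zero U, of g x v] assms by (simp add: D_zero)

lemma magnetic_codiff_eq:
  assumes "norm x \<le> 1"
  shows "magnetic_codiff (cball 0 1) A \<omega> x [] =
    - (\<Sum>b\<in>Basis. D b (w b) x) + \<i> * (\<Sum>b\<in>Basis. (x \<bullet> A b) *\<^sub>R w b x)"
proof -
  have "frechet_derivative (\<lambda>y. \<omega> y [b]) (at x within cball 0 1) b = D b (w b) x" if "b \<in> Basis" for b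
    by (rule frechet_derivative_within_eq_D[OF w U _ assms]) (simp add: \<omega> W_Basis that)
  moreover have "\<omega> x [A x] = - (\<Sum>b\<in>Basis. (x \<bullet> A b) *\<^sub>R w b x)"
    using assms by (simp add: \<omega> W_def skew sum_negf)
  ultimately show ?thesis
    using assms by (simp add: magnetic_codiff_def codiff_def interior_product_def)
qed

lemma magnetic_codiff_other:
  assumes "norm x \<le> 1" "vs \<noteq> []"
  shows "magnetic_codiff (cball 0 1) A \<omega> x vs = 0"
proof -
  have "\<omega> y (v # vs) = 0" if "norm y \<le> 1" for y v using \<omega>_length[OF that, of "v # vs"] assms(2) by simp
  then show ?thesis
    using assms by (simp add: magnetic_codiff_def codiff_def interior_product_def frechet_zero_within)
qed

lemma magnetic_d_eq:
  assumes "norm x \<le> 1"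
  shows "magnetic_d (cball 0 1) A \<omega> x [u, v] = D u (W w v) x - D v (W w u) x +
    \<i> * ((x \<bullet> A v) *\<^sub>R W w u x - (x \<bullet> A u) *\<^sub>R W w v x)"
proof -
  have "frechet_derivative (\<lambda>y. \<omega> y [a]) (at x within cball 0 1) b = D b (W w a) x" for a b
    by (rule frechet_derivative_within_eq_D[OF smooth_W U _ assms]) (simp_all add: w \<omega>)
  then show ?thesis
    using assms
    by (simp add: magnetic_d_def ext_deriv_def wedge1_def remove_nth_def lessThan_Suc numeral_2_eq_2
        \<omega> skew scaleR_conv_of_real algebra_simps)
qed

lemma length_remove_nth: "i < length vs \<Longrightarrow> length (remove_nth i vs) = length vs - 1"
  by (simp add: remove_nth_def)

lemma magnetic_d_other:
  assumes "norm x \<le> 1" "length vs \<noteq> 2"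
  shows "magnetic_d (cball 0 1) A \<omega> x vs = 0"
proof -
  have "\<omega> y (remove_nth i vs) = 0" if "norm y \<le> 1" "i < length vs" for y i
    using \<omega>_length[OF that(1), of "remove_nth i vs"] assms(2) that(2) by (auto simp: length_remove_nth)
  then show ?thesis
    using assms by (simp add: magnetic_d_def ext_deriv_def wedge1_def frechet_zero_within)
qed

lemma magnetic_laplacian_other:
  assumes "norm x \<le> 1" "length vs \<noteq> 1"
  shows "magnetic_laplacian (cball 0 1) A \<omega> x vs = 0"
proof -
  let ?c = "magnetic_codiff (cball 0 1) A \<omega>" and ?d = "magnetic_d (cball 0 1) A \<omega>"
  have "?c y (remove_nth i vs) = 0" if "norm y \<le> 1" "i < length vs" for y i
    using magnetic_codiff_other[OF that(1), of "remove_nth i vs"] assms(2) that(2) length_remove_nth[OF that(2)]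
    by fastforce
  then have "magnetic_d (cball 0 1) A ?c x vs = 0"
    using assms(1) by (simp add: magnetic_d_def[of _ _ ?c] ext_deriv_def wedge1_def frechet_zero_within)
  moreover have "?d y (v # vs) = 0" if "norm y \<le> 1" for y v
    using magnetic_d_other[OF that, of "v # vs"] assms(2) by simp
  then have "magnetic_codiff (cball 0 1) A ?d x vs = 0"
    using assms(1)
    by (simp add: magnetic_codiff_def[of _ _ ?d] codiff_def interior_product_def frechet_zero_within)
  ultimately show ?thesis by (simp add: magnetic_laplacian_def)
qed

text \<open>A Bochner formula for the flat metric: the first three terms are the magnetic Laplacian
  acting on each component, where the divergence of the potential drops out by skewness, and the
  last term is the field strength, constant because \<open>A\<close> is linear.\<close>

lemma magnetic_laplacian_eq:
  assumes x: "norm x \<le> 1"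
  shows "magnetic_laplacian (cball 0 1) A \<omega> x [v] =
    - L (W w v) x - 2 * \<i> * D (A x) (W w v) x + (A x \<bullet> A x) *\<^sub>R W w v x - 2 * \<i> * W w (A v) x"
proof -
  let ?c = "magnetic_codiff (cball 0 1) A \<omega>" and ?d = "magnetic_d (cball 0 1) A \<omega>"
  define S where "S = (\<lambda>x. - (\<Sum>b\<in>Basis. D b (w b) x) + \<i> * (\<Sum>b\<in>Basis. (x \<bullet> A b) *\<^sub>R w b x))"
  define T where "T u v = (\<lambda>x. D u (W w v) x - D v (W w u) x +
    \<i> * ((x \<bullet> A v) *\<^sub>R W w u x - (x \<bullet> A u) *\<^sub>R W w v x))" for u v
  note sm = smooth_add smooth_diff smooth_minus smooth_cmult smooth_sum smooth_D smooth_scaleR_inner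
    w smooth_W[OF w]
  have S: "S \<in> smooth" unfolding S_def by (intro sm)
  have T: "T u v \<in> smooth" for u v unfolding T_def by (intro sm)
  have lap: "magnetic_laplacian (cball 0 1) A \<omega> x [v] = D v S x + \<i> * (of_real (A x \<bullet> v) * S x)
      - (\<Sum>b\<in>Basis. D b (T b v) x) - \<i> * T (A x) v x"
  proof -
    have "frechet_derivative (\<lambda>y. ?c y []) (at x within cball 0 1) v = D v S x"
      by (rule frechet_derivative_within_eq_D[OF S U _ x]) (simp add: magnetic_codiff_eq S_def)
    moreover have "frechet_derivative (\<lambda>y. ?d y [b, v]) (at x within cball 0 1) b = D b (T b v) x" for b
      by (rule frechet_derivative_within_eq_D[OF T U _ x]) (simp add: magnetic_d_eq T_def)
    moreover have "?c x [] = S x" "?d x [A x, v] = T (A x) v x"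
      using x by (simp_all add: magnetic_codiff_eq S_def magnetic_d_eq T_def)
    ultimately show ?thesis
      using x
      by (simp add: magnetic_laplacian_def magnetic_d_def[of _ _ ?c] ext_deriv_def wedge1_def remove_nth_def
          magnetic_codiff_def[of _ _ ?d] codiff_def interior_product_def)
  qed
  \<comment> \<open>\<open>X\<close>, the divergence \<open>Y\<close> and the mixed second
    derivatives \<open>Z\<close> occur with opposite signs in the two halves of the Laplacian and
    cancel, as do the terms with \<open>W w (A x) x\<close>.\<close>
  define X where "X = (\<Sum>b\<in>Basis. (A x \<bullet> b) *\<^sub>R D v (w b) x)"
  define Y where "Y = (\<Sum>b\<in>Basis. D b (w b) x)"
  define Z where "Z = (\<Sum>b\<in>Basis. D b (D v (w b)) x)"
  have DvS: "D v S x = - Z + \<i> * (- X - W w (A v) x)"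
  proof -
    have "D v S x = - (\<Sum>b\<in>Basis. D v (D b (w b)) x) +
        \<i> * (\<Sum>b\<in>Basis. (x \<bullet> A b) *\<^sub>R D v (w b) x + (v \<bullet> A b) *\<^sub>R w b x)"
      unfolding S_def by (simp add: D_diff D_cmult D_sum D_scaleR_inner sm)
    also have "(\<Sum>b\<in>Basis. D v (D b (w b)) x) = Z"
      unfolding Z_def by (simp add: D_commute[OF w, of v])
    also have "(\<Sum>b\<in>Basis. (x \<bullet> A b) *\<^sub>R D v (w b) x + (v \<bullet> A b) *\<^sub>R w b x) = - X - W w (A v) x"
      by (simp add: X_def W_def skew sum.distrib sum_negf)
    finally show ?thesis .
  qed
  have "D b (T b v) x = D b (D b (W w v)) x - D b (D v (w b)) x +
      \<i> * ((x \<bullet> A v) *\<^sub>R D b (w b) x - (b \<bullet> A v) *\<^sub>R (- w b x) + (A x \<bullet> b) *\<^sub>R D b (W w v) x)"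
    if b: "b \<in> Basis" for b
  proof -
    have "b \<bullet> A b = 0" using skew[of b b] by (simp add: inner_commute)
    moreover have "x \<bullet> A b = - (A x \<bullet> b)" by (simp add: skew)
    ultimately show ?thesis
      unfolding T_def W_Basis[OF b] by (simp add: D_add D_diff D_cmult D_scaleR_inner sm)
  qed
  then have "(\<Sum>b\<in>Basis. D b (T b v) x) = (\<Sum>b\<in>Basis. D b (D b (W w v)) x - D b (D v (w b)) x +
      \<i> * ((x \<bullet> A v) *\<^sub>R D b (w b) x - (b \<bullet> A v) *\<^sub>R (- w b x) + (A x \<bullet> b) *\<^sub>R D b (W w v) x))"
    by simp
  also have "\<dots> = L (W w v) x - Z + \<i> * ((x \<bullet> A v) *\<^sub>R Y + W w (A v) x + D (A x) (W w v) x)"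
    by (simp add: sum.distrib sum_subtractf sum_distrib_left[symmetric] scaleR_sum_right[symmetric] sum_negf
        L_def Z_def Y_def W_def[of w "A v"] inner_commute D_expand[OF smooth_W[OF w], of "A x"])
  finally have divT: "(\<Sum>b\<in>Basis. D b (T b v) x) =
      L (W w v) x - Z + \<i> * ((x \<bullet> A v) *\<^sub>R Y + W w (A v) x + D (A x) (W w v) x)" .
  have T_A: "T (A x) v x = D (A x) (W w v) x - X + \<i> * ((x \<bullet> A v) *\<^sub>R W w (A x) x + (A x \<bullet> A x) *\<^sub>R W w v x)"
    unfolding T_def X_def D_W[where w=w and u=v and v="A x", OF w] using skew[of x "A x"] by simp
  have S_x: "S x = - Y - \<i> * W w (A x) x"
    by (simp add: S_def Y_def W_def skew sum_negf)
  show ?thesis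
    unfolding lap DvS divT T_A S_x by (simp add: skew scaleR_conv_of_real algebra_simps)
qed

end

section \<open>Components of a Steklov eigenform\<close>

context open_set
begin


text \<open>The eigenvalue equation tests tangential vectors only, so \<open>c\<close> is replaced
  by its tangential projection. Differentiating h = 0 along it trades the sum of the terms x_b D_v
  w_b for minus the tangential value of the form, which turns \<sigma> into \<sigma> - 1; the
  remaining normal part is \<open>E h\<close>.\<close>

lemma boundary_components:
  fixes w :: "'a \<Rightarrow> 'a \<Rightarrow> real"
  assumes U: "cball 0 1 \<subseteq> U" and w: "\<And>b. w b \<in> smooth"
    and h_def: "h = (\<lambda>x. \<Sum>b\<in>Basis. (x \<bullet> b) * w b x)"
    and normal: "\<And>x. norm x = 1 \<Longrightarrow> h x = 0"
    and eigen: "\<And>x v. norm x = 1 \<Longrightarrow> x \<bullet> v = 0 \<Longrightarrow>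
      \<sigma> * (\<Sum>b\<in>Basis. (v \<bullet> b) * w b x) =
      (\<Sum>b\<in>Basis. (v \<bullet> b) * E (w b) x) - (\<Sum>b\<in>Basis. (x \<bullet> b) * D v (w b) x)"
    and c: "c \<in> Basis" and x: "norm x = 1"
  shows "E (w c) x = (\<sigma> - 1) * w c x + (x \<bullet> c) * E h x"
proof -
  define v where "v = c - (x \<bullet> c) *\<^sub>R x"
  have h: "h \<in> smooth" unfolding h_def by (intro smooth_intros w)
  have SU: "sphere 0 1 \<subseteq> U" using U by auto
  have v: "x \<bullet> v = 0" using x by (simp add: v_def inner_diff_right dot_square_norm)
  have expand: "(\<Sum>b\<in>Basis. (v \<bullet> b) * f b) = f c - (x \<bullet> c) * (\<Sum>b\<in>Basis. (x \<bullet> b) * f b)" for f :: "'a \<Rightarrow> real"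
  proof -
    have "(\<Sum>b\<in>Basis. (v \<bullet> b) * f b) = (\<Sum>b\<in>Basis. (if b = c then f b else 0) - (x \<bullet> c) * ((x \<bullet> b) * f b))"
      using c by (intro sum.cong) (auto simp: v_def inner_diff_left inner_Basis left_diff_distrib)
    then show ?thesis using c by (simp add: sum_subtractf sum_distrib_left)
  qed
  have "D v h x = 0" using D_tangential[OF h SU normal x, of v] v by simp
  moreover have "D v h x = (\<Sum>b\<in>Basis. (x \<bullet> b) * D v (w b) x) + (\<Sum>b\<in>Basis. (v \<bullet> b) * w b x)"
    unfolding h_def by (simp add: D_sum D_coord smooth_intros w sum.distrib)
  ultimately have "(\<Sum>b\<in>Basis. (v \<bullet> b) * E (w b) x) = (\<sigma> - 1) * (\<Sum>b\<in>Basis. (v \<bullet> b) * w b x)"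
    using eigen[OF x v] by (simp add: algebra_simps)
  moreover have "(\<Sum>b\<in>Basis. (x \<bullet> b) * E (w b) x) = E h x"
  proof -
    have "E h x = (\<Sum>b\<in>Basis. (x \<bullet> b) * E (w b) x) + h x"
      unfolding h_def by (simp add: E_sum E_coord smooth_intros w sum.distrib)
    then show ?thesis using normal[OF x] by simp
  qed
  moreover have "(\<Sum>b\<in>Basis. (x \<bullet> b) * w b x) = 0" using normal[OF x] by (simp add: h_def)
  ultimately show ?thesis unfolding expand by simp
qed

text \<open>The conditions on the components of the extension of a Steklov eigenform. The last equation is
  \<open>\<sigma> \<omega>(v) = d\<omega>(x, v)\<close>; the magnetic terms drop out since \<open>A x\<close> is tangential and \<open>\<omega>(x) = 0\<close>.\<close>

definition magnetic_steklov_field :: "('a \<Rightarrow> 'a) \<Rightarrow> real \<Rightarrow> ('a \<Rightarrow> 'a \<Rightarrow> complex) \<Rightarrow> bool" where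
  "magnetic_steklov_field A \<sigma> w \<longleftrightarrow> cball 0 1 \<subseteq> U \<and> (\<forall>b. w b \<in> smooth) \<and>
     (\<forall>x. \<forall>c\<in>Basis. norm x \<le> 1 \<longrightarrow>
        L (w c) x = (A x \<bullet> A x) *\<^sub>R w c x - 2 * \<i> * D (A x) (w c) x - 2 * \<i> * W w (A c) x) \<and>
     (\<forall>x. norm x = 1 \<longrightarrow> W w x x = 0) \<and>
     (\<forall>x v. norm x = 1 \<longrightarrow> x \<bullet> v = 0 \<longrightarrow>
        \<sigma> *\<^sub>R W w v x = D x (W w v) x - (\<Sum>b\<in>Basis. (x \<bullet> b) *\<^sub>R D v (w b) x)) \<and>
     (\<exists>x. \<exists>b\<in>Basis. norm x = 1 \<and> w b x \<noteq> 0)"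

text \<open>The boundary conditions have real coefficients and pass to real and imaginary parts
  separately; a general real-linear \<open>T\<close> covers both. Only the interior equation couples
  the two parts.\<close>

lemma magnetic_steklov_field_part:
  assumes w: "magnetic_steklov_field A \<sigma> w" and T: "bounded_linear (T :: complex \<Rightarrow> real)"
    and p_def: "p = (\<lambda>b x. T (w b x))" and h_def: "h = (\<lambda>x. \<Sum>b\<in>Basis. (x \<bullet> b) * p b x)"
  shows "\<And>b. p b \<in> smooth" "\<And>x. norm x = 1 \<Longrightarrow> h x = 0"
    and "\<And>c x. c \<in> Basis \<Longrightarrow> norm x = 1 \<Longrightarrow> E (p c) x = (\<sigma> - 1) * p c x + (x \<bullet> c) * E h x"
    and "\<And>b v. D v (p b) = (\<lambda>x. T (D v (w b) x))" "\<And>b. L (p b) = (\<lambda>x. T (L (w b) x))"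
proof -
  interpret T: bounded_linear T by (rule T)
  have U: "cball 0 1 \<subseteq> U" and sw: "w b \<in> smooth" for b
    using w by (auto simp: magnetic_steklov_field_def)
  show p: "p b \<in> smooth" for b unfolding p_def by (rule smooth_bounded_linear[OF T sw])
  show Dp: "D v (p b) = (\<lambda>x. T (D v (w b) x))" for b v
    unfolding p_def by (rule D_bounded_linear[OF T sw])
  show "L (p b) = (\<lambda>x. T (L (w b) x))" for b
    by (simp add: L_def fun_eq_iff Dp D_bounded_linear[OF T] smooth_D sw T.sum)
  have TW: "T (W w v x) = (\<Sum>b\<in>Basis. (v \<bullet> b) * p b x)" for v x
    by (simp add: W_def T.sum T.scaleR p_def)
  show h: "h x = 0" if "norm x = 1" for x
  proof -
    have "W w x x = 0" using w that by (simp add: magnetic_steklov_field_def)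
    then have "T (W w x x) = 0" by (simp add: T.zero)
    then show ?thesis by (simp add: TW h_def)
  qed
  show "E (p c) x = (\<sigma> - 1) * p c x + (x \<bullet> c) * E h x" if "c \<in> Basis" "norm x = 1" for c x
  proof (rule boundary_components[OF U p h_def h _ that])
    fix x v :: 'a assume x: "norm x = 1" "x \<bullet> v = 0"
    then have "T (\<sigma> *\<^sub>R W w v x) = T (D x (W w v) x - (\<Sum>b\<in>Basis. (x \<bullet> b) *\<^sub>R D v (w b) x))"
      using w by (simp add: magnetic_steklov_field_def)
    then show "\<sigma> * (\<Sum>b\<in>Basis. (v \<bullet> b) * p b x) =
        (\<Sum>b\<in>Basis. (v \<bullet> b) * E (p b) x) - (\<Sum>b\<in>Basis. (x \<bullet> b) * D v (p b) x)"
      by (simp add: T.diff T.sum T.scaleR TW D_W sw Dp E_eq_D[OF p])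
  qed
qed

lemma harmonic_steklov_field_ge:
  assumes w: "magnetic_steklov_field (\<lambda>_. 0) \<sigma> w" and dim: "DIM('a) \<ge> 2"
  shows "\<sigma> \<ge> 1 + 2 / real DIM('a)"
proof -
  have U: "cball 0 1 \<subseteq> U" and sw: "w b \<in> smooth" for b
    using w by (auto simp: magnetic_steklov_field_def)
  have D0: "D 0 (w b) x = 0" for b x using linear_0[OF D_linear[OF sw]] .
  have L: "L (w b) x = 0" if "b \<in> Basis" "norm x \<le> 1" for b x
    using w that by (simp add: magnetic_steklov_field_def W_def D0)
  obtain x b where x: "norm x = 1" "b \<in> Basis" and "w b x \<noteq> 0"
    using w by (auto simp: magnetic_steklov_field_def)
  then consider "Re (w b x) \<noteq> 0" | "Im (w b x) \<noteq> 0" using complex_eq_iff by force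
  then show ?thesis
  proof cases
    case 1
    note part = magnetic_steklov_field_part[OF w bounded_linear_Re refl refl]
    show ?thesis
      by (rule harmonic_field_eigenvalue_ge[OF dim U part(1) _ refl part(2,3) x 1]) (simp_all add: part(5) L)
  next
    case 2
    note part = magnetic_steklov_field_part[OF w bounded_linear_Im refl refl]
    show ?thesis
      by (rule harmonic_field_eigenvalue_ge[OF dim U part(1) _ refl part(2,3) x 2]) (simp_all add: part(5) L)
  qed
qed

lemma magnetic_steklov_field_nonneg:
  assumes w: "magnetic_steklov_field A \<sigma> w" and A: "linear A" "\<And>x. norm (A x) \<le> a * norm x"
    and skew: "\<And>x y. A x \<bullet> y = - (x \<bullet> A y)" and a: "4 * a < real DIM('a)"
  shows "\<sigma> \<ge> 0"
proof -
  have U: "cball 0 1 \<subseteq> U" using w by (auto simp: magnetic_steklov_field_def)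
  define p where "p = (\<lambda>b x. Re (w b x))"
  define q where "q = (\<lambda>b x. Im (w b x))"
  define hp where "hp = (\<lambda>x. \<Sum>b\<in>Basis. (x \<bullet> b) * p b x)"
  define hq where "hq = (\<lambda>x. \<Sum>b\<in>Basis. (x \<bullet> b) * q b x)"
  note P = magnetic_steklov_field_part[OF w bounded_linear_Re p_def hp_def]
  note Q = magnetic_steklov_field_part[OF w bounded_linear_Im q_def hq_def]
  define u where "u = (\<lambda>x. \<Sum>b\<in>Basis. p b x * p b x + q b x * q b x)"
  have L: "L (w c) x = (A x \<bullet> A x) *\<^sub>R w c x - 2 * \<i> * D (A x) (w c) x - 2 * \<i> * W w (A c) x"
    if "c \<in> Basis" "norm x \<le> 1" for c x
    using w that by (simp add: magnetic_steklov_field_def)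
  have W: "Re (W w (A c) x) = - (\<Sum>b\<in>Basis. (A b \<bullet> c) * p b x)"
    "Im (W w (A c) x) = - (\<Sum>b\<in>Basis. (A b \<bullet> c) * q b x)" for c x
  proof -
    have flip0: "A c \<bullet> b = - (A b \<bullet> c)" for b using skew[of c b] by (simp add: inner_commute)
    have flip: "(\<Sum>b\<in>Basis. (A c \<bullet> b) * f b) = - (\<Sum>b\<in>Basis. (A b \<bullet> c) * f b)" for f :: "'a \<Rightarrow> real"
      unfolding sum_negf[symmetric] by (rule sum.cong[OF refl]) (use flip0 in \<open>metis mult_minus_left\<close>)
    show "Re (W w (A c) x) = - (\<Sum>b\<in>Basis. (A b \<bullet> c) * p b x)"
      "Im (W w (A c) x) = - (\<Sum>b\<in>Basis. (A b \<bullet> c) * q b x)"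
      unfolding flip[symmetric] by (simp_all add: W_def p_def q_def)
  qed
  obtain x0 b where x0: "norm x0 = 1" "b \<in> Basis" and nz: "w b x0 \<noteq> 0"
    using w by (auto simp: magnetic_steklov_field_def)
  show ?thesis
  proof (rule magnetic_field_eigenvalue_nonneg[OF U A a P(1) Q(1) _ _ u_def _ x0(1)])
    fix c x :: 'a assume c: "c \<in> Basis" and x: "norm x \<le> 1"
    show "L (p c) x = 2 * D (A x) (q c) x + (A x \<bullet> A x) * p c x - 2 * (\<Sum>b\<in>Basis. (A b \<bullet> c) * q b x)"
      by (simp add: P(5) L[OF c x] W Q(4)) (simp add: p_def)
    show "L (q c) x = - 2 * D (A x) (p c) x + (A x \<bullet> A x) * q c x + 2 * (\<Sum>b\<in>Basis. (A b \<bullet> c) * p b x)"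
      by (simp add: Q(5) L[OF c x] W P(4)) (simp add: q_def)
  next
    fix x :: 'a assume x: "norm x = 1"
    \<comment> \<open>The extra normal terms assemble to multiples of \<open>hp\<close> and
      \<open>hq\<close>, which vanish on the sphere.\<close>
    have "(\<Sum>b\<in>Basis. p b x * E (p b) x + q b x * E (q b) x) =
        (\<Sum>b\<in>Basis. (\<sigma> - 1) * (p b x * p b x + q b x * q b x) +
          (((x \<bullet> b) * p b x) * E hp x + ((x \<bullet> b) * q b x) * E hq x))"
      by (rule sum.cong) (simp_all add: P(3) Q(3) x algebra_simps)
    also have "\<dots> = (\<sigma> - 1) * u x + (hp x * E hp x + hq x * E hq x)"
      by (simp add: sum.distrib sum_distrib_left[symmetric] sum_distrib_right[symmetric] u_def
          hp_def hq_def)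
    finally show "(\<Sum>b\<in>Basis. p b x * E (p b) x + q b x * E (q b) x) = (\<sigma> - 1) * u x"
      using P(2)[OF x] Q(2)[OF x] by simp
  next
    have "(Re (w b x0))\<^sup>2 + (Im (w b x0))\<^sup>2 > 0"
      using nz complex_neq_0 by blast
    then have "p b x0 * p b x0 + q b x0 * q b x0 > 0" by (simp add: p_def q_def power2_eq_square)
    then have "u x0 > 0" unfolding u_def using x0(2) by (intro sum_pos2[of _ b]) auto
    then show "u x0 \<noteq> 0" by simp
  qed
qed

end

section \<open>From eigenvalues of the operator to component fields\<close>

lemma one_form_components:
  fixes \<omega> :: "'a::euclidean_space cform"
  assumes "\<omega> \<in> forms 1 (cball 0 1)"
  obtains U w where "open_set U" "cball 0 1 \<subseteq> U" "\<And>b. w b \<in> open_set.smooth U"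
    "\<And>x v. norm x \<le> 1 \<Longrightarrow> \<omega> x [v] = open_set.W w v x"
    "\<And>x vs. norm x \<le> 1 \<Longrightarrow> length vs \<noteq> 1 \<Longrightarrow> \<omega> x vs = 0"
proof -
  have alt: "alternating_form 1 UNIV (\<omega> x)" if "norm x \<le> 1" for x
    using assms that by (simp add: forms_def)
  have "\<forall>b. \<exists>Vg. open (fst Vg) \<and> cball 0 1 \<subseteq> fst Vg \<and> (\<forall>k. Ck_on k (fst Vg) (snd Vg)) \<and>
      (\<forall>x\<in>cball 0 1. snd Vg x = \<omega> x [b])"
  proof
    fix b
    have "smooth_on (cball 0 1) (\<lambda>x. \<omega> x [b])" using assms unfolding forms_def by blast
    then show "\<exists>Vg. open (fst Vg) \<and> cball 0 1 \<subseteq> fst Vg \<and> (\<forall>k. Ck_on k (fst Vg) (snd Vg)) \<and>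
      (\<forall>x\<in>cball 0 1. snd Vg x = \<omega> x [b])" unfolding smooth_on_def by auto
  qed
  from choice[OF this] obtain Vg where Vg: "\<forall>b. open (fst (Vg b)) \<and> cball 0 1 \<subseteq> fst (Vg b) \<and>
      (\<forall>k. Ck_on k (fst (Vg b)) (snd (Vg b))) \<and> (\<forall>x\<in>cball 0 1. snd (Vg b) x = \<omega> x [b])" ..
  define V where "V b = fst (Vg b)" for b
  define g where "g b = snd (Vg b)" for b
  have V: "open (V b)" "cball 0 1 \<subseteq> V b" and g: "Ck_on k (V b) (g b)"
    and eq: "x \<in> cball 0 1 \<Longrightarrow> g b x = \<omega> x [b]" for b k x
    using Vg by (simp_all add: V_def g_def)
  \<comment> \<open>Every component comes with its own neighbourhood; intersecting over the finite
    \<open>Basis\<close> alone keeps the result open.\<close>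
  define U where "U = (\<Inter>b\<in>Basis. V b)"
  have U: "open U" "cball 0 1 \<subseteq> U" using V by (auto simp: U_def intro: open_INT)
  interpret open_set U by (unfold_locales) (rule U(1))
  define w where "w b x = (if b \<in> Basis \<and> x \<in> U then g b x else 0)" for b x
  have w: "w b \<in> smooth" for b
  proof (cases "b \<in> Basis")
    case True
    have "Ck_on k U (g b)" for k
      by (rule Ck_on_subset[OF g]) (use True in \<open>auto simp: U_def\<close>)
    moreover have "Ck_on k U (w b) \<longleftrightarrow> Ck_on k U (g b)" for k
      by (rule Ck_on_cong[OF U(1)]) (simp add: w_def True)
    ultimately show ?thesis by (simp add: smooth_def w_def)
  next
    case False
    then have "w b = (\<lambda>_. 0)" by (simp add: w_def fun_eq_iff)
    then show ?thesis by (simp add: smooth_zero)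
  qed
  have W: "\<omega> x [v] = W w v x" if x: "norm x \<le> 1" for x v
  proof -
    have lin: "linear (\<lambda>v. \<omega> x [v])" by (rule alternating_form_linear[OF alt[OF x]])
    have "\<omega> x [v] = \<omega> x [(\<Sum>b\<in>Basis. (v \<bullet> b) *\<^sub>R b)]" by (simp add: euclidean_representation)
    also have "\<dots> = (\<Sum>b\<in>Basis. (v \<bullet> b) *\<^sub>R \<omega> x [b])"
      by (simp only: linear_sum[OF lin] linear_cmul[OF lin])
    also have "\<dots> = W w v x"
    proof -
      have "x \<in> U" using x U(2) by auto
      then show ?thesis unfolding W_def by (intro sum.cong) (use x eq in \<open>auto simp: w_def\<close>)
    qed
    finally show ?thesis .
  qed
  have "\<omega> x vs = 0" if "norm x \<le> 1" "length vs \<noteq> 1" for x vs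
    using alt[OF that(1)] that(2) by (simp add: alternating_form_def)
  from that[of U w, OF open_set_axioms U(2) w W this] show thesis .
qed

lemma steklov_eigenvalue_field:
  fixes A :: "'a::euclidean_space \<Rightarrow> 'a"
  assumes A: "linear A" and skew: "\<And>x y. A x \<bullet> y = - (x \<bullet> A y)"
    and eigen: "steklov_eigenvalue 1 (cball 0 1) (\<lambda>x. - x) A \<sigma>"
  obtains U w where "open_set U" "open_set.magnetic_steklov_field U A \<sigma> w"
proof -
  have frontier: "x \<in> frontier (cball 0 1) \<longleftrightarrow> norm x = 1" for x :: 'a by simp
  obtain \<psi> \<omega> where \<psi>0: "\<psi> \<noteq> (\<lambda>_ _. 0)"
    and ext: "steklov_extension 1 (cball 0 1) (\<lambda>x. - x) A \<psi> \<omega>"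
    and T: "(\<lambda>x vs. of_real \<sigma> * \<psi> x vs) = (\<lambda>x vs. - boundary_pullback (cball 0 1) (\<lambda>x. - x)
      (interior_product (\<lambda>x. - x) (magnetic_d (cball 0 1) A \<omega>)) x vs)"
    using eigen by (auto simp: steklov_eigenvalue_def magnetic_steklov_def)
  have form: "\<omega> \<in> forms 1 (cball 0 1)"
    and lap: "\<And>x vs. norm x \<le> 1 \<Longrightarrow> magnetic_laplacian (cball 0 1) A \<omega> x vs = 0"
    and \<psi>: "\<psi> = boundary_pullback (cball 0 1) (\<lambda>x. - x) \<omega>"
    and normal: "\<And>x vs. norm x = 1 \<Longrightarrow> \<omega> x (- x # vs) = 0"
    using ext by (auto simp: steklov_extension_def frontier interior_product_def)
  obtain U w where dom: "open_set U" "cball 0 1 \<subseteq> U" and w: "\<And>b. w b \<in> open_set.smooth U"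
    and \<omega>: "\<And>x v. norm x \<le> 1 \<Longrightarrow> \<omega> x [v] = open_set.W w v x"
    and \<omega>_length: "\<And>x vs. norm x \<le> 1 \<Longrightarrow> length vs \<noteq> 1 \<Longrightarrow> \<omega> x vs = 0"
    by (rule one_form_components[OF form], rule that; assumption)
  interpret form_components U w \<omega> A
    using dom w \<omega> \<omega>_length A skew by (simp add: form_components_def form_components_axioms_def)
  have W0: "W w x x = 0" if "norm x = 1" for x
    using normal[OF that, of "[]"] \<omega>[of x "- x"] that by (simp add: W_def sum_negf)
  have "L (w c) x = (A x \<bullet> A x) *\<^sub>R w c x - 2 * \<i> * D (A x) (w c) x - 2 * \<i> * W w (A c) x"
    if "c \<in> Basis" "norm x \<le> 1" for c x
  proof -
    have "- L (W w c) x - 2 * \<i> * D (A x) (W w c) x + (A x \<bullet> A x) *\<^sub>R W w c x - 2 * \<i> * W w (A c) x = 0"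
      using magnetic_laplacian_eq[OF that(2), of c] lap[OF that(2), of "[c]"]
      by metis
    then show ?thesis unfolding W_Basis[OF that(1)] by algebra
  qed
  moreover have "\<sigma> *\<^sub>R W w v x = D x (W w v) x - (\<Sum>b\<in>Basis. (x \<bullet> b) *\<^sub>R D v (w b) x)"
    if x: "norm x = 1" and v: "x \<bullet> v = 0" for x v
  proof -
    have x1: "norm x \<le> 1" using x by simp
    have tv: "v \<in> tangent_space (\<lambda>x. - x) x" using v by (simp add: tangent_space_def inner_commute)
    have "\<sigma> *\<^sub>R W w v x = of_real \<sigma> * \<psi> x [v]"
      using x tv \<omega>[OF x1] by (simp add: \<psi> boundary_pullback_def frontier scaleR_conv_of_real)
    also have "\<dots> = - magnetic_d (cball 0 1) A \<omega> x [- x, v]"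
      using fun_cong[OF fun_cong[OF T, of x], of "[v]"] x tv
      by (simp add: boundary_pullback_def frontier interior_product_def)
    also have "\<dots> = - (D (- x) (W w v) x - D v (W w (- x)) x)"
    proof -
      have "W w (- x) x = 0" using W0[OF x] by (simp add: W_def sum_negf)
      moreover have "x \<bullet> A (- x) = 0" using skew[of x x] by (simp add: linear_neg[OF A] inner_commute[of "A x"])
      ultimately show ?thesis
        by (simp add: magnetic_d_eq[OF x1])
    qed
    also have "\<dots> = D x (W w v) x - (\<Sum>b\<in>Basis. (x \<bullet> b) *\<^sub>R D v (w b) x)"
    proof -
      have "D (- x) (W w v) x = - D x (W w v) x"
        by (rule linear_neg[OF D_linear[OF smooth_W[of w, OF w]]])
      moreover have "D v (W w (- x)) x = - (\<Sum>b\<in>Basis. (x \<bullet> b) *\<^sub>R D v (w b) x)"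
        unfolding D_W[of w, OF w] by (simp add: sum_negf)
      ultimately show ?thesis by simp
    qed
    finally show ?thesis .
  qed
  moreover have "\<exists>x. \<exists>b\<in>Basis. norm x = 1 \<and> w b x \<noteq> 0"
  proof -
    have "\<exists>x vs. \<psi> x vs \<noteq> 0"
    proof (rule ccontr)
      assume "\<nexists>x vs. \<psi> x vs \<noteq> 0"
      then have "\<psi> = (\<lambda>_ _. 0)" by (simp add: fun_eq_iff)
      with \<psi>0 show False ..
    qed
    then obtain x vs where "\<psi> x vs \<noteq> 0" by (elim exE)
    then have x: "norm x = 1" and "\<omega> x vs \<noteq> 0"
      by (auto simp: \<psi> boundary_pullback_def frontier split: if_splits)
    moreover have "length vs = 1" using \<omega>_length[of x vs] x \<open>\<omega> x vs \<noteq> 0\<close> by auto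
    then obtain v where "vs = [v]" by (auto simp: length_Suc_conv)
    ultimately have "\<omega> x [v] \<noteq> 0" by simp
    then have "(\<Sum>b\<in>Basis. (v \<bullet> b) *\<^sub>R w b x) \<noteq> 0" using x \<omega>[of x v] by (simp add: W_def)
    then obtain b where "b \<in> Basis" "w b x \<noteq> 0"
      using sum.neutral[of Basis "\<lambda>b. (v \<bullet> b) *\<^sub>R w b x"] by auto
    then show ?thesis using x by blast
  qed
  ultimately have "magnetic_steklov_field A \<sigma> w"
    using dom(2) w W0 by (simp add: magnetic_steklov_field_def)
  then show thesis by (rule that[OF dom(1)])
qed

lemma steklov_eigenvalue_ge:
  assumes "steklov_eigenvalue 1 (cball (0 :: 'a::euclidean_space) 1) (\<lambda>x. - x) (\<lambda>_. 0) \<sigma>" "DIM('a) \<ge> 2"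
  shows "\<sigma> \<ge> 1 + 2 / real DIM('a)"
proof (rule steklov_eigenvalue_field[OF _ _ assms(1)])
  show "linear (\<lambda>_. 0 :: 'a)" by (rule module_hom_zero)
  show "\<sigma> \<ge> 1 + 2 / real DIM('a)" if "open_set U" "open_set.magnetic_steklov_field U (\<lambda>_. 0) \<sigma> w"
    for U :: "'a set" and w
    using open_set.harmonic_steklov_field_ge[OF that assms(2)] .
qed simp

lemma steklov_eigenvalue_nonneg:
  fixes A :: "'a::euclidean_space \<Rightarrow> 'a"
  assumes A: "linear A" "\<And>x y. A x \<bullet> y = - (x \<bullet> A y)" "\<And>x. norm (A x) \<le> a * norm x"
    and a: "4 * a < real DIM('a)"
    and eigen: "steklov_eigenvalue 1 (cball 0 1) (\<lambda>x. - x) A \<sigma>"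
  shows "\<sigma> \<ge> 0"
proof (rule steklov_eigenvalue_field[OF A(1,2) eigen])
  show "\<sigma> \<ge> 0" if "open_set U" "open_set.magnetic_steklov_field U A \<sigma> w" for U :: "'a set" and w
    using open_set.magnetic_steklov_field_nonneg[OF that A(1,3,2) a] .
qed

section \<open>The explicit eigenform\<close>

text \<open>\<open>F_eq\<close> and \<open>H_eq\<close> compare the coefficients of l(v) and of l(x)
  (x . v) in L w = (t^2 |x|^2 - 2 t) w, the 2 H coming from the Laplacian of l(x) (x . v).
  \<open>normal\<close> is the vanishing of the form on x, and \<open>eigen\<close> the Steklov
  condition on tangential vectors, both at |x| = 1. \<open>F\<close> and \<open>H\<close> are towers
  of derivatives.\<close>

locale explicit_form =
  fixes J :: "'a::euclidean_space \<Rightarrow> 'a" and l :: "'a \<Rightarrow> complex" and t \<sigma> :: real and F H :: "nat \<Rightarrow> real \<Rightarrow> real"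
  assumes J: "linear J" "\<And>x y. J x \<bullet> y = - (x \<bullet> J y)" "\<And>x. J x \<bullet> J x = x \<bullet> x"
    and l: "bounded_linear l" "\<And>x. l (J x) = - \<i> * l x"
    and F: "\<And>k s. (F k has_real_derivative F (Suc k) s) (at s)"
    and H: "\<And>k s. (H k has_real_derivative H (Suc k) s) (at s)"
    and F_eq: "\<And>s. 4 * s * F 2 s + 2 * real DIM('a) * F 1 s + 2 * H 0 s = (t\<^sup>2 * s - 2 * t) * F 0 s"
    and H_eq: "\<And>s. 4 * s * H 2 s + (2 * real DIM('a) + 8) * H 1 s = (t\<^sup>2 * s - 2 * t) * H 0 s"
    and normal: "F 0 1 + H 0 1 = 0" and eigen: "\<sigma> * F 0 1 = 2 * F 1 1 - H 0 1"
begin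

sublocale UNIV: open_set "UNIV :: 'a set"
  by unfold_locales simp

interpretation l: bounded_linear l by (rule l(1))

definition w :: "'a \<Rightarrow> 'a \<Rightarrow> complex" where
  "w v x = of_real (F 0 (x \<bullet> x)) * l v + l x * of_real (H 0 (x \<bullet> x) * (x \<bullet> v))"

lemma w_linear: "linear (\<lambda>v. w v x)"
  by (rule linearI) (simp_all add: w_def l.add l.scaleR inner_add_right algebra_simps scaleR_conv_of_real)

lemma radial_has_derivative:
  fixes G :: "nat \<Rightarrow> real \<Rightarrow> real"
  assumes "\<And>k s. (G k has_real_derivative G (Suc k) s) (at s)"
  shows "((\<lambda>x::'a. G k (x \<bullet> x)) has_derivative (\<lambda>u. G (Suc k) (x \<bullet> x) * (2 * (x \<bullet> u)))) (at x)"
proof -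
  have "((\<lambda>x. x \<bullet> x) has_derivative (\<lambda>u. 2 * (x \<bullet> u))) (at x)"
    by (rule has_derivative_eq_rhs, rule has_derivative_inner[OF has_derivative_ident has_derivative_ident])
      (simp add: inner_commute)
  moreover have "(G k has_derivative (*) (G (Suc k) (x \<bullet> x))) (at (x \<bullet> x))"
    using assms by (simp add: has_field_derivative_def)
  ultimately show ?thesis by (rule has_derivative_compose)
qed

lemma radial_inner_has_derivative:
  fixes G :: "nat \<Rightarrow> real \<Rightarrow> real" and v :: 'a
  assumes "\<And>k s. (G k has_real_derivative G (Suc k) s) (at s)"
  shows "((\<lambda>x. G k (x \<bullet> x) * (x \<bullet> v)) has_derivative
    (\<lambda>u. G k (x \<bullet> x) * (u \<bullet> v) + G (Suc k) (x \<bullet> x) * (2 * (x \<bullet> u)) * (x \<bullet> v))) (at x)"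
  by (rule has_derivative_mult[OF radial_has_derivative[of G, OF assms]
        bounded_linear_imp_has_derivative[OF bounded_linear_inner_left]])

lemma D_w: "UNIV.D u (w v) x = of_real (F 1 (x \<bullet> x) * (2 * (x \<bullet> u))) * l v
    + (l x * of_real (H 0 (x \<bullet> x) * (u \<bullet> v) + H 1 (x \<bullet> x) * (2 * (x \<bullet> u)) * (x \<bullet> v))
      + l u * of_real (H 0 (x \<bullet> x) * (x \<bullet> v)))"
proof -
  note d = has_derivative_add[OF
      has_derivative_mult_left[OF has_derivative_of_real[OF radial_has_derivative[of F, OF F]]]
      has_derivative_mult[OF bounded_linear_imp_has_derivative[OF l(1)]
        has_derivative_of_real[OF radial_inner_has_derivative[of H, OF H]]]]
  show ?thesis unfolding w_def[abs_def] UNIV.D_eqI[OF d UNIV_I] by simp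
qed

lemma D_D_w: "UNIV.D b (UNIV.D b (w v)) x =
    l v * of_real (4 * F 2 (x \<bullet> x) * ((x \<bullet> b) * (x \<bullet> b)) + 2 * F 1 (x \<bullet> x) * (b \<bullet> b))
    + 2 * (l b * of_real (2 * H 1 (x \<bullet> x) * (x \<bullet> v) * (x \<bullet> b) + H 0 (x \<bullet> x) * (b \<bullet> v)))
    + l x * of_real (4 * H 2 (x \<bullet> x) * (x \<bullet> v) * ((x \<bullet> b) * (x \<bullet> b)) + 2 * H 1 (x \<bullet> x) * (x \<bullet> v) * (b \<bullet> b)
      + 4 * H 1 (x \<bullet> x) * ((x \<bullet> b) * (b \<bullet> v)))"
proof -
  have e: "UNIV.D b (w v) = (\<lambda>x. of_real (2 * (F 1 (x \<bullet> x) * (x \<bullet> b))) * l v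
      + (l x * of_real (H 0 (x \<bullet> x) * (b \<bullet> v) + 2 * (H 1 (x \<bullet> x) * (x \<bullet> b) * (x \<bullet> v)))
        + l b * of_real (H 0 (x \<bullet> x) * (x \<bullet> v))))"
    by (rule ext) (simp add: D_w)
  note d = has_derivative_add[OF
      has_derivative_mult_left[OF has_derivative_of_real[OF has_derivative_mult_right[OF radial_inner_has_derivative[of F, OF F, of 1 b x]]], of 2 "l v"]
      has_derivative_add[OF
        has_derivative_mult[OF bounded_linear_imp_has_derivative[OF l(1)]
          has_derivative_of_real[OF has_derivative_add[OF
            has_derivative_mult_left[OF radial_has_derivative[of H, OF H, of 0 x]]
            has_derivative_mult_right[OF has_derivative_mult[OF
              radial_inner_has_derivative[of H, OF H, of 1 b x]
              bounded_linear_imp_has_derivative[OF bounded_linear_inner_left]]]]]]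
        has_derivative_mult_right[OF has_derivative_of_real[OF radial_inner_has_derivative[of H, OF H, of 0 v x]]]]]
  show ?thesis
    unfolding e UNIV.D_eqI[OF d UNIV_I] Suc_1 One_nat_def[symmetric]
    by (simp add: numeral_2_eq_2 distrib_left distrib_right)
qed

lemma L_w: "UNIV.L (w v) x = of_real (t\<^sup>2 * (x \<bullet> x) - 2 * t) * w v x"
proof -
  define s where "s = x \<bullet> x"
  define m where "m = real DIM('a)"
  have l_sum: "(\<Sum>b\<in>Basis. l b * of_real (y \<bullet> b)) = l y" for y
  proof -
    have "l y = l (\<Sum>b\<in>Basis. (y \<bullet> b) *\<^sub>R b)" by (simp add: euclidean_representation)
    then show ?thesis by (simp only: l.sum l.scaleR) (simp add: scaleR_conv_of_real mult.commute)
  qed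
  have sums: "(\<Sum>b\<in>Basis. (x \<bullet> b) * (x \<bullet> b)) = s" "(\<Sum>b\<in>Basis. (x \<bullet> b) * (b \<bullet> v)) = x \<bullet> v"
    "(\<Sum>b\<in>(Basis::'a set). b \<bullet> b) = m"
    unfolding s_def m_def by (simp_all add: euclidean_inner[symmetric] inner_commute[of _ v])
  have "UNIV.D b (UNIV.D b (w v)) x =
      l v * of_real (4 * F 2 s) * of_real ((x \<bullet> b) * (x \<bullet> b)) + l v * of_real (2 * F 1 s) * of_real (b \<bullet> b)
      + of_real (4 * H 1 s * (x \<bullet> v)) * (l b * of_real (x \<bullet> b)) + of_real (2 * H 0 s) * (l b * of_real (v \<bullet> b))
      + l x * of_real (4 * H 2 s * (x \<bullet> v)) * of_real ((x \<bullet> b) * (x \<bullet> b))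
      + l x * of_real (2 * H 1 s * (x \<bullet> v)) * of_real (b \<bullet> b)
      + l x * of_real (4 * H 1 s) * of_real ((x \<bullet> b) * (b \<bullet> v))" for b
    unfolding D_D_w s_def[symmetric] inner_commute[of v b] by (simp add: algebra_simps)
  then have "UNIV.L (w v) x =
      l v * of_real (4 * F 2 s) * of_real s + l v * of_real (2 * F 1 s) * of_real m
      + of_real (4 * H 1 s * (x \<bullet> v)) * l x + of_real (2 * H 0 s) * l v
      + l x * of_real (4 * H 2 s * (x \<bullet> v)) * of_real s
      + l x * of_real (2 * H 1 s * (x \<bullet> v)) * of_real m + l x * of_real (4 * H 1 s) * of_real (x \<bullet> v)"
    unfolding UNIV.L_def
    by (simp only: sum.distrib sum_distrib_left[symmetric] of_real_sum[symmetric] sums l_sum)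
  also have "\<dots> = l v * of_real (4 * s * F 2 s + 2 * m * F 1 s + 2 * H 0 s)
    + l x * of_real ((x \<bullet> v) * (4 * s * H 2 s + (2 * m + 8) * H 1 s))"
    by (simp add: algebra_simps)
  also have "\<dots> = l v * of_real ((t\<^sup>2 * s - 2 * t) * F 0 s) + l x * of_real ((x \<bullet> v) * ((t\<^sup>2 * s - 2 * t) * H 0 s))"
    using F_eq[of s] H_eq[of s] by (simp only: m_def)
  also have "\<dots> = of_real (t\<^sup>2 * s - 2 * t) * (of_real (F 0 s) * l v + l x * of_real (H 0 s * (x \<bullet> v)))"
    by (simp add: algebra_simps)
  finally show ?thesis unfolding w_def s_def[symmetric] .
qed

text \<open>The vector argument may depend on the point, because smoothness of boundary forms is
  tested on tangential vector fields.\<close>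

lemma Ck_on_w:
  assumes "open U" "\<And>k. Ck_on k U X"
  shows "Ck_on k U (\<lambda>x. w (X x) x)"
proof -
  have r: "Ck_on k U (\<lambda>x. x \<bullet> x)" for k
    by (rule Ck_on_bilinear[OF bounded_bilinear_inner assms(1)]) (rule Ck_on_bounded_linear[OF bounded_linear_ident])+
  have of_real: "Ck_on k U (\<lambda>x. of_real (g x) :: complex)" if "Ck_on k U g" for k g
    by (rule Ck_on_bounded_linear_compose[OF bounded_linear_of_real assms(1) that])
  have "Ck_on k U (\<lambda>x. F 0 (x \<bullet> x))" "Ck_on k U (\<lambda>x. H 0 (x \<bullet> x))"
    using Ck_on_real_compose[of F, OF F assms(1) r] Ck_on_real_compose[of H, OF H assms(1) r] by auto
  then show ?thesis
    unfolding w_def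
    by (intro Ck_on_add[OF assms(1)] Ck_on_bilinear[OF bounded_bilinear_mult assms(1)] of_real
        Ck_on_bounded_linear_compose[OF l(1) assms(1)] Ck_on_bounded_linear[OF l(1)]
        Ck_on_bilinear[OF bounded_bilinear_inner assms(1)] Ck_on_bounded_linear[OF bounded_linear_ident] assms(2))
qed

lemma w_smooth: "w v \<in> UNIV.smooth"
  using Ck_on_w[of UNIV "\<lambda>_. v"] by (simp add: UNIV.smooth_def Ck_on_const)

definition \<omega> :: "'a cform" where
  "\<omega> x vs = (if norm x \<le> 1 \<and> length vs = 1 then w (hd vs) x else 0)"

abbreviation A :: "'a \<Rightarrow> 'a" where
  "A x \<equiv> t *\<^sub>R J x"

lemma A: "linear A" "A x \<bullet> y = - (x \<bullet> A y)"
  using J by (simp_all add: linear_iff scaleR_add_right)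

lemma W_w: "UNIV.W w v x = w v x"
proof -
  have "w v x = w (\<Sum>b\<in>Basis. (v \<bullet> b) *\<^sub>R b) x" by (simp add: euclidean_representation)
  also have "\<dots> = UNIV.W w v x"
    unfolding UNIV.W_def by (simp only: linear_sum[OF w_linear] linear_cmul[OF w_linear])
  finally show ?thesis by simp
qed

lemma \<omega>_apply: "norm x \<le> 1 \<Longrightarrow> \<omega> x [v] = UNIV.W w v x"
  by (simp add: \<omega>_def W_w)

lemma \<omega>_length: "norm x \<le> 1 \<Longrightarrow> length vs \<noteq> 1 \<Longrightarrow> \<omega> x vs = 0"
  by (simp add: \<omega>_def)

sublocale UNIV: form_components UNIV w \<omega> A
  by unfold_locales (rule subset_UNIV w_smooth \<omega>_apply \<omega>_length A(2)
      linear_add[OF A(1)] linear_cmul[OF A(1)] | assumption)+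

text \<open>Since J x is orthogonal to x and l(J x) = -i l(x), the sum of
  \<open>D (A x) (w v)\<close> and \<open>w (A v)\<close>, which is a Lie derivative, is -i t times
  \<open>w v\<close>. Multiplied by -2i it becomes -2 t, which cancels against
  \<open>L_w\<close>.\<close>

lemma magnetic_laplacian_\<omega>:
  assumes "norm x \<le> 1"
  shows "magnetic_laplacian (cball 0 1) A \<omega> x vs = 0"
proof (cases "length vs = 1")
  case True
  then obtain v where vs: "vs = [v]" by (auto simp: length_Suc_conv)
  have W: "UNIV.W w v = w v" for v by (simp add: fun_eq_iff W_w)
  have "x \<bullet> J x = 0" using J(2)[of x x] by (simp add: inner_commute)
  moreover have "x \<bullet> J v = - (J x \<bullet> v)" by (simp add: J(2))
  ultimately show ?thesis
    unfolding vs UNIV.magnetic_laplacian_eq[OF assms] W L_w D_w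
    by (simp add: w_def l.scaleR l(2) J(3) scaleR_conv_of_real power2_eq_square algebra_simps)
next
  case False
  then show ?thesis
    by (rule UNIV.magnetic_laplacian_other[OF assms])
qed

lemma \<omega>_normal:
  assumes "norm x = 1"
  shows "w x x = 0"
proof -
  have "x \<bullet> x = 1" using assms by (simp add: dot_square_norm)
  then have "w x x = of_real (F 0 1 + H 0 1) * l x" by (simp add: w_def algebra_simps)
  then show ?thesis by (simp only: normal) simp
qed

lemma steklov_eigenvalue:
  assumes nonzero: "norm x0 = 1" "x0 \<bullet> v0 = 0" "l v0 \<noteq> 0" "F 0 1 \<noteq> 0"
  shows "steklov_eigenvalue 1 (cball 0 1) (\<lambda>x. - x) A \<sigma>"
proof -
  define \<psi> where "\<psi> = boundary_pullback (cball 0 1) (\<lambda>x. - x) \<omega>"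
  have frontier: "x \<in> frontier (cball 0 1) \<longleftrightarrow> norm x = 1" for x :: 'a by simp
  have tangent: "v \<in> tangent_space (\<lambda>x. - x) x \<longleftrightarrow> x \<bullet> v = 0" for v x :: 'a
    by (simp add: tangent_space_def inner_commute)
  have \<psi>_tangent: "\<psi> x [v] = w v x" if "norm x = 1" "x \<bullet> v = 0" for x v
    using that by (simp add: \<psi>_def boundary_pullback_def frontier tangent \<omega>_def)
  have \<psi>_zero: "\<psi> x vs = 0" if "norm x \<noteq> 1 \<or> length vs \<noteq> 1 \<or> \<not> set vs \<subseteq> tangent_space (\<lambda>x. - x) x" for x vs
    using that by (auto simp: \<psi>_def boundary_pullback_def frontier \<omega>_def)
  have form: "\<omega> \<in> forms 1 (cball 0 1)"
  proof -
    have "alternating_form 1 UNIV (\<omega> x)" if "norm x \<le> 1" for x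
      using that linear_add[OF w_linear] linear_cmul[OF w_linear]
      by (auto simp: alternating_form_def \<omega>_def length_Suc_conv)
    moreover have "smooth_on (cball 0 1) (\<lambda>x. \<omega> x vs)" for vs
    proof (cases "length vs = 1")
      case True
      then show ?thesis
        unfolding smooth_on_def using w_smooth[of "hd vs"]
        by (intro exI[of _ UNIV] exI[of _ "w (hd vs)"]) (auto simp: UNIV.smooth_def \<omega>_def)
    next
      case False
      then show ?thesis
        unfolding smooth_on_def
        by (intro exI[of _ UNIV] exI[of _ "\<lambda>_. 0"]) (auto simp: \<omega>_def Ck_on_const)
    qed
    ultimately show ?thesis by (auto simp: forms_def \<omega>_def fun_eq_iff)
  qed
  have boundary: "\<psi> \<in> boundary_forms 1 (cball 0 1) (\<lambda>x. - x)"
  proof -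
    have "alternating_form 1 (tangent_space (\<lambda>x. - x) x) (\<psi> x)" if x: "norm x = 1" for x
      unfolding alternating_form_def
    proof (intro conjI allI impI)
      show "\<psi> x vs = 0" if "length vs \<noteq> 1 \<or> \<not> set vs \<subseteq> tangent_space (\<lambda>x. - x) x" for vs
        using that by (intro \<psi>_zero) auto
      show "\<psi> x vs = 0" if "\<not> distinct vs" for vs
        using that by (intro \<psi>_zero) (auto simp: length_Suc_conv)
      fix us ws :: "'a list" and u v c
      assume "length us + length ws + 1 = 1 \<and> set us \<union> set ws \<union> {u, v} \<subseteq> tangent_space (\<lambda>x. - x) x"
      then have "us = []" "ws = []" and uv: "x \<bullet> u = 0" "x \<bullet> v = 0" by (auto simp: tangent)
      then show "\<psi> x (us @ (c *\<^sub>R u + v) # ws) = c *\<^sub>R \<psi> x (us @ u # ws) + \<psi> x (us @ v # ws)"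
        using x by (simp add: \<psi>_tangent inner_add_right linear_add[OF w_linear] linear_cmul[OF w_linear])
    qed
    moreover have "smooth_on (sphere 0 1) (\<lambda>x. \<psi> x (map (\<lambda>X. X x) Xs))"
      if Xs: "\<forall>X\<in>set Xs. smooth_on (sphere 0 1) X \<and> (\<forall>x\<in>sphere 0 1. X x \<in> tangent_space (\<lambda>x. - x) x)"
      for Xs :: "('a \<Rightarrow> 'a) list"
    proof (cases "length Xs = 1")
      case True
      then obtain X where X: "Xs = [X]" by (auto simp: length_Suc_conv)
      have "smooth_on (sphere 0 1) X" using Xs by (simp add: X)
      then obtain U Y where UY: "open U \<and> sphere 0 1 \<subseteq> U \<and> (\<forall>k. Ck_on k U Y) \<and> (\<forall>x\<in>sphere 0 1. Y x = X x)"
        unfolding smooth_on_def by (elim exE)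
      then have U: "open U" "sphere 0 1 \<subseteq> U" and Y: "\<And>k. Ck_on k U Y"
        and eq: "\<And>x. x \<in> sphere 0 1 \<Longrightarrow> Y x = X x"
        by simp_all
      have "w (Y x) x = \<psi> x [X x]" if "x \<in> sphere 0 1" for x
        using that Xs eq[OF that] \<psi>_tangent[of x "X x"] by (simp add: X tangent)
      then show ?thesis
        unfolding smooth_on_def X using U Ck_on_w[OF U(1) Y]
        by (intro exI[of _ U] exI[of _ "\<lambda>x. w (Y x) x"]) auto
    next
      case False
      then show ?thesis
        unfolding smooth_on_def
        by (intro exI[of _ UNIV] exI[of _ "\<lambda>_. 0"]) (auto simp: \<psi>_zero Ck_on_const)
    qed
    ultimately show ?thesis
      by (simp add: boundary_forms_def fun_eq_iff \<psi>_zero)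
  qed
  have "interior_product (\<lambda>x. - x) \<omega> x vs = 0" if x: "norm x = 1" for x vs
    using x \<omega>_normal[OF x] linear_neg[OF w_linear, of x x] by (simp add: interior_product_def \<omega>_def)
  then have ext: "steklov_extension 1 (cball 0 1) (\<lambda>x. - x) A \<psi> \<omega>"
    using form by (simp add: steklov_extension_def \<psi>_def frontier magnetic_laplacian_\<omega>)
  have "of_real \<sigma> * \<psi> x vs = - boundary_pullback (cball 0 1) (\<lambda>x. - x)
      (interior_product (\<lambda>x. - x) (magnetic_d (cball 0 1) A \<omega>)) x vs" for x vs
  proof (cases "norm x = 1 \<and> set vs \<subseteq> tangent_space (\<lambda>x. - x) x")
    case True
    then have x: "norm x = 1" "norm x \<le> 1" "x \<bullet> x = 1" by (simp_all add: dot_square_norm)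
    show ?thesis
    proof (cases "length vs = 1")
      case True
      then obtain v where vs: "vs = [v]" by (auto simp: length_Suc_conv)
      have v: "x \<bullet> v = 0" "v \<bullet> x = 0"
        using \<open>norm x = 1 \<and> _\<close> by (simp_all add: vs tangent inner_commute)
      have W: "UNIV.W w v = w v" for v by (simp add: fun_eq_iff W_w)
      have "w (- x) x = 0" using \<omega>_normal[OF x(1)] linear_neg[OF w_linear, of x x] by simp
      moreover have "x \<bullet> A (- x) = 0"
        using J(2)[of x x] by (simp add: linear_neg[OF J(1)] inner_commute)
      ultimately have "magnetic_d (cball 0 1) A \<omega> x [- x, v] = - of_real (2 * F 1 1 - H 0 1) * l v"
        unfolding UNIV.magnetic_d_eq[OF x(2)] W D_w by (simp add: x v algebra_simps)
      also have "\<dots> = - (of_real \<sigma> * w v x)"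
        unfolding eigen[symmetric] by (simp add: w_def x v)
      finally show ?thesis
        using x v by (simp add: vs \<psi>_tangent boundary_pullback_def frontier tangent interior_product_def)
    next
      case False
      then have "magnetic_d (cball 0 1) A \<omega> x (- x # vs) = 0" by (intro UNIV.magnetic_d_other[OF x(2)]) (simp add: numeral_2_eq_2)
      then show ?thesis using False by (simp add: \<psi>_zero boundary_pullback_def interior_product_def)
    qed
  next
    case False
    then have "\<psi> x vs = 0" by (intro \<psi>_zero) auto
    then show ?thesis using False by (auto simp: boundary_pullback_def frontier)
  qed
  then have "(\<psi>, \<lambda>x vs. of_real \<sigma> * \<psi> x vs) \<in> magnetic_steklov 1 (cball 0 1) (\<lambda>x. - x) A"
    unfolding magnetic_steklov_def using boundary ext by blast
  moreover have "\<psi> x0 [v0] \<noteq> 0"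
    using nonzero by (simp add: \<psi>_tangent w_def dot_square_norm)
  then have "\<psi> \<noteq> (\<lambda>_ _. 0)" by auto
  ultimately show ?thesis unfolding steklov_eigenvalue_def by blast
qed

end

section \<open>The rotation field on complex space\<close>

text \<open>Taylor coefficients of the solution of \<open>4 (s \<Phi>'' + b \<Phi>') = (s - 2) \<Phi>\<close> that is regular at 0.\<close>

fun radial_coeff :: "nat \<Rightarrow> nat \<Rightarrow> real" where
  "radial_coeff b 0 = 1"
| "radial_coeff b (Suc 0) = - 1 / (2 * real b)"
| "radial_coeff b (Suc (Suc k)) =
    (radial_coeff b k - 2 * radial_coeff b (Suc k)) / (4 * (real k + 2) * (real k + 1 + real b))"

text \<open>The numerator of the recurrence is at most 3/k! and the denominator at least 4 (k + 2)
  (k + 1), so a factor 3/4 is to spare. Factorial decay makes the power series entire.\<close>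

lemma radial_coeff_bound: "b \<ge> 1 \<Longrightarrow> \<bar>radial_coeff b k\<bar> \<le> 1 / fact k"
proof (induction b k rule: radial_coeff.induct)
  case (3 b k)
  define d where "d = 4 * (real k + 2) * (real k + 1 + real b)"
  have d: "d \<ge> 4 * ((real k + 2) * (real k + 1))" "d > 0"
    unfolding d_def mult.assoc using 3(3) by (auto intro!: mult_left_mono)
  have "1 / fact (Suc k) \<le> 1 / (fact k :: real)"
    by (intro divide_left_mono) (auto simp: fact_mono)
  then have "\<bar>radial_coeff b k - 2 * radial_coeff b (Suc k)\<bar> \<le> 3 / fact k"
    using 3 by simp
  then have "\<bar>radial_coeff b (Suc (Suc k))\<bar> \<le> 3 / fact k / d"
    unfolding radial_coeff.simps d_def[symmetric] abs_divide using d(2) by (simp only: abs_of_pos divide_right_mono less_imp_le)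
  also have "\<dots> \<le> 3 / fact k / (4 * ((real k + 2) * (real k + 1)))"
    using d by (intro divide_left_mono) auto
  also have "\<dots> = 3 / 4 * (1 / fact (Suc (Suc k)))" by (simp add: field_simps)
  also have "\<dots> \<le> 1 / fact (Suc (Suc k))"
  proof -
    have "(0::real) \<le> 1 / fact (Suc (Suc k))" by simp
    then show ?thesis by linarith
  qed
  finally show ?case .
qed auto

text \<open>At s = 0 the equation reads 4 b \<Phi>'(0) = -2 \<Phi>(0), so the normalization forces
  the negative slope; this sign is what lowers the eigenvalue.\<close>

lemma radial_function:
  assumes b: "b \<ge> 1"
  obtains \<Phi> :: "nat \<Rightarrow> real \<Rightarrow> real" where
    "\<And>k s. (\<Phi> k has_real_derivative \<Phi> (Suc k) s) (at s)"
    "\<And>s. 4 * (s * \<Phi> 2 s + real b * \<Phi> 1 s) = (s - 2) * \<Phi> 0 s"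
    "\<Phi> 0 0 = 1" "\<Phi> 1 0 < 0"
proof -
  define f where "f = Abs_fps (radial_coeff b)"
  have "fps_conv_radius f \<ge> \<infinity>"
    unfolding fps_conv_radius_def
  proof (rule conv_radius_geI_ex')
    fix r :: real assume r: "0 < r"
    show "summable (\<lambda>n. fps_nth f n * of_real r ^ n)"
    proof (rule summable_comparison_test'[OF summable_exp[of r]])
      show "norm (fps_nth f n * of_real r ^ n) \<le> inverse (fact n) * r ^ n" for n
        using mult_right_mono[OF radial_coeff_bound[OF b, of n], of "r ^ n"] r
        by (simp add: f_def abs_mult inverse_eq_divide)
    qed
  qed
  then have f: "fps_conv_radius f = \<infinity>" by simp
  have fk: "fps_conv_radius ((fps_deriv ^^ k) f) = \<infinity>" for k
  proof (induction k)
    case (Suc k)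
    then show ?case using fps_conv_radius_deriv[of "(fps_deriv ^^ k) f"] by simp
  qed (simp add: f)
  define \<Phi> where "\<Phi> k = eval_fps ((fps_deriv ^^ k) f)" for k
  have d: "(\<Phi> k has_real_derivative \<Phi> (Suc k) s) (at s)" for k s
    unfolding \<Phi>_def using has_field_derivative_eval_fps[of s "(fps_deriv ^^ k) f"] fk by simp
  define f1 where "f1 = fps_deriv f"
  define f2 where "f2 = fps_deriv f1"
  have r: "fps_conv_radius f1 = \<infinity>" "fps_conv_radius f2 = \<infinity>"
    using fk[of 1] fk[of 2] by (simp_all add: f1_def f2_def numeral_2_eq_2)
  have rX: "fps_conv_radius (fps_X * f2) = \<infinity>" "fps_conv_radius (fps_X * f) = \<infinity>"
    "fps_conv_radius (fps_const (real b) * f1) = \<infinity>" "fps_conv_radius (2 * f) = \<infinity>"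
    using fps_conv_radius_mult[of fps_X f2] fps_conv_radius_mult[of fps_X f]
      fps_conv_radius_mult[of "fps_const (real b)" f1] fps_conv_radius_mult[of 2 f] by (simp_all add: r f)
  have rS: "fps_conv_radius (fps_X * f2 + fps_const (real b) * f1) = \<infinity>"
    using fps_conv_radius_add[of "fps_X * f2" "fps_const (real b) * f1"] by (simp add: rX)
  have "4 * (fps_X * f2 + fps_const (real b) * f1) = fps_X * f - 2 * f"
  proof (rule fps_ext)
    fix k
    have n4: "fps_nth (4 * g) k = 4 * fps_nth g k" "fps_nth (2 * g) k = 2 * fps_nth g k" for g :: "real fps"
      by (simp_all add: numeral_fps_const)
    show "fps_nth (4 * (fps_X * f2 + fps_const (real b) * f1)) k = fps_nth (fps_X * f - 2 * f) k"
    proof (cases k)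
      case 0
      then show ?thesis using b by (simp add: n4 f1_def f_def)
    next
      case (Suc j)
      have "4 * (real j + 2) * (real j + 1 + real b) \<noteq> 0" using b by auto
      then have "4 * (real j + 2) * (real j + 1 + real b) * radial_coeff b (Suc (Suc j)) =
          radial_coeff b j - 2 * radial_coeff b (Suc j)" by simp
      then show ?thesis
        unfolding Suc fps_sub_nth n4
        by (simp add: f1_def f2_def f_def del: radial_coeff.simps) (simp add: algebra_simps del: radial_coeff.simps)
    qed
  qed
  then have ev: "eval_fps (4 * (fps_X * f2 + fps_const (real b) * f1)) s = eval_fps (fps_X * f - 2 * f) s" for s
    by simp
  have ode: "4 * (s * \<Phi> 2 s + real b * \<Phi> 1 s) = (s - 2) * \<Phi> 0 s" for s
  proof -
    have "\<Phi> 0 = eval_fps f" "\<Phi> 1 = eval_fps f1" "\<Phi> 2 = eval_fps f2"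
      by (simp_all add: \<Phi>_def f1_def f2_def numeral_2_eq_2)
    then show ?thesis
      using ev[of s]
      by (simp add: eval_fps_mult eval_fps_add eval_fps_diff r f rX rS left_diff_distrib del: distrib_left_numeral)
  qed
  have "\<Phi> 0 0 = 1" by (simp add: \<Phi>_def eval_fps_at_0 f_def)
  moreover have "\<Phi> 1 0 < 0" using b by (simp add: \<Phi>_def eval_fps_at_0 f_def)
  ultimately show thesis using that[of \<Phi>] d ode by blast
qed


lemma deriv_scaled_mult:
  assumes "\<And>k s. (G k has_real_derivative G (Suc k) s) (at s)"
  shows "((\<lambda>s. t ^ k * G k (t * s)) has_real_derivative t ^ Suc k * G (Suc k) (t * s)) (at (s::real))"
proof -
  have "((\<lambda>s. G k (t * s)) has_real_derivative G (Suc k) (t * s) * t) (at s)"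
    by (rule DERIV_chain'[OF _ assms]) (auto intro!: derivative_eq_intros)
  then show ?thesis by (auto intro!: derivative_eq_intros)
qed

section \<open>The explicit eigenvalue of the rotation field\<close>

context
  fixes J :: "(real \<times> real) ^ 'n \<Rightarrow> (real \<times> real) ^ 'n"
  assumes J: "J = (\<lambda>x. \<chi> j. (- snd (x $ j), fst (x $ j)))"
begin

lemma rotation_linear: "linear J"
  by (rule linearI) (simp_all add: J vec_eq_iff)

lemma rotation_skew: "J x \<bullet> y = - (x \<bullet> J y)"
  by (simp add: J inner_vec_def inner_prod_def flip: sum_negf)

lemma rotation_isometry: "J x \<bullet> J x = x \<bullet> x"
  by (simp add: J inner_vec_def inner_prod_def add.commute)

lemma rotation_norm: "norm (J x) = norm x"
  by (simp add: norm_eq_sqrt_inner rotation_isometry)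

text \<open>In dimension 2n, 2n l(x) (x . v) - |x|^2 l(v) is a harmonic polynomial of degree 2 in x.
  The form is a combination of the constant l(v) times P(t |x|^2) and this polynomial times Q(t
  |x|^2); a harmonic factor of degree d raises the parameter of the radial equation from n to n +
  d.\<close>

lemma steklov_eigenvalue_rotation:
  fixes P Q :: "nat \<Rightarrow> real \<Rightarrow> real" and n :: real
  defines "n \<equiv> real CARD('n)"
  assumes P: "\<And>k s. (P k has_real_derivative P (Suc k) s) (at s)"
    and Q: "\<And>k s. (Q k has_real_derivative Q (Suc k) s) (at s)"
    and P_eq: "\<And>s. 4 * (s * P 2 s + n * P 1 s) = (s - 2) * P 0 s"
    and Q_eq: "\<And>s. 4 * (s * Q 2 s + (n + 2) * Q 1 s) = (s - 2) * Q 0 s"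
    and pos: "P 0 t > 0" "Q 0 t > 0"
  shows "steklov_eigenvalue 1 (cball 0 1) (\<lambda>x. - x) (\<lambda>x. t *\<^sub>R J x)
    (1 + 1 / n + t * ((2 - 1 / n) * (P 1 t / P 0 t) + 1 / n * (Q 1 t / Q 0 t)))"
proof -
  have n: "n > 0" by (simp add: n_def)
  have dim: "real DIM((real \<times> real) ^ 'n) = 2 * n" by (simp add: n_def)
  define a :: 'n where "a = undefined"
  define l where "l x = Complex (fst (x $ a)) (- snd (x $ a))" for x :: "(real \<times> real) ^ 'n"
  \<comment> \<open>The normal condition p P + (2n - 1) c Q = 0 at |x| = 1 fixes \<open>p\<close>
    and \<open>c\<close> up to a common factor; this scaling gives F = 2 P Q there.\<close>
  define p where "p = (2 - 1 / n) * Q 0 t"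
  define c where "c = - P 0 t / n"
  \<comment> \<open>The k-th derivative of p P(t s) - c s Q(t s) by the Leibniz rule; at k = 0 the
    truncated \<open>k - 1\<close> is multiplied by 0.\<close>
  define F where "F k s = p * (t ^ k * P k (t * s)) -
    c * (s * (t ^ k * Q k (t * s)) + real k * (t ^ (k - 1) * Q (k - 1) (t * s)))" for k s
  define H where "H k s = 2 * (n * c) * (t ^ k * Q k (t * s))" for k s
  define \<sigma> where "\<sigma> = 1 + 1 / n + t * ((2 - 1 / n) * (P 1 t / P 0 t) + 1 / n * (Q 1 t / Q 0 t))"
  interpret explicit_form J l t \<sigma> F H
  proof (rule explicit_form.intro)
    show "linear J" by (rule rotation_linear)
    show "J x \<bullet> y = - (x \<bullet> J y)" "J x \<bullet> J x = x \<bullet> x" for x y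
      by (rule rotation_skew rotation_isometry)+
    have "linear l" by (rule linearI) (simp_all add: l_def complex_eq_iff)
    then show "bounded_linear l" by (rule linear_conv_bounded_linear[THEN iffD1])
    show "l (J x) = - \<i> * l x" for x by (simp add: l_def J complex_eq_iff)
    show "(H k has_real_derivative H (Suc k) s) (at s)" for k s
      unfolding H_def by (rule DERIV_cmult[OF deriv_scaled_mult[of Q, OF Q]])
    show "(F k has_real_derivative F (Suc k) s) (at s)" for k s
    proof -
      have 1: "((\<lambda>s. s * (t ^ k * Q k (t * s))) has_real_derivative
          s * (t ^ Suc k * Q (Suc k) (t * s)) + t ^ k * Q k (t * s)) (at s)"
        by (rule DERIV_cong[OF DERIV_mult[OF DERIV_ident deriv_scaled_mult[of Q, OF Q]]]) simp
      have 2: "((\<lambda>s. real k * (t ^ (k - 1) * Q (k - 1) (t * s))) has_real_derivative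
          real k * (t ^ k * Q k (t * s))) (at s)"
        using DERIV_cmult[OF deriv_scaled_mult[of Q, OF Q, of t "k - 1" s], of "real k"] by (cases k) simp_all
      have "F (Suc k) s = p * (t ^ Suc k * P (Suc k) (t * s)) -
          c * (s * (t ^ Suc k * Q (Suc k) (t * s)) + t ^ k * Q k (t * s) + real k * (t ^ k * Q k (t * s)))"
        by (simp add: F_def algebra_simps)
      then show ?thesis
        unfolding F_def[of k, abs_def]
        using DERIV_diff[OF DERIV_cmult[OF deriv_scaled_mult[of P, OF P, of t k s], of p]
            DERIV_cmult[OF DERIV_add[OF 1 2], of "c"]] by (simp only:)
    qed
    fix s :: real
    show "4 * s * H 2 s + (2 * real DIM((real \<times> real) ^ 'n) + 8) * H 1 s = (t\<^sup>2 * s - 2 * t) * H 0 s"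
    proof -
      have "4 * s * H 2 s + (2 * (2 * n) + 8) * H 1 s =
          2 * (n * c) * t * (4 * (t * s * Q 2 (t * s) + (n + 2) * Q 1 (t * s)))"
        by (simp add: H_def power2_eq_square algebra_simps)
      then show ?thesis unfolding dim Q_eq by (simp add: H_def power2_eq_square algebra_simps)
    qed
    show "4 * s * F 2 s + 2 * real DIM((real \<times> real) ^ 'n) * F 1 s + 2 * H 0 s = (t\<^sup>2 * s - 2 * t) * F 0 s"
    proof -
      have "4 * s * F 2 s + 2 * (2 * n) * F 1 s + 2 * H 0 s =
          p * t * (4 * (t * s * P 2 (t * s) + n * P 1 (t * s)))
          - c * s * t * (4 * (t * s * Q 2 (t * s) + (n + 2) * Q 1 (t * s)))"
        by (simp add: F_def H_def power2_eq_square algebra_simps)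
      then show ?thesis unfolding dim P_eq Q_eq by (simp add: F_def power2_eq_square algebra_simps)
    qed
  next
    show "F 0 1 + H 0 1 = 0" using n by (simp add: F_def H_def p_def c_def field_simps)
    show "\<sigma> * F 0 1 = 2 * F 1 1 - H 0 1"
      using n pos by (simp add: \<sigma>_def F_def H_def p_def c_def field_simps)
  qed
  have "steklov_eigenvalue 1 (cball 0 1) (\<lambda>x. - x) (\<lambda>x. t *\<^sub>R J x) \<sigma>"
  proof (rule steklov_eigenvalue[of "axis a (1, 0)" "axis a (0, 1)"])
    show "F 0 1 \<noteq> 0"
    proof -
      have "F 0 1 = 2 * (P 0 t * Q 0 t)" using n by (simp add: F_def p_def c_def field_simps)
      then show ?thesis using pos by simp
    qed
  qed (simp_all add: norm_eq_sqrt_inner inner_axis_axis l_def complex_eq_iff)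
  then show ?thesis by (simp only: \<sigma>_def)
qed

end

section \<open>Comparison of the two lowest eigenvalues\<close>

theorem theorem1p3:
  fixes M :: "((real \<times> real) ^ 'n) set"
    and \<nu> \<eta> :: "(real \<times> real) ^ 'n \<Rightarrow> (real \<times> real) ^ 'n"
  assumes M: "M = cball 0 1"
    and \<nu>: "\<nu> = (\<lambda>x. - x)"
    and \<eta>: "\<eta> = (\<lambda>x. \<chi> j. (- snd (x $ j), fst (x $ j)))"
  shows "\<exists>\<epsilon>>0. \<forall>t. 0 < t \<and> t < \<epsilon> \<longrightarrow>
    lowest_steklov_eigenvalue 1 M \<nu> (\<lambda>x. t *\<^sub>R \<eta> x) <
    lowest_steklov_eigenvalue 1 M \<nu> (\<lambda>_. 0)"
proof -
  define n where "n = real CARD('n)"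
  have n: "n \<ge> 1" unfolding n_def by (simp add: Suc_leI)
  have dim: "real DIM((real \<times> real) ^ 'n) = 2 * n" by (simp add: n_def)
  obtain P :: "nat \<Rightarrow> real \<Rightarrow> real" where P: "\<And>k s. (P k has_real_derivative P (Suc k) s) (at s)"
    and P_eq: "\<And>s. 4 * (s * P 2 s + n * P 1 s) = (s - 2) * P 0 s" and P0: "P 0 0 = 1" "P 1 0 < 0"
    using radial_function[of "CARD('n)"] by (auto simp: n_def Suc_leI)
  obtain Q :: "nat \<Rightarrow> real \<Rightarrow> real" where Q: "\<And>k s. (Q k has_real_derivative Q (Suc k) s) (at s)"
    and Q_eq: "\<And>s. 4 * (s * Q 2 s + (n + 2) * Q 1 s) = (s - 2) * Q 0 s" and Q0: "Q 0 0 = 1" "Q 1 0 < 0"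
    using radial_function[of "CARD('n) + 2"] by (auto simp: n_def add.commute)
  note eig = steklov_eigenvalue_rotation[OF \<eta> P Q P_eq[unfolded n_def] Q_eq[unfolded n_def], folded n_def]
  have tend: "(G k \<longlongrightarrow> G k 0) (nhds 0)" if "\<And>k s. (G k has_real_derivative G (Suc k) s) (at s)"
    for G :: "nat \<Rightarrow> real \<Rightarrow> real" and k
    using DERIV_isCont[OF that] by (simp add: isCont_def tendsto_at_iff_tendsto_nhds)
  have "\<forall>\<^sub>F t in nhds 0. P 0 t > 0 \<and> Q 0 t > 0 \<and> P 1 t < 0 \<and> Q 1 t < 0"
    using P0 Q0
    by (intro eventually_conj order_tendstoD[OF tend[of P, OF P]] order_tendstoD[OF tend[of Q, OF Q]]) simp_all
  then obtain \<delta> where \<delta>: "\<delta> > 0"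
    and signs: "\<And>t. \<bar>t\<bar> < \<delta> \<Longrightarrow> P 0 t > 0 \<and> Q 0 t > 0 \<and> P 1 t < 0 \<and> Q 1 t < 0"
    by (auto simp: eventually_nhds_metric dist_real_def)
  let ?S = "\<lambda>A. {\<sigma>. steklov_eigenvalue 1 M \<nu> A \<sigma>}"
  have "1 + 1 / n \<le> Inf (?S (\<lambda>_. 0))"
  proof (rule cInf_greatest)
    \<comment> \<open>The explicit form at \<open>t = 0\<close> shows that the set is nonempty;
      otherwise a bound on its elements would say nothing about \<open>Inf\<close>.\<close>
    have "steklov_eigenvalue 1 M \<nu> (\<lambda>_. 0) (1 + 1 / n)"
      using eig[of 0] P0 Q0 by (simp add: M \<nu>)
    then show "?S (\<lambda>_. 0) \<noteq> {}" by blast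
    fix \<sigma> assume "\<sigma> \<in> ?S (\<lambda>_. 0)"
    then have "steklov_eigenvalue 1 (cball 0 1) (\<lambda>x. - x) (\<lambda>_. 0 :: (real \<times> real) ^ 'n) \<sigma>" by (simp add: M \<nu>)
    moreover have "DIM((real \<times> real) ^ 'n) \<ge> 2"
      using zero_less_card_finite[where 'a = 'n] by (simp del: zero_less_card_finite)
    ultimately have "\<sigma> \<ge> 1 + 2 / real DIM((real \<times> real) ^ 'n)" by (rule steklov_eigenvalue_ge)
    moreover have "2 / real DIM((real \<times> real) ^ 'n) = 1 / n" unfolding dim by simp
    ultimately show "1 + 1 / n \<le> \<sigma>" by simp
  qed
  \<comment> \<open>The bound 1/2 gives 4 t < 2 n for every n \<ge> 1, as the lower bound on the
    spectrum requires; \<open>\<delta>\<close> controls the signs of P, Q and their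
    derivatives.\<close>
  moreover have "Inf (?S (\<lambda>x. t *\<^sub>R \<eta> x)) < 1 + 1 / n" if t: "0 < t" "t < min \<delta> (1 / 2)" for t
  proof -
    have sg: "P 0 t > 0" "Q 0 t > 0" "P 1 t < 0" "Q 1 t < 0" using signs[of t] t by auto
    define \<sigma> where "\<sigma> = 1 + 1 / n + t * ((2 - 1 / n) * (P 1 t / P 0 t) + 1 / n * (Q 1 t / Q 0 t))"
    have "\<sigma> \<in> ?S (\<lambda>x. t *\<^sub>R \<eta> x)"
      using eig[OF sg(1,2)] by (simp add: \<sigma>_def M \<nu>)
    moreover have "bdd_below (?S (\<lambda>x. t *\<^sub>R \<eta> x))"
    proof (rule bdd_belowI[of _ 0])
      fix \<sigma> assume "\<sigma> \<in> ?S (\<lambda>x. t *\<^sub>R \<eta> x)"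
      then have e: "steklov_eigenvalue 1 (cball 0 1) (\<lambda>x. - x) (\<lambda>x. t *\<^sub>R \<eta> x) \<sigma>" by (simp add: M \<nu>)
      show "0 \<le> \<sigma>"
      proof (rule steklov_eigenvalue_nonneg[OF _ _ _ _ e])
        show "linear (\<lambda>x. t *\<^sub>R \<eta> x)" using rotation_linear[OF \<eta>] by (rule linear_compose_scale_right)
        show "(t *\<^sub>R \<eta> x) \<bullet> y = - (x \<bullet> (t *\<^sub>R \<eta> y))" for x y using rotation_skew[OF \<eta>] by simp
        show "norm (t *\<^sub>R \<eta> x) \<le> t * norm x" for x using rotation_norm[OF \<eta>] t by simp
        show "4 * t < real DIM((real \<times> real) ^ 'n)" unfolding dim using t n by simp
      qed
    qed
    ultimately have "Inf (?S (\<lambda>x. t *\<^sub>R \<eta> x)) \<le> \<sigma>" by (rule cInf_lower)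
    also have "\<sigma> < 1 + 1 / n"
    proof -
      have "2 - 1 / n > 0" "1 / n > 0" using n by (simp_all add: field_simps)
      moreover have "P 1 t / P 0 t < 0" "Q 1 t / Q 0 t < 0" using sg by (simp_all add: divide_neg_pos)
      ultimately have "(2 - 1 / n) * (P 1 t / P 0 t) < 0" "1 / n * (Q 1 t / Q 0 t) < 0"
        by (simp_all only: mult_pos_neg)
      then have "t * ((2 - 1 / n) * (P 1 t / P 0 t) + 1 / n * (Q 1 t / Q 0 t)) < 0"
        by (intro mult_pos_neg[OF t(1)] add_neg_neg)
      then show ?thesis by (simp add: \<sigma>_def)
    qed
    finally show ?thesis .
  qed
  ultimately show ?thesis
    unfolding lowest_steklov_eigenvalue_def
    using \<delta> by (intro exI[of _ "min \<delta> (1 / 2)"]) force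
qed

end
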